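(* If the preference $\succsim$ on $\Delta(X)$ has an SMEU representation, then there exists a unique $\mathcal T^*\in\mathbb T(\succsim)$ such that $\mathcal T^*$ is simpler than $\mathcal T$ for all $\mathcal T\in\mathbb T(\succsim)$.
   Context: **Setup.** $N>1$ is an integer and $I=\{1,\dots,N\}$. For each $i\in I$, $X_i=[\underline x_i,\overline x_i]\subseteq\mathbb R$ is a nondegenerate compact interval. For $A\subseteq I$: $X_A=\prod_{i\in A}X_i$, $X=X_I$, $A^{\mathsf c}=I\setminus A$; $X_\emptyset$ is trivial and arguments in it are ignored. $\Delta(Z)$ is the set of finitely supported probability measures on $Z$; $\delta_x$ is the point mass at $x$, identified with $x$. $p_A$ is the marginal of $p$ on the coordinates in $A$, $x_A$ the restriction of $x$ to $A$; $p_{A|x}$ is the conditional distribution of the coordinates in $A$ given that the coordinates in $B$ (disjoint from $A$) equal $x\in X_B$ ($p_{A|x}=p_A$ if $B=\emptyset$), and $\mathbb E^p_{A|x}$ is expectation under $p_{A|x}$. For disjoint index sets, $(p_1,\dots,p_n)$ is the product measure. Vectors are ordered coordinatewise; $g$ is strictly increasing if $y\geqslant y'$, $y\ne y'$ imply $g(y)>g(y')$. $\succsim$ is a binary relation on $\Delta(X)$. For nonempty $A\subseteq I$ and $x\in X_{A^{\mathsf c}}$, the conditional preference $\succsim_x$ on $\Delta(X_A)$ is: $p\succsim_x q\iff(p,x)\succsim(q,x)$. **RCT.** A rooted clustered tree (RCT) is a pair $\mathcal T=(\mathcal P,E)$, where $\mathcal P$ is a partition of $I$ and $E$ is the set of directed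 edges of an out-tree (underlying undirected graph connected and acyclic, with a unique directed path from the root to every other vertex) on $\mathcal P_o=\mathcal P\cup\{o\}$, with $o$ an additional vertex, the root. $c(A)$, $a(A)$, $d(A)$ are the sets of children, ancestors (including $o$ if $A\neq o$), and descendants of $A\in\mathcal P_o$; $\bar a(A)=\bigcup_{B\in a(A)\setminus\{o\}}B$, $\bar d(A)=\bigcup_{B\in d(A)}B$. The root carries no dimensions: $\bar a(o)=\emptyset$, and "$o\cup\bar d(o)$" means $I$ (with complement $\emptyset$). **SMEU representation.** $\succsim$ has an SMEU representation $(\mathcal T,(u^A)_{A\in\mathcal P_o})$ if there are an RCT $\mathcal T=(\mathcal P,E)$ and functions $u^o:\mathbb R^{c(o)}\to\mathbb R$ and $u^A:X_{\bar a(A)}\times X_A\times\mathbb R^{c(A)}\to\mathbb R$ ($A\in\mathcal P$; the factor $\mathbb R^{c(A)}$ is dropped if $c(A)=\emptyset$) such that, defining recursively for $A\in\mathcal P$, $x\in X_{\bar a(A)}$, $p\in\Delta(X)$ $$U^A_x(p)=\mathbb E^p_{A|x}\,u^A\big(x,y,(U^B_{(x,y)}(p))_{B\in c(A)}\big)$$ ($y\in X_A$ is the integration variable; the value is $0$ if $x\notin\operatorname{supp}(p_{\bar a(A)})$) and $U^o(p)=u^o((U^B(p))_{B\in c(o)})$, the following hold for all $A\in\mathcal P_o$, $x\in X_{\bar a(A)}$, and $z\in X_{(A\cup\bar d(A))^{\mathsf c}}$ with $z_{\bar a(A)}=x$: (1) $p\succsim_z q\iff U^A_x(\delta_z,p)\geqslant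 U^A_x(\delta_z,q)$ for all $p,q\in\Delta(X_{A\cup\bar d(A)})$; (2) $U^A_x(\delta_{(z,y)})$ is continuous and strictly increasing in $y\in X_{A\cup\bar d(A)}$. $\mathbb T(\succsim)$ is the set of RCTs $\mathcal T$ such that $(\mathcal T,(u^A)_{A\in\mathcal P_o})$ is an SMEU representation of $\succsim$ for some $(u^A)_{A\in\mathcal P_o}$. **Simplicity.** For an RCT $\mathcal T=(\mathcal P,E)$ and $i\in A\in\mathcal P$, let $\kappa^{\mathcal T}(i)=|a(A)|$ (the depth of the vertex containing $i$). A partition $\mathcal P'$ is finer than $\mathcal P$ if every element of $\mathcal P'$ is contained in some element of $\mathcal P$ (equality of partitions allowed). $\mathcal T=(\mathcal P,E)$ is simpler than $\mathcal T'=(\mathcal P',E')$ if (i) $\kappa^{\mathcal T}(i)\leqslant\kappa^{\mathcal T'}(i)$ for all $i\in I$, and (ii) if $\kappa^{\mathcal T}(i)=\kappa^{\mathcal T'}(i)$ for all $i\in I$, then $\mathcal P'$ is finer than $\mathcal P$. (So every RCT is simpler than itself in this weak sense.) *)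

theory Defs
  imports "HOL-Probability.Probability"
begin

section \<open>Points and lotteries\<close>

text \<open>
  A point of \<open>X\<^sub>A = (\<Prod>i\<in>A. X\<^sub>i)\<close> is an element of \<^term>\<open>PiE A X\<close>, i.e. a function that is
  \<^term>\<open>undefined\<close> outside \<open>A\<close>.  Hence \<open>X\<close> over the empty set is the singleton
  \<open>{\<lambda>_. undefined}\<close>.
\<close>

type_synonym point = "nat \<Rightarrow> real"

definition lotteries :: "point set \<Rightarrow> point pmf set" where
  "lotteries Z = {p. finite (set_pmf p) \<and> set_pmf p \<subseteq> Z}"

definition marginal :: "nat set \<Rightarrow> point pmf \<Rightarrow> point pmf" where
  "marginal A p = map_pmf (\<lambda>f. restrict f A) p"

text \<open>\<open>p\<^bsub>A|x\<^esub>\<close> for \<open>x \<in> X\<^sub>B\<close>; meaningful only for \<open>x\<close> in the support of the marginal on \<open>B\<close>.\<close>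

definition cond_marginal :: "nat set \<Rightarrow> nat set \<Rightarrow> point \<Rightarrow> point pmf \<Rightarrow> point pmf" where
  "cond_marginal A B x p = marginal A (cond_pmf p {f. restrict f B = x})"

definition prod_lottery :: "nat set \<Rightarrow> point pmf \<Rightarrow> nat set \<Rightarrow> point pmf \<Rightarrow> point pmf" where
  "prod_lottery A p B q = map_pmf (merge A B) (pair_pmf p q)"

definition cond_pref ::
    "nat set \<Rightarrow> (point pmf \<Rightarrow> point pmf \<Rightarrow> bool) \<Rightarrow> nat set \<Rightarrow> point \<Rightarrow> point pmf \<Rightarrow> point pmf \<Rightarrow> bool"
  where
  "cond_pref I pref A x p q \<longleftrightarrow>
     pref (prod_lottery A p (I - A) (return_pmf x)) (prod_lottery A q (I - A) (return_pmf x))"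


section \<open>Rooted clustered trees\<close>

text \<open>The additional root vertex is \<^term>\<open>None\<close>; the vertex of a cell \<open>A\<close> is \<^term>\<open>Some A\<close>.\<close>

type_synonym vertex = "nat set option"
type_synonym rct = "nat set set \<times> (vertex \<times> vertex) set"

definition vertices :: "nat set set \<Rightarrow> vertex set" where
  "vertices P = insert None (Some ` P)"

definition directed_path :: "('v \<times> 'v) set \<Rightarrow> 'v \<Rightarrow> 'v \<Rightarrow> 'v list \<Rightarrow> bool" where
  "directed_path E a b vs \<longleftrightarrow> vs \<noteq> [] \<and> hd vs = a \<and> last vs = b \<and> distinct vs \<and>
     successively (\<lambda>v w. (v, w) \<in> E) vs"

definition undirected_cycle :: "('v \<times> 'v) set \<Rightarrow> 'v list \<Rightarrow> bool" where
  "undirected_cycle E vs \<longleftrightarrow> length vs \<ge> 3 \<and> distinct vs \<and>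
     successively (\<lambda>v w. (v, w) \<in> E \<union> E\<inverse>) vs \<and> (last vs, hd vs) \<in> E \<union> E\<inverse>"

text \<open>
  Asymmetry says that \<open>E\<close> is an orientation of a simple graph: it excludes loops and pairs of
  opposite edges, which \<^const>\<open>undirected_cycle\<close> does not detect.
\<close>

definition is_rct :: "nat set \<Rightarrow> rct \<Rightarrow> bool" where
  "is_rct I T \<longleftrightarrow> (case T of (P, E) \<Rightarrow>
     partition_on I P \<and>
     E \<subseteq> vertices P \<times> vertices P \<and> asym E \<and>
     (\<forall>v\<in>vertices P. \<forall>w\<in>vertices P. (v, w) \<in> (E \<union> E\<inverse>)\<^sup>*) \<and>
     (\<nexists>vs. undirected_cycle E vs) \<and>
     (\<forall>v\<in>vertices P. v \<noteq> None \<longrightarrow> (\<exists>!vs. directed_path E None v vs)))"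

text \<open>The root is never a child, so children are represented as cells.\<close>

definition children :: "rct \<Rightarrow> vertex \<Rightarrow> nat set set" where
  "children T v = {B. (v, Some B) \<in> snd T}"

definition ancestors :: "rct \<Rightarrow> vertex \<Rightarrow> vertex set" where
  "ancestors T v = {w. (w, v) \<in> (snd T)\<^sup>+}"

definition descendants :: "rct \<Rightarrow> vertex \<Rightarrow> vertex set" where
  "descendants T v = {w. (v, w) \<in> (snd T)\<^sup>+}"

definition anc_dims :: "rct \<Rightarrow> vertex \<Rightarrow> nat set" where
  "anc_dims T v = \<Union>{B. Some B \<in> ancestors T v}"

text \<open>\<open>A \<union> d\<^sup>-(A)\<close>; at the root this is the whole index set.\<close>

definition subtree_dims :: "rct \<Rightarrow> vertex \<Rightarrow> nat set" where
  "subtree_dims T v = (case v of None \<Rightarrow> {} | Some A \<Rightarrow> A) \<union> \<Union>{B. Some B \<in> descendants T v}"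

lemma rtrancl_imp_directed_path:
  assumes "(a, b) \<in> E\<^sup>*"
  shows "\<exists>vs. directed_path E a b vs"
  using assms
proof (induction rule: rtrancl_induct)
  case base
  have "directed_path E a a [a]"
    by (simp add: directed_path_def)
  then show ?case by blast
next
  case (step b c)
  then obtain vs where vs: "directed_path E a b vs" by blast
  show ?case
  proof (cases "c \<in> set vs")
    case True
    then obtain xs ys where "vs = xs @ c # ys" by (meson split_list)
    then have "directed_path E a c (xs @ [c])"
      using vs by (auto simp: directed_path_def successively_append_iff hd_append split: if_splits)
    then show ?thesis by blast
  next
    case False
    then have "directed_path E a c (vs @ [c])"
      using vs step.hyps by (auto simp: directed_path_def successively_append_iff)
    then show ?thesis by blast
  qed
qed

lemma is_rct_acyclic:
  assumes "is_rct I T"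
  shows "acyclic (snd T)"
proof (rule acyclicI, intro allI notI)
  fix v assume "(v, v) \<in> (snd T)\<^sup>+"
  then obtain w where w: "(v, w) \<in> snd T" "(w, v) \<in> (snd T)\<^sup>*"
    by (meson tranclD)
  obtain vs where vs: "directed_path (snd T) w v vs"
    using rtrancl_imp_directed_path[OF w(2)] by blast
  have as: "asym (snd T)" and nc: "\<not> undirected_cycle (snd T) vs"
    using assms by (auto simp: is_rct_def split: prod.splits)
  have "length vs < 3"
  proof (rule ccontr)
    assume "\<not> length vs < 3"
    moreover have "successively (\<lambda>v w. (v, w) \<in> snd T \<union> (snd T)\<inverse>) vs"
      using vs by (auto simp: directed_path_def elim!: successively_mono)
    ultimately have "undirected_cycle (snd T) vs"
      using vs w(1) by (auto simp: undirected_cycle_def directed_path_def)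
    then show False using nc by blast
  qed
  then consider "vs = [w]" | "vs = [w, v]"
    using vs by (cases vs; cases "tl vs") (auto simp: directed_path_def)
  then show False
    using vs w(1) as by cases (auto simp: directed_path_def dest: asymD)
qed

lemma is_rct_wf:
  assumes "is_rct I T" "finite I"
  shows "wf ((snd T)\<inverse>)"
proof -
  have "finite (fst T)"
    using assms by (auto simp: is_rct_def intro: finite_elements split: prod.splits)
  then have "finite (vertices (fst T) \<times> vertices (fst T))"
    by (simp add: vertices_def)
  moreover have "snd T \<subseteq> vertices (fst T) \<times> vertices (fst T)"
    using assms by (auto simp: is_rct_def split: prod.splits)
  ultimately have "finite (snd T)"
    by (rule rev_finite_subset)
  then show ?thesis
    using is_rct_acyclic[OF assms(1)] by (rule finite_acyclic_wf_converse)
qed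


section \<open>SMEU representations\<close>

text \<open>
  Vectors in \<open>\<real>\<^bsup>c(A)\<^esup>\<close> are functions restricted to the set of children of \<open>A\<close>.  The aggregator
  of a leaf is only ever applied to the unique element of \<open>\<real>\<^bsup>\<emptyset>\<^esup>\<close>.
\<close>

type_synonym aggregators = "nat set \<Rightarrow> point \<Rightarrow> point \<Rightarrow> (nat set \<Rightarrow> real) \<Rightarrow> real"

lemma restrict_fundef_cong [fundef_cong]:
  "A = B \<Longrightarrow> (\<And>x. x \<in> B \<Longrightarrow> f x = g x) \<Longrightarrow> restrict f A = restrict g B"
  by (auto simp: restrict_def)

text \<open>
  \<open>utility T u p A x\<close> is \<open>U\<^sup>A\<^sub>x(p)\<close>.  The well-foundedness guard only makes the recursion total; it
  always holds for a rooted clustered tree on a finite index set, by \<open>is_rct_wf\<close> above.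
\<close>

context
  fixes T :: rct and u :: aggregators and p :: "point pmf"
begin

function utility :: "nat set \<Rightarrow> point \<Rightarrow> real" where
  "utility A x =
     (if wf ((snd T)\<inverse>) \<and> x \<in> set_pmf (marginal (anc_dims T (Some A)) p)
      then measure_pmf.expectation (cond_marginal A (anc_dims T (Some A)) x p)
             (\<lambda>y. u A x y (\<lambda>B\<in>children T (Some A). utility B (merge (anc_dims T (Some A)) A (x, y))))
      else 0)"
  by auto
termination
proof (relation "inv_image {(b, a). wf ((snd T)\<inverse>) \<and> (a, b) \<in> snd T} (\<lambda>(A, x). Some A)")
  have "wf {(b, a). wf ((snd T)\<inverse>) \<and> (a, b) \<in> snd T}"
  proof (cases "wf ((snd T)\<inverse>)")
    case True
    then show ?thesis by (simp add: converse_unfold)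
  qed simp
  then show "wf (inv_image {(b, a). wf ((snd T)\<inverse>) \<and> (a, b) \<in> snd T} (\<lambda>(A, x::point). Some A))"
    by (rule wf_inv_image)
qed (auto simp: children_def)

declare utility.simps [simp del]

end

lemma utility_rec:
  assumes "is_rct I T" "finite I"
  shows "utility T u p A x =
     (if x \<in> set_pmf (marginal (anc_dims T (Some A)) p)
      then measure_pmf.expectation (cond_marginal A (anc_dims T (Some A)) x p)
             (\<lambda>y. u A x y (\<lambda>B\<in>children T (Some A). utility T u p B (merge (anc_dims T (Some A)) A (x, y))))
      else 0)"
  using is_rct_wf[OF assms] by (subst utility.simps) simp

text \<open>At the root, \<open>U\<^sup>o(p)\<close>; there \<open>x\<close> is the unique point over the empty index set.\<close>

definition vertex_utility ::
    "rct \<Rightarrow> ((nat set \<Rightarrow> real) \<Rightarrow> real) \<Rightarrow> aggregators \<Rightarrow> vertex \<Rightarrow> point \<Rightarrow> point pmf \<Rightarrow> real" where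
  "vertex_utility T uo u v x p =
     (case v of
        None \<Rightarrow> uo (\<lambda>B\<in>children T None. utility T u p B (\<lambda>_. undefined))
      | Some A \<Rightarrow> utility T u p A x)"

text \<open>
  Continuity refers to the product topology on \<^typ>\<open>nat \<Rightarrow> real\<close>, which on points over a finite
  index set is the Euclidean topology; strict monotonicity refers to the pointwise order, which on
  points over the same index set is the coordinatewise one.
\<close>

definition smeu_rep ::
    "nat set \<Rightarrow> (nat \<Rightarrow> real set) \<Rightarrow> (point pmf \<Rightarrow> point pmf \<Rightarrow> bool) \<Rightarrow>
     rct \<Rightarrow> ((nat set \<Rightarrow> real) \<Rightarrow> real) \<Rightarrow> aggregators \<Rightarrow> bool" where
  "smeu_rep I X pref T uo u \<longleftrightarrow>
     is_rct I T \<and>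
     (\<forall>v\<in>vertices (fst T). let S = subtree_dims T v in
        \<forall>x\<in>PiE (anc_dims T v) X. \<forall>z\<in>PiE (I - S) X. restrict z (anc_dims T v) = x \<longrightarrow>
          (\<forall>p\<in>lotteries (PiE S X). \<forall>q\<in>lotteries (PiE S X).
             cond_pref I pref S z p q \<longleftrightarrow>
               vertex_utility T uo u v x (prod_lottery (I - S) (return_pmf z) S p)
               \<ge> vertex_utility T uo u v x (prod_lottery (I - S) (return_pmf z) S q)) \<and>
          continuous_on (PiE S X)
            (\<lambda>y. vertex_utility T uo u v x (return_pmf (merge (I - S) S (z, y)))) \<and>
          strict_mono_on (PiE S X)
            (\<lambda>y. vertex_utility T uo u v x (return_pmf (merge (I - S) S (z, y)))))"

definition smeu_trees ::
    "nat set \<Rightarrow> (nat \<Rightarrow> real set) \<Rightarrow> (point pmf \<Rightarrow> point pmf \<Rightarrow> bool) \<Rightarrow> rct set" where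
  "smeu_trees I X pref = {T. \<exists>uo u. smeu_rep I X pref T uo u}"


section \<open>Simplicity\<close>

definition depth :: "rct \<Rightarrow> nat \<Rightarrow> nat" where
  "depth T i = card (ancestors T (Some (THE A. A \<in> fst T \<and> i \<in> A)))"

definition simpler :: "nat set \<Rightarrow> rct \<Rightarrow> rct \<Rightarrow> bool" where
  "simpler I T T' \<longleftrightarrow>
     (\<forall>i\<in>I. depth T i \<le> depth T' i) \<and>
     ((\<forall>i\<in>I. depth T i = depth T' i) \<longrightarrow> refines I (fst T') (fst T))"

end

theory Submission
  imports Defs
begin

text \<open>
  A clustered tree is encoded by the preorder "the cell of \<open>i\<close> lies above or equals the cell of
  \<open>j\<close>", and a tree supports a representation iff, recursively, the subtrees below a vertex separate
  the conditional preference and each root cell \<open>A\<close> of a subtree on \<open>B\<close> admits a utility on \<open>B\<close>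
  that is the expectation of its own values conditional on the coordinates in \<open>A\<close>.  The
  simplest tree is built by induction on the number of dimensions.

  A utility with this property for some nonempty cell is unique up to positive affine maps: mixing
  with lotteries between the bottom and the top point calibrates it.  Hence root cells of two trees
  on the same set can be united, and there is a largest one.  This settles the case in which the
  dimensions do not separate at all.

  Otherwise there is a finest separating partition.  If the subtree on \<open>B\<close> of some tree
  contains several of its blocks and the root cell meets one of them, then exchanging the parts of
  two equally likely lotteries shows that the utility is additive across these blocks and that all
  the other blocks are expected utility.  So a block that is not expected utility must have the
  root cell of its subtree inside it and can be simplified on its own.  Expected-utility blocks, in
  contrast, are merged as far as possible: if two of them meet a common expected-utility block of
  another separating partition, additivity gives all utilities a common scale, and moving along the
  indifference lines of a small box shows that their union is again an expected-utility block.
\<close>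

section \<open>Conditioning on coordinates\<close>

text \<open>The two halves of simplicity pull apart: small depth asks for many root cells side by
  side, the tie-break asks for large cells. They are compatible because an expected-utility block
  already has all its dimensions at depth one, so splitting it gains nothing; only the other blocks
  are split as finely as possible.

  The preorder encoding suits the comparison of trees, which always passes to fewer dimensions:
  freezing the others is an intersection with \<open>G \<times> G\<close>, whereas a tree would lose
  vertices and reattach their children. Frozen dimensions turn into context, hence the set
  \<open>K\<close> of relevant context coordinates in most notions.

  Aggregators are arbitrary functions. Apart from order, continuity and monotonicity, a
  representation therefore says that subtrees see the context only through their ancestors, that the
  utilities of the children determine the indifference classes below a vertex, and that each utility
  averages its conditional values. The preference enters through \<open>W\<close>, the root utility
  of one fixed representation. Certainty equivalents are required on every set of dimensions, since
  blocks of unrelated partitions are cut against each other.\<close>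

definition cyl :: "nat set \<Rightarrow> point \<Rightarrow> point set" where
  "cyl A f = {g. \<forall>i\<in>A. g i = f i}"

lemma self_in_cyl [simp]: "f \<in> cyl A f"
  by (simp add: cyl_def)

lemma set_cond_cyl [simp]: "f \<in> set_pmf p \<Longrightarrow> set_pmf (cond_pmf p (cyl A f)) = set_pmf p \<inter> cyl A f"
  by (rule set_cond_pmf) (use self_in_cyl in blast)

text \<open>Redrawing a point given its own coordinates in \<open>A\<close> does not change its law:
  this is the tower property behind \<open>condaff_Un\<close>.\<close>

lemma bind_cond_cyl: "bind_pmf p (\<lambda>f. cond_pmf p (cyl A f)) = p"
proof -
  have "bind_pmf p (\<lambda>f. cond_pmf p {g. (\<lambda>f g. \<forall>i\<in>A. g i = f i) f g}) = p"
  proof (rule bind_cond_pmf_cancel)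
    fix x y assume "\<forall>i\<in>A. y i = (x :: point) i"
    then have "{y. \<forall>i\<in>A. y i = x i} = {x. \<forall>i\<in>A. y i = x i}" by auto
    then show "measure_pmf.prob p {y. \<forall>i\<in>A. y i = x i} = measure_pmf.prob p {x. \<forall>i\<in>A. y i = x i}"
      by simp
  qed auto
  then show ?thesis by (simp add: cyl_def)
qed

lemma cond_cond_pmf:
  assumes "set_pmf p \<inter> s \<inter> t \<noteq> {}"
  shows "cond_pmf (cond_pmf p s) t = cond_pmf p (s \<inter> t)"
proof -
  have s: "set_pmf p \<inter> s \<noteq> {}" and st: "set_pmf p \<inter> (s \<inter> t) \<noteq> {}"
    using assms by auto
  have t: "set_pmf (cond_pmf p s) \<inter> t \<noteq> {}"
    using assms s by simp
  have ms: "measure_pmf.prob p s \<noteq> 0"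
    using measure_measure_pmf_not_zero[OF s] .
  have "measure_pmf.prob (cond_pmf p s) t = measure_pmf.prob p (s \<inter> t) / measure_pmf.prob p s"
    by (simp add: cond_pmf.rep_eq[OF s] measure_uniform_measure[where A=s] ms
          emeasure_measure_pmf_not_zero[OF s] measure_pmf.emeasure_eq_measure)
  then show ?thesis
    by (intro pmf_eqI) (simp add: pmf_cond[OF st] pmf_cond[OF t] pmf_cond[OF s] ms)
qed

lemma cond_pmf_eq_self:
  assumes "set_pmf p \<subseteq> s"
  shows "cond_pmf p s = p"
proof -
  have s: "set_pmf p \<inter> s \<noteq> {}" using assms set_pmf_not_empty[of p] by auto
  have "measure_pmf.prob p s = 1"
    using assms by (subst measure_pmf.prob_eq_1) (auto simp: AE_measure_pmf_iff)
  then show ?thesis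
    by (intro pmf_eqI) (use assms in \<open>auto simp: pmf_cond[OF s] set_pmf_iff\<close>)
qed

text \<open>Only one component meets \<open>s\<close>, and its weight \<open>pmf \<mu> t\<close>
  cancels against the same factor in the mass of \<open>s\<close>.\<close>

lemma cond_bind_pmf_disjoint:
  assumes fin: "finite (set_pmf \<mu>)" "\<And>t. t \<in> set_pmf \<mu> \<Longrightarrow> finite (set_pmf (k t))"
    and t: "t \<in> set_pmf \<mu>" and ne: "set_pmf (k t) \<inter> s \<noteq> {}"
    and dis: "\<And>t'. t' \<in> set_pmf \<mu> \<Longrightarrow> t' \<noteq> t \<Longrightarrow> set_pmf (k t') \<inter> s = {}"
  shows "cond_pmf (bind_pmf \<mu> k) s = cond_pmf (k t) s"
proof -
  have E: "measure_pmf.expectation (bind_pmf \<mu> k) h = pmf \<mu> t * measure_pmf.expectation (k t) h"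
    if h: "\<And>g. g \<notin> s \<Longrightarrow> h g = (0::real)" for h
  proof -
    have z: "measure_pmf.expectation (k t') h = 0" if "t' \<in> set_pmf \<mu> - {t}" for t'
    proof -
      have "measure_pmf.expectation (k t') h = measure_pmf.expectation (k t') (\<lambda>_. 0)"
        by (rule integral_cong_AE) (use dis[of t'] that h in \<open>auto simp: AE_measure_pmf_iff\<close>)
      then show ?thesis by simp
    qed
    have "measure_pmf.expectation (bind_pmf \<mu> k) h
        = (\<Sum>a\<in>set_pmf \<mu>. pmf \<mu> a *\<^sub>R measure_pmf.expectation (k a) h)"
      by (rule pmf_expectation_bind) (use fin in auto)
    also have "\<dots> = pmf \<mu> t * measure_pmf.expectation (k t) h"
      using fin t z by (subst sum.remove[of _ t]) (auto intro!: sum.neutral)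
    finally show ?thesis .
  qed
  have ne': "set_pmf (bind_pmf \<mu> k) \<inter> s \<noteq> {}"
    using t ne by (auto simp: set_bind_pmf)
  have M: "measure_pmf.prob (bind_pmf \<mu> k) s = pmf \<mu> t * measure_pmf.prob (k t) s"
    using E[of "indicator s"] by simp
  have P: "pmf (bind_pmf \<mu> k) x = pmf \<mu> t * pmf (k t) x" if "x \<in> s" for x
  proof -
    have "indicator {x} g = (0::real)" if "g \<notin> s" for g
      using that \<open>x \<in> s\<close> by (auto simp: indicator_def)
    from E[of "indicator {x}", OF this] show ?thesis by (simp add: pmf.rep_eq)
  qed
  have "pmf \<mu> t \<noteq> 0" using t by (simp add: set_pmf_iff)
  then show ?thesis
    by (intro pmf_eqI) (simp add: pmf_cond[OF ne] pmf_cond[OF ne'] M P)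
qed

lemma expectation_cong:
  assumes "\<And>x. x \<in> set_pmf p \<Longrightarrow> f x = (g x :: real)"
  shows "measure_pmf.expectation p f = measure_pmf.expectation p g"
  by (rule integral_cong_AE) (use assms in \<open>auto simp: AE_measure_pmf_iff\<close>)

lemma expectation_bind_finite:
  fixes h :: "'b \<Rightarrow> real"
  assumes "finite (set_pmf p)" "\<And>x. x \<in> set_pmf p \<Longrightarrow> finite (set_pmf (k x))"
  shows "measure_pmf.expectation (bind_pmf p k) h
    = measure_pmf.expectation p (\<lambda>x. measure_pmf.expectation (k x) h)"
  using assms
  by (subst pmf_expectation_bind[of "set_pmf p"])
     (auto simp: integral_measure_pmf[of "set_pmf p" p])

lemma expectation_affine:
  fixes h :: "'b \<Rightarrow> real"
  assumes "finite (set_pmf p)"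
  shows "measure_pmf.expectation p (\<lambda>x. a * h x + b) = a * measure_pmf.expectation p h + b"
proof -
  have "integrable p h" using assms by (rule integrable_measure_pmf_finite)
  then show ?thesis by simp
qed

lemma expectation_add:
  fixes h :: "'b \<Rightarrow> real"
  assumes "finite (set_pmf p)"
  shows "measure_pmf.expectation p (\<lambda>x. h x + k x)
    = measure_pmf.expectation p h + measure_pmf.expectation p k"
  using assms by (intro Bochner_Integration.integral_add integrable_measure_pmf_finite)

lemma expectation_in_interval:
  fixes h :: "'b \<Rightarrow> real"
  assumes "finite (set_pmf p)" "\<And>x. x \<in> set_pmf p \<Longrightarrow> a \<le> h x \<and> h x \<le> b"
  shows "a \<le> measure_pmf.expectation p h" "measure_pmf.expectation p h \<le> b"
proof -
  have i: "integrable p h" using assms(1) by (rule integrable_measure_pmf_finite)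
  show "a \<le> measure_pmf.expectation p h"
    by (rule measure_pmf.integral_ge_const[OF i]) (use assms in \<open>auto simp: AE_measure_pmf_iff\<close>)
  show "measure_pmf.expectation p h \<le> b"
    by (rule measure_pmf.integral_le_const[OF i]) (use assms in \<open>auto simp: AE_measure_pmf_iff\<close>)
qed

section \<open>Sections of lotteries\<close>

text \<open>
  Preferences conditional on \<open>z\<close> are expressed with full points and full lotteries, so that no
  function or lottery ever changes its index set: \<open>sect S z p\<close> is \<open>(p\<^sub>S, z)\<close>, with
  the coordinates of \<open>z\<close> in \<open>S\<close> and those of \<open>p\<close> outside \<open>S\<close> ignored.
\<close>

definition sect :: "nat set \<Rightarrow> point \<Rightarrow> point pmf \<Rightarrow> point pmf" where
  "sect S z p = map_pmf (\<lambda>f. override_on z f S) p"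

lemma override_on_apply: "override_on f g A a = (if a \<in> A then g a else f a)"
  by (simp add: override_on_def)

lemma override_override:
  "override_on z (override_on w f B) S = override_on (override_on z w S) f (B \<inter> S)"
  by (auto simp: override_on_def)

lemma sect_sect: "sect S z (sect B w p) = sect (B \<inter> S) (override_on z w S) p"
  by (simp add: sect_def map_pmf_comp override_override)

lemma sect_empty: "sect {} z p = return_pmf z"
  by (simp add: sect_def override_on_def)

lemma sect_return [simp]: "sect S z (return_pmf f) = return_pmf (override_on z f S)"
  by (simp add: sect_def)

lemma override_on_self [simp]: "override_on z z S = z"
  by (auto simp: override_on_def)

text \<open>What is left of the recursion for the utilities once the aggregators are forgotten: the
  integrand at a value of the cell \<open>A\<close> is the utility of the lottery conditional on
  that value. For \<open>A = {}\<close> this says nothing, so uniqueness arguments take nonempty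
  cells.\<close>

definition condaff :: "point pmf set \<Rightarrow> nat set \<Rightarrow> (point pmf \<Rightarrow> real) \<Rightarrow> bool" where
  "condaff \<L> A V \<longleftrightarrow>
     (\<forall>p\<in>\<L>. V p = measure_pmf.expectation p (\<lambda>f. V (cond_pmf p (cyl A f))))"

lemma lotteriesD: "p \<in> lotteries Z \<Longrightarrow> finite (set_pmf p)" "p \<in> lotteries Z \<Longrightarrow> f \<in> set_pmf p \<Longrightarrow> f \<in> Z"
  by (auto simp: lotteries_def)

lemma return_in_lotteries [simp]: "return_pmf y \<in> lotteries Z \<longleftrightarrow> y \<in> Z"
  by (auto simp: lotteries_def)

lemma cond_in_lotteries: "p \<in> lotteries Z \<Longrightarrow> f \<in> set_pmf p \<Longrightarrow> cond_pmf p (cyl A f) \<in> lotteries Z"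
  by (auto simp: lotteries_def)

lemma bind_in_lotteries:
  "finite (set_pmf \<mu>) \<Longrightarrow> (\<And>t. t \<in> set_pmf \<mu> \<Longrightarrow> k t \<in> lotteries Z) \<Longrightarrow> bind_pmf \<mu> k \<in> lotteries Z"
  by (fastforce simp: lotteries_def set_bind_pmf)

text \<open>If the components differ in the coordinates in \<open>A\<close>, then seeing these
  coordinates reveals the component, so conditioning the mixture is conditioning the component. This
  is the source of affinity in the splitting arguments below.\<close>

lemma condaff_bind:
  assumes V: "condaff (lotteries Z) A V" and fin: "finite (set_pmf \<mu>)"
    and k: "\<And>t. t \<in> set_pmf \<mu> \<Longrightarrow> k t \<in> lotteries Z"
    and dis: "\<And>t t' f f'. t \<in> set_pmf \<mu> \<Longrightarrow> t' \<in> set_pmf \<mu> \<Longrightarrow> t \<noteq> t' \<Longrightarrow> f \<in> set_pmf (k t) \<Longrightarrow>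
      f' \<in> set_pmf (k t') \<Longrightarrow> \<exists>i\<in>A. f i \<noteq> f' i"
  shows "V (bind_pmf \<mu> k) = measure_pmf.expectation \<mu> (\<lambda>t. V (k t))"
proof -
  let ?p = "bind_pmf \<mu> k"
  have c: "cond_pmf ?p (cyl A f) = cond_pmf (k t) (cyl A f)"
    if "t \<in> set_pmf \<mu>" "f \<in> set_pmf (k t)" for t f
  proof (rule cond_bind_pmf_disjoint)
    show "finite (set_pmf (k t))" if "t \<in> set_pmf \<mu>" for t
      using k[OF that] by (simp add: lotteries_def)
    show "set_pmf (k t) \<inter> cyl A f \<noteq> {}" using that self_in_cyl by blast
    show "set_pmf (k t') \<inter> cyl A f = {}" if "t' \<in> set_pmf \<mu>" "t' \<noteq> t" for t'
      using dis[of t' t _ f] that \<open>t \<in> set_pmf \<mu>\<close> \<open>f \<in> set_pmf (k t)\<close> by (fastforce simp: cyl_def)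
  qed (use fin that in auto)
  have "V ?p = measure_pmf.expectation ?p (\<lambda>f. V (cond_pmf ?p (cyl A f)))"
    using V bind_in_lotteries[OF fin k] by (auto simp: condaff_def)
  also have "\<dots> = measure_pmf.expectation \<mu> (\<lambda>t. measure_pmf.expectation (k t)
      (\<lambda>f. V (cond_pmf ?p (cyl A f))))"
    by (rule expectation_bind_finite) (use fin k in \<open>auto simp: lotteries_def\<close>)
  also have "\<dots> = measure_pmf.expectation \<mu> (\<lambda>t. measure_pmf.expectation (k t)
      (\<lambda>f. V (cond_pmf (k t) (cyl A f))))"
    by (intro expectation_cong) (simp add: c)
  also have "\<dots> = measure_pmf.expectation \<mu> (\<lambda>t. V (k t))"
    by (intro expectation_cong) (use V k in \<open>auto simp: condaff_def\<close>)
  finally show ?thesis .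
qed

text \<open>Conditioning on \<open>A\<close> and then on \<open>A'\<close> is conditioning on the
  union, and the two nested averages collapse into one.\<close>

lemma condaff_Un:
  assumes "condaff (lotteries Z) A V" "condaff (lotteries Z) A' V"
  shows "condaff (lotteries Z) (A \<union> A') V"
  unfolding condaff_def
proof
  fix p assume p: "p \<in> lotteries Z"
  let ?c = "\<lambda>f. cond_pmf p (cyl A f)"
  have cc: "cond_pmf (?c f) (cyl A' g) = cond_pmf p (cyl (A \<union> A') g)"
    if "f \<in> set_pmf p" "g \<in> set_pmf (?c f)" for f g
  proof -
    have g: "g \<in> set_pmf p" "g \<in> cyl A f" using that by auto
    then have "cyl A f \<inter> cyl A' g = cyl (A \<union> A') g" by (auto simp: cyl_def)
    moreover have "set_pmf p \<inter> cyl A f \<inter> cyl A' g \<noteq> {}" using g self_in_cyl by blast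
    ultimately show ?thesis by (simp add: cond_cond_pmf)
  qed
  have "V p = measure_pmf.expectation p (\<lambda>f. V (?c f))"
    using assms(1) p by (auto simp: condaff_def)
  also have "\<dots> = measure_pmf.expectation p (\<lambda>f. measure_pmf.expectation (?c f)
      (\<lambda>g. V (cond_pmf (?c f) (cyl A' g))))"
    by (intro expectation_cong) (use assms(2) cond_in_lotteries[OF p] in \<open>auto simp: condaff_def\<close>)
  also have "\<dots> = measure_pmf.expectation p (\<lambda>f. measure_pmf.expectation (?c f)
      (\<lambda>g. V (cond_pmf p (cyl (A \<union> A') g))))"
    by (intro expectation_cong) (simp add: cc)
  also have "\<dots> = measure_pmf.expectation (bind_pmf p ?c) (\<lambda>g. V (cond_pmf p (cyl (A \<union> A') g)))"
    by (rule expectation_bind_finite[symmetric]) (use p cond_in_lotteries[OF p] in \<open>auto simp: lotteries_def\<close>)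
  also have "bind_pmf p ?c = p" by (rule bind_cond_cyl)
  finally show "V p = measure_pmf.expectation p (\<lambda>f. V (cond_pmf p (cyl (A \<union> A') f)))" .
qed

lemma condaff_affine:
  assumes "condaff (lotteries Z) A V" "\<And>p. p \<in> lotteries Z \<Longrightarrow> V' p = a * V p + b"
  shows "condaff (lotteries Z) A V'"
  unfolding condaff_def
proof
  fix p assume p: "p \<in> lotteries Z"
  have "V' p = a * V p + b" using assms p by auto
  also have "\<dots> = a * measure_pmf.expectation p (\<lambda>f. V (cond_pmf p (cyl A f))) + b"
    using assms p by (auto simp: condaff_def)
  also have "\<dots> = measure_pmf.expectation p (\<lambda>f. a * V (cond_pmf p (cyl A f)) + b)"
    by (rule expectation_affine[symmetric]) (use p in \<open>auto simp: lotteries_def\<close>)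
  also have "\<dots> = measure_pmf.expectation p (\<lambda>f. V' (cond_pmf p (cyl A f)))"
    by (intro expectation_cong) (use assms cond_in_lotteries[OF p] in auto)
  finally show "V' p = measure_pmf.expectation p (\<lambda>f. V' (cond_pmf p (cyl A f)))" .
qed

text \<open>Coordinates outside \<open>C\<close> are frozen at \<open>z\<close> and carry no
  information, so conditioning the section on \<open>A\<close> is conditioning on
  \<open>A \<inter> C\<close>.\<close>

lemma condaff_sect:
  assumes V: "condaff (lotteries Z) A V" and L: "\<And>p. p \<in> lotteries Z \<Longrightarrow> sect C z p \<in> lotteries Z"
  shows "condaff (lotteries Z) (A \<inter> C) (\<lambda>p. V (sect C z p))"
  unfolding condaff_def
proof
  fix p assume p: "p \<in> lotteries Z"
  have pre: "(\<lambda>f. override_on z f C) -` cyl A (override_on z f C) = cyl (A \<inter> C) f" for f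
    by (auto simp: cyl_def override_on_def)
  have c: "cond_pmf (sect C z p) (cyl A (override_on z f C)) = sect C z (cond_pmf p (cyl (A \<inter> C) f))"
    if "f \<in> set_pmf p" for f
    unfolding sect_def
    by (subst cond_map_pmf) (use that self_in_cyl in \<open>auto simp: pre\<close>)
  have "V (sect C z p) = measure_pmf.expectation (sect C z p) (\<lambda>f. V (cond_pmf (sect C z p) (cyl A f)))"
    using V L[OF p] by (auto simp: condaff_def)
  also have "\<dots> = measure_pmf.expectation p (\<lambda>f. V (cond_pmf (sect C z p) (cyl A (override_on z f C))))"
    by (subst (1) sect_def) simp
  also have "\<dots> = measure_pmf.expectation p (\<lambda>f. V (sect C z (cond_pmf p (cyl (A \<inter> C) f))))"
    by (intro expectation_cong) (simp add: c)
  finally show "V (sect C z p) = \<dots>" .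
qed

section \<open>Conditional preferences, their utilities, and forests that fit them\<close>

locale lottery_pref =
  fixes I :: "nat set" and lo hi :: "nat \<Rightarrow> real" and W :: "point pmf \<Rightarrow> real"
  assumes finite_I: "finite I"
    and lo_less_hi: "i \<in> I \<Longrightarrow> lo i < hi i"
    and W_continuous: "continuous_on (PiE I (\<lambda>i. {lo i..hi i})) (\<lambda>y. W (return_pmf y))"
    and W_strict_mono: "strict_mono_on (PiE I (\<lambda>i. {lo i..hi i})) (\<lambda>y. W (return_pmf y))"
begin

definition Z :: "point set" where "Z = PiE I (\<lambda>i. {lo i..hi i})"

abbreviation L :: "point pmf set" where "L \<equiv> lotteries Z"

definition eqv :: "nat set \<Rightarrow> point \<Rightarrow> point pmf \<Rightarrow> point pmf \<Rightarrow> bool" where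
  "eqv S z p q \<longleftrightarrow> W (sect S z p) = W (sect S z q)"

text \<open>In the following, \<open>K\<close> is the set of coordinates of the context that may matter.\<close>

definition indep :: "nat set \<Rightarrow> nat set \<Rightarrow> bool" where
  "indep S K \<longleftrightarrow> (\<forall>z\<in>Z. \<forall>z'\<in>Z. (\<forall>i\<in>K. z i = z' i) \<longrightarrow>
     (\<forall>p\<in>L. \<forall>q\<in>L. W (sect S z p) \<le> W (sect S z q) \<longleftrightarrow> W (sect S z' p) \<le> W (sect S z' q)))"

definition repr :: "nat set \<Rightarrow> point \<Rightarrow> (point pmf \<Rightarrow> real) \<Rightarrow> bool" where
  "repr S z V \<longleftrightarrow> (\<forall>p\<in>L. \<forall>q\<in>L. V p \<le> V q \<longleftrightarrow> W (sect S z p) \<le> W (sect S z q)) \<and>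
     continuous_on Z (\<lambda>y. V (return_pmf y))"

text \<open>The utility may be chosen anew for each context \<open>z\<close>; how the order varies
  with the context is the business of \<open>indep\<close>.\<close>

definition Util :: "nat set \<Rightarrow> nat set \<Rightarrow> bool" where
  "Util A S \<longleftrightarrow> (\<forall>z\<in>Z. \<exists>V. repr S z V \<and> condaff L A V)"

text \<open>Only indifference is aggregated, which is all that an arbitrary function of the
  utilities of the children can express. Indifference on a block may be checked at any context that
  agrees with \<open>z\<close> on \<open>K\<close>, in particular at one that differs from
  \<open>z\<close> in the other blocks.\<close>

definition Sep :: "nat set \<Rightarrow> nat set \<Rightarrow> nat set set \<Rightarrow> bool" where
  "Sep K S \<P> \<longleftrightarrow> partition_on S \<P> \<and> (\<forall>B\<in>\<P>. indep B K) \<and>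
     (\<forall>z\<in>Z. \<forall>p\<in>L. \<forall>q\<in>L.
        (\<forall>B\<in>\<P>. \<exists>w\<in>Z. (\<forall>i\<in>K. w i = z i) \<and> eqv B w p q) \<longrightarrow> eqv S z p q)"

text \<open>
  \<open>(i, j) \<in> R\<close> means that the cell of \<open>i\<close> is an ancestor of the cell of \<open>j\<close> or equal to it; the
  vertex \<open>o\<close> is implicit.
\<close>

definition root_cell :: "(nat \<times> nat) set \<Rightarrow> nat set \<Rightarrow> nat set \<Rightarrow> bool" where
  "root_cell R B A \<longleftrightarrow>
     A \<noteq> {} \<and> A \<subseteq> B \<and> Util A B \<and> Restr R B = A \<times> B \<union> Restr R (B - A)"

text \<open>A forest on \<open>S\<close> below a fixed context: \<open>\<P>\<close> lists the
  dimensions of its top subtrees, and the coordinates of a root cell join the context of all that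
  lies below. The relation \<open>R\<close> alone is the datum; for the relation of a tree,
  \<open>\<P>\<close> and the root cells are recovered in \<open>good_step\<close>.\<close>

inductive good :: "nat set \<Rightarrow> nat set \<Rightarrow> (nat \<times> nat) set \<Rightarrow> bool" where
  good: "\<lbrakk>S \<subseteq> I; Sep K S \<P>; R \<subseteq> (\<Union>B\<in>\<P>. B \<times> B);
    \<forall>B\<in>\<P>. \<exists>A. root_cell R B A \<and> good (K \<union> A) (B - A) (Restr R (B - A))\<rbrakk> \<Longrightarrow> good K S R"

lemma W_continuous_Z: "continuous_on Z (\<lambda>y. W (return_pmf y))"
  and W_strict_mono_Z: "strict_mono_on Z (\<lambda>y. W (return_pmf y))"
  using W_continuous W_strict_mono by (simp_all add: Z_def)

lemma override_in_Z [simp]: "z \<in> Z \<Longrightarrow> f \<in> Z \<Longrightarrow> override_on z f S \<in> Z"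
  by (auto simp: Z_def override_on_apply PiE_iff extensional_def)

lemma sect_in_L [simp]: "z \<in> Z \<Longrightarrow> p \<in> L \<Longrightarrow> sect S z p \<in> L"
  by (auto simp: sect_def lotteries_def)

lemma override_cong_Z:
  assumes "z \<in> Z" "z' \<in> Z" "\<And>i. i \<in> I - S \<Longrightarrow> z i = z' i"
  shows "override_on z f S = override_on z' f S"
proof
  fix i show "override_on z f S i = override_on z' f S i"
    using assms by (cases "i \<in> I") (auto simp: Z_def override_on_apply PiE_iff extensional_def)
qed

lemma sect_cong:
  assumes "z \<in> Z" "z' \<in> Z" "\<And>i. i \<in> I - S \<Longrightarrow> z i = z' i"
  shows "sect S z p = sect S z' p"
  unfolding sect_def using override_cong_Z[OF assms] by simp

lemma sect_cong_set:
  assumes "\<And>f. f \<in> set_pmf p \<Longrightarrow> override_on z f S = override_on z' f S'"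
  shows "sect S z p = sect S' z' p"
  unfolding sect_def by (rule map_pmf_cong) (use assms in auto)

lemma sect_sub:
  assumes "z \<in> Z" "C \<subseteq> B"
  shows "sect B z (sect C z p) = sect C z p"
  using assms by (simp add: sect_sect Int_absorb2)

lemma sect_idem: "sect S z (sect S z p) = sect S z p"
  by (simp add: sect_sect)

lemma lo_in_Z: "restrict lo I \<in> Z" and hi_in_Z: "restrict hi I \<in> Z"
  using lo_less_hi by (auto simp: Z_def PiE_iff less_imp_le)

lemma eqv_refl [simp]: "eqv S z p p"
  by (simp add: eqv_def)

lemma indepD:
  assumes "indep S K" "z \<in> Z" "z' \<in> Z" "\<And>i. i \<in> K \<Longrightarrow> z i = z' i" "p \<in> L" "q \<in> L"
  shows "W (sect S z p) \<le> W (sect S z q) \<longleftrightarrow> W (sect S z' p) \<le> W (sect S z' q)"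
  by (rule assms(1)[unfolded indep_def, rule_format]) (use assms in auto)

lemma indep_eqv:
  assumes "indep S K" "z \<in> Z" "z' \<in> Z" "\<And>i. i \<in> K \<Longrightarrow> z i = z' i" "p \<in> L" "q \<in> L"
  shows "eqv S z p q \<longleftrightarrow> eqv S z' p q"
  using indepD[OF assms] indepD[OF assms(1-4,6,5)] by (auto simp: eqv_def)

lemma indep_mono:
  assumes "indep S K" "K \<subseteq> K'"
  shows "indep S K'"
  unfolding indep_def
proof (intro ballI impI)
  fix z z' p q assume "z \<in> Z" "z' \<in> Z" "\<forall>i\<in>K'. z i = z' i" "p \<in> L" "q \<in> L"
  then show "W (sect S z p) \<le> W (sect S z q) \<longleftrightarrow> W (sect S z' p) \<le> W (sect S z' q)"
    using assms by (intro indepD[OF assms(1)]) auto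
qed

lemma indep_sub:
  assumes "indep B K" "C \<subseteq> B"
  shows "indep C (K \<union> (B - C))"
  unfolding indep_def
proof (intro ballI impI)
  fix z z' p q assume h: "z \<in> Z" "z' \<in> Z" "\<forall>i\<in>K \<union> (B - C). z i = z' i" "p \<in> L" "q \<in> L"
  have e: "sect B z' (sect C z r) = sect C z' r" for r
  proof -
    have "sect B z' (sect C z r) = sect C (override_on z' z B) r"
      using assms(2) by (simp add: sect_sect Int_absorb2)
    also have "\<dots> = sect C z' r"
      by (rule sect_cong) (use h in \<open>auto simp: override_on_apply\<close>)
    finally show ?thesis .
  qed
  have "W (sect B z (sect C z p)) \<le> W (sect B z (sect C z q)) \<longleftrightarrow>
      W (sect B z' (sect C z p)) \<le> W (sect B z' (sect C z q))"
    by (rule indepD[OF assms(1)]) (use h in auto)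
  then show "W (sect C z p) \<le> W (sect C z q) \<longleftrightarrow> W (sect C z' p) \<le> W (sect C z' q)"
    using sect_sub[OF h(1) assms(2)] by (simp add: e)
qed

lemma repr_sect:
  assumes "repr S z V" "z \<in> Z" "p \<in> L"
  shows "V (sect S z p) = V p"
  using assms by (intro antisym) (auto simp: repr_def sect_idem)

lemma repr_le: "repr S z V \<Longrightarrow> p \<in> L \<Longrightarrow> q \<in> L \<Longrightarrow> V p \<le> V q \<longleftrightarrow> W (sect S z p) \<le> W (sect S z q)"
  by (simp add: repr_def)

lemma repr_eq: "repr S z V \<Longrightarrow> p \<in> L \<Longrightarrow> q \<in> L \<Longrightarrow> V p = V q \<longleftrightarrow> eqv S z p q"
  by (simp add: repr_def eqv_def order_eq_iff)

lemma continuous_on_override: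
  assumes "z \<in> Z"
  shows "continuous_on Z (\<lambda>y. override_on z y C)"
proof (rule continuous_on_coordinatewise_then_product)
  fix i
  have "continuous_on Z (\<lambda>y :: point. y i)"
    by (rule continuous_on_subset[OF continuous_on_product_coordinates]) simp
  then show "continuous_on Z (\<lambda>y. override_on z y C i)"
    by (cases "i \<in> C") (auto simp: override_on_apply)
qed

lemma continuous_section:
  assumes "z \<in> Z" "continuous_on Z (\<lambda>y. V (return_pmf y))"
  shows "continuous_on Z (\<lambda>y. V (sect C z (return_pmf y)))"
  unfolding sect_return
  by (rule continuous_on_compose2[OF assms(2) continuous_on_override[OF assms(1)]])
     (use assms in auto)

lemma repr_section:
  assumes "repr B z V" "z \<in> Z" "C \<subseteq> B"
  shows "repr C z (\<lambda>p. V (sect C z p))"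
  using assms continuous_section[of z V C] by (auto simp: repr_def sect_sub)

lemma repr_W: "z \<in> Z \<Longrightarrow> repr S z (\<lambda>p. W (sect S z p))"
  using continuous_section[OF _ W_continuous_Z] by (auto simp: repr_def)

lemma Util_sub:
  assumes "Util A B" "C \<subseteq> B"
  shows "Util (A \<inter> C) C"
  unfolding Util_def
proof
  fix z assume z: "z \<in> Z"
  then obtain V where V: "repr B z V" "condaff L A V" using assms(1) by (auto simp: Util_def)
  have "condaff L (A \<inter> C) (\<lambda>p. V (sect C z p))"
    by (rule condaff_sect[OF V(2)]) (use z in auto)
  then show "\<exists>V. repr C z V \<and> condaff L (A \<inter> C) V"
    using repr_section[OF V(1) z assms(2)] by blast
qed

lemma repr_mono:
  assumes V: "repr S z V" and z: "z \<in> Z" and y: "y \<in> Z" "y' \<in> Z"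
    and le: "\<And>i. i \<in> S \<Longrightarrow> y i \<le> y' i"
  shows "V (return_pmf y) \<le> V (return_pmf y')"
proof -
  have "override_on z y S \<le> override_on z y' S"
    using le by (auto simp: le_fun_def override_on_apply)
  then have "W (return_pmf (override_on z y S)) \<le> W (return_pmf (override_on z y' S))"
    using W_strict_mono_Z z y by (cases "override_on z y S = override_on z y' S")
      (auto simp: strict_mono_on_def intro: less_imp_le)
  then show ?thesis using V y by (simp add: repr_def)
qed

lemma repr_strict_mono:
  assumes V: "repr S z V" and z: "z \<in> Z" and y: "y \<in> Z" "y' \<in> Z"
    and le: "\<And>i. i \<in> S \<Longrightarrow> y i \<le> y' i" and i: "i \<in> S" "y i < y' i"
  shows "V (return_pmf y) < V (return_pmf y')"
proof -
  have "override_on z y S i < override_on z y' S i" using i by (simp add: override_on_apply)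
  moreover have "override_on z y S \<le> override_on z y' S"
    using le by (auto simp: le_fun_def override_on_apply)
  ultimately have "override_on z y S < override_on z y' S"
    by (metis less_le)
  then have "W (return_pmf (override_on z y S)) < W (return_pmf (override_on z y' S))"
    using W_strict_mono_Z z y by (auto simp: strict_mono_on_def)
  then show ?thesis using repr_le[OF V, of "return_pmf y'" "return_pmf y"] y by simp
qed

lemma repr_context:
  assumes V: "repr S z V" and "indep S K" "z \<in> Z" "w \<in> Z" "\<And>i. i \<in> K \<Longrightarrow> z i = w i"
  shows "repr S w V"
  unfolding repr_def
proof (intro conjI ballI)
  show "continuous_on Z (\<lambda>y. V (return_pmf y))" using V by (simp add: repr_def)
  fix p q assume pq: "p \<in> L" "q \<in> L"
  show "V p \<le> V q \<longleftrightarrow> W (sect S w p) \<le> W (sect S w q)"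
    using repr_le[OF V pq] indepD[OF assms(2-5) pq] by simp
qed

section \<open>Separating partitions\<close>

lemma Sep_partition: "Sep K S \<P> \<Longrightarrow> partition_on S \<P>"
  and Sep_indep: "Sep K S \<P> \<Longrightarrow> B \<in> \<P> \<Longrightarrow> indep B K"
  by (auto simp: Sep_def)

lemma Sep_eqv:
  assumes "Sep K S \<P>" "z \<in> Z" "p \<in> L" "q \<in> L"
    and "\<And>B. B \<in> \<P> \<Longrightarrow> \<exists>w\<in>Z. (\<forall>i\<in>K. w i = z i) \<and> eqv B w p q"
  shows "eqv S z p q"
proof -
  have "\<forall>z\<in>Z. \<forall>p\<in>L. \<forall>q\<in>L.
      (\<forall>B\<in>\<P>. \<exists>w\<in>Z. (\<forall>i\<in>K. w i = z i) \<and> eqv B w p q) \<longrightarrow> eqv S z p q"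
    using assms(1)[unfolded Sep_def, THEN conjunct2, THEN conjunct2] .
  from this[rule_format, OF assms(2-4)] show ?thesis using assms(5) by meson
qed

lemma Sep_eqv':
  assumes "Sep K S \<P>" "z \<in> Z" "p \<in> L" "q \<in> L" and e: "\<And>B. B \<in> \<P> \<Longrightarrow> eqv B z p q"
  shows "eqv S z p q"
proof (rule Sep_eqv[OF assms(1-4)])
  fix B assume "B \<in> \<P>"
  then show "\<exists>w\<in>Z. (\<forall>i\<in>K. w i = z i) \<and> eqv B w p q"
    using e assms(2) by (intro bexI[of _ z]) simp_all
qed

lemma Sep_mono:
  assumes P: "Sep K S \<P>" and K: "K \<subseteq> K'"
  shows "Sep K' S \<P>"
  unfolding Sep_def
proof (intro conjI ballI impI)
  show "indep B K'" if "B \<in> \<P>" for B using indep_mono[OF Sep_indep[OF P that] K] .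
  fix z p q assume "z \<in> Z" "p \<in> L" "q \<in> L"
    and h: "\<forall>B\<in>\<P>. \<exists>w\<in>Z. (\<forall>i\<in>K'. w i = z i) \<and> eqv B w p q"
  then show "eqv S z p q"
  proof (intro Sep_eqv[OF P])
    fix B assume "B \<in> \<P>"
    then obtain w where "w \<in> Z" "\<forall>i\<in>K'. w i = z i" "eqv B w p q" using h by blast
    then show "\<exists>w\<in>Z. (\<forall>i\<in>K. w i = z i) \<and> eqv B w p q" using K by (intro bexI[of _ w]) auto
  qed
qed (rule Sep_partition[OF P])

lemma Sep_trivial:
  assumes "indep S K" "S \<noteq> {}"
  shows "Sep K S {S}"
  unfolding Sep_def
proof (intro conjI ballI impI)
  show "partition_on S {S}" using assms by (simp add: partition_on_def disjoint_def)
  fix z p q assume "z \<in> Z" "p \<in> L" "q \<in> L" "\<forall>B\<in>{S}. \<exists>w\<in>Z. (\<forall>i\<in>K. w i = z i) \<and> eqv B w p q"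
  then obtain w where "w \<in> Z" "\<And>i. i \<in> K \<Longrightarrow> w i = z i" "eqv S w p q" by auto
  then show "eqv S z p q" using indep_eqv[OF assms(1), of w z p q] \<open>z \<in> Z\<close> \<open>p \<in> L\<close> \<open>q \<in> L\<close>
    by blast
qed (use assms in auto)

text \<open>Both lotteries are completed by the coordinates of \<open>z\<close> in
  \<open>S - G\<close>. A block that misses \<open>G\<close> then sees the same sure point twice,
  and any other block sees only its part in \<open>G\<close>.\<close>

lemma Sep_restrict:
  assumes P: "Sep K S \<P>" and G: "G \<subseteq> S"
  shows "Sep (K \<union> (S - G)) G ((\<inter>) G ` \<P> - {{}})"
  unfolding Sep_def
proof (intro conjI ballI impI)
  have "partition_on (G \<inter> S) ((\<inter>) G ` \<P> - {{}})"
    by (rule partition_on_restrict) (use Sep_partition[OF P] in auto)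
  then show "partition_on G ((\<inter>) G ` \<P> - {{}})" using G by (simp add: Int_absorb2)
next
  fix C assume "C \<in> (\<inter>) G ` \<P> - {{}}"
  then obtain B where B: "B \<in> \<P>" "C = G \<inter> B" by auto
  have "B \<subseteq> S" using B Sep_partition[OF P] by (auto simp: partition_on_def)
  then show "indep C (K \<union> (S - G))"
    by (intro indep_mono[OF indep_sub[OF Sep_indep[OF P B(1)], of C]]) (use B in auto)
next
  fix z p q assume z: "z \<in> Z" and pq: "p \<in> L" "q \<in> L"
    and h: "\<forall>B\<in>(\<inter>) G ` \<P> - {{}}. \<exists>w\<in>Z. (\<forall>i\<in>K \<union> (S - G). w i = z i) \<and> eqv B w p q"
  have "eqv S z (sect G z p) (sect G z q)"
  proof (rule Sep_eqv[OF P z])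
    fix B assume B: "B \<in> \<P>"
    then have BS: "B \<subseteq> S" using Sep_partition[OF P] by (auto simp: partition_on_def)
    show "\<exists>w\<in>Z. (\<forall>i\<in>K. w i = z i) \<and> eqv B w (sect G z p) (sect G z q)"
    proof (cases "G \<inter> B = {}")
      case True
      have "eqv B z (sect G z p) (sect G z q)"
        by (simp only: eqv_def sect_sect True sect_empty)
      then show ?thesis using z by (intro bexI[of _ z]) simp_all
    next
      case False
      then have "G \<inter> B \<in> (\<inter>) G ` \<P> - {{}}" using B by blast
      from bspec[OF h this] obtain w
        where w: "w \<in> Z" "\<forall>i\<in>K \<union> (S - G). w i = z i" "eqv (G \<inter> B) w p q"
        by (elim bexE conjE)
      have "sect B w (sect G z r) = sect (G \<inter> B) w r" for r
        unfolding sect_sect by (rule sect_cong) (use w z BS in \<open>auto simp: override_on_apply\<close>)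
      then have "eqv B w (sect G z p) (sect G z q)" using w(3) by (simp add: eqv_def)
      then show ?thesis using w(1,2) by (intro bexI[of _ w]) simp_all
    qed
  qed (use z pq in auto)
  then show "eqv G z p q" using z G by (simp add: eqv_def sect_sub)
qed

lemma partition_on_Union:
  assumes "partition_on S \<P>" "\<And>B. B \<in> \<P> \<Longrightarrow> partition_on B (Q B)"
  shows "partition_on S (\<Union>B\<in>\<P>. Q B)"
proof (rule partition_onI)
  show "\<Union> (\<Union>B\<in>\<P>. Q B) = S" using assms by (fastforce simp: partition_on_def)
  show "{} \<notin> (\<Union>B\<in>\<P>. Q B)" using assms by (auto simp: partition_on_def)
  fix C D assume "C \<in> (\<Union>B\<in>\<P>. Q B)" "D \<in> (\<Union>B\<in>\<P>. Q B)" and ne: "C \<noteq> D"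
  then obtain B B' where B: "B \<in> \<P>" "C \<in> Q B" "B' \<in> \<P>" "D \<in> Q B'" by auto
  then have sub: "C \<subseteq> B" "D \<subseteq> B'" using assms(2) by (auto simp: partition_on_def)
  show "disjnt C D"
  proof (cases "B = B'")
    case True
    then show ?thesis using assms(2)[OF B(1)] B ne by (auto simp: partition_on_def disjoint_def disjnt_def)
  next
    case False
    then have "B \<inter> B' = {}" using assms(1) B by (auto simp: partition_on_def disjoint_def)
    then show ?thesis using sub by (auto simp: disjnt_def)
  qed
qed

lemma Sep_Union:
  assumes P: "Sep K S \<P>" and Q: "\<And>B. B \<in> \<P> \<Longrightarrow> Sep K B (Q B)"
  shows "Sep K S (\<Union>B\<in>\<P>. Q B)"
  unfolding Sep_def
proof (intro conjI ballI impI)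
  show "partition_on S (\<Union>B\<in>\<P>. Q B)"
    by (rule partition_on_Union[OF Sep_partition[OF P] Sep_partition[OF Q]])
  show "indep C K" if "C \<in> (\<Union>B\<in>\<P>. Q B)" for C
  proof -
    from that obtain B where "B \<in> \<P>" "C \<in> Q B" by (rule UN_E)
    then show ?thesis by (rule Sep_indep[OF Q])
  qed
  fix z p q assume h: "z \<in> Z" "p \<in> L" "q \<in> L"
    "\<forall>B\<in>\<Union> (Q ` \<P>). \<exists>w\<in>Z. (\<forall>i\<in>K. w i = z i) \<and> eqv B w p q"
  show "eqv S z p q"
  proof (rule Sep_eqv'[OF P h(1-3)])
    fix B assume "B \<in> \<P>"
    have sub: "C \<in> \<Union> (Q ` \<P>)" if "C \<in> Q B" for C using that \<open>B \<in> \<P>\<close> by (rule UN_I[rotated])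
    show "eqv B z p q" by (rule Sep_eqv[OF Q[OF \<open>B \<in> \<P>\<close>] h(1-3)]) (rule bspec[OF h(4) sub])
  qed
qed

lemma Sep_drop_context:
  assumes P: "Sep K' S \<P>" and ind: "indep S K" and K: "K \<subseteq> K'" "K' \<inter> S = {}"
  shows "Sep K S \<P>"
proof -
  have i: "indep B K" if B: "B \<in> \<P>" for B
    unfolding indep_def
  proof (intro ballI impI)
    fix z z' p q assume h: "z \<in> Z" "z' \<in> Z" "\<forall>i\<in>K. z i = z' i" "p \<in> L" "q \<in> L"
    have BS: "B \<subseteq> S" using B Sep_partition[OF P] by (auto simp: partition_on_def)
    \<comment> \<open>The coordinates of \<open>z\<close> in \<open>S\<close> on top of the context
      \<open>z'\<close>. It agrees with \<open>z'\<close> on \<open>K'\<close> because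
      \<open>K'\<close> misses \<open>S\<close>.\<close>
    let ?z = "override_on z' z S"
    have "W (sect B z p) \<le> W (sect B z q) \<longleftrightarrow>
        W (sect S z (sect B z p)) \<le> W (sect S z (sect B z q))"
      using BS h by (simp add: sect_sub)
    also have "\<dots> \<longleftrightarrow> W (sect S z' (sect B z p)) \<le> W (sect S z' (sect B z q))"
      by (rule indepD[OF ind]) (use h in auto)
    also have "\<dots> \<longleftrightarrow> W (sect B ?z p) \<le> W (sect B ?z q)"
      using BS by (simp add: sect_sect Int_absorb2)
    also have "\<dots> \<longleftrightarrow> W (sect B z' p) \<le> W (sect B z' q)"
      by (rule indepD[OF Sep_indep[OF P B]]) (use h K in \<open>auto simp: override_on_apply\<close>)
    finally show "W (sect B z p) \<le> W (sect B z q) \<longleftrightarrow> W (sect B z' p) \<le> W (sect B z' q)" .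
  qed
  show ?thesis
    unfolding Sep_def
  proof (intro conjI ballI impI)
    show "partition_on S \<P>" using Sep_partition[OF P] .
    fix z p q assume h: "z \<in> Z" "p \<in> L" "q \<in> L"
      "\<forall>B\<in>\<P>. \<exists>w\<in>Z. (\<forall>i\<in>K. w i = z i) \<and> eqv B w p q"
    show "eqv S z p q"
    proof (rule Sep_eqv'[OF P h(1-3)])
      fix B assume B: "B \<in> \<P>"
      then obtain w where w: "w \<in> Z" "\<forall>i\<in>K. w i = z i" "eqv B w p q" using h by blast
      have "eqv B w p q \<longleftrightarrow> eqv B z p q"
        by (rule indep_eqv[OF i[OF B] w(1) h(1)]) (use w h in auto)
      with w show "eqv B z p q" by simp
    qed
  qed (use i in auto)
qed

text \<open>Cutting a block \<open>B\<close> along the other partition separates it with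
  \<open>S - B\<close> as extra context, and \<open>Sep_drop_context\<close> removes that again
  because \<open>B\<close> depends on \<open>K\<close> alone.\<close>

lemma Sep_refine:
  assumes P: "Sep K S \<P>" and Q: "Sep K S \<P>'" and K: "K \<inter> S = {}"
  shows "Sep K S (\<Union>B\<in>\<P>. (\<inter>) B ` \<P>' - {{}})"
proof (rule Sep_Union[OF P])
  fix B assume B: "B \<in> \<P>"
  then have "B \<subseteq> S" using Sep_partition[OF P] by (auto simp: partition_on_def)
  then have "Sep (K \<union> (S - B)) B ((\<inter>) B ` \<P>' - {{}})" by (rule Sep_restrict[OF Q])
  then show "Sep K B ((\<inter>) B ` \<P>' - {{}})"
    by (rule Sep_drop_context) (use Sep_indep[OF P B] K \<open>B \<subseteq> S\<close> in auto)
qed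

section \<open>Restriction of trees\<close>

lemma root_cellD:
  assumes "root_cell R B A"
  shows "A \<noteq> {}" "A \<subseteq> B" "Util A B" "Restr R B = A \<times> B \<union> Restr R (B - A)"
  using assms unfolding root_cell_def by - (elim conjE, assumption)+

lemma Restr_Restr: "C \<subseteq> B \<Longrightarrow> Restr (Restr R B) C = Restr R C"
  by auto

lemma root_cell_Restr:
  assumes "B \<subseteq> S"
  shows "root_cell (Restr R S) B A \<longleftrightarrow> root_cell R B A"
proof -
  have "B - A \<subseteq> S" using assms by auto
  then show ?thesis unfolding root_cell_def Restr_Restr[OF assms] by (simp only: Restr_Restr)
qed

lemma root_cell_restrict:
  assumes "root_cell R B A" "C \<subseteq> B" "A \<inter> C \<noteq> {}"
  shows "root_cell R C (A \<inter> C)"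
proof -
  note A = root_cellD[OF assms(1)]
  have "Restr R C = Restr (Restr R B) C" using assms(2) by (simp add: Restr_Restr)
  also have "\<dots> = Restr (A \<times> B \<union> Restr R (B - A)) C" by (simp only: A(4))
  also have "\<dots> = (A \<inter> C) \<times> C \<union> Restr R (C - A \<inter> C)" using assms(2) A(2) by blast
  finally have e: "Restr R C = (A \<inter> C) \<times> C \<union> Restr R (C - A \<inter> C)" .
  show ?thesis unfolding root_cell_def by (intro conjI assms(3) Int_lower2 Util_sub[OF A(3) assms(2)] e)
qed

lemma good_mono:
  assumes "good K S R" "K \<subseteq> K'"
  shows "good K' S R"
  using assms
proof (induction arbitrary: K' rule: good.induct)
  case (good S K \<P> R)
  show ?case
  proof (rule good.good[OF good.hyps(1) Sep_mono[OF good.hyps(2) good.prems] good.hyps(3)], intro ballI)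
    fix B assume "B \<in> \<P>"
    then obtain A where A: "root_cell R B A"
      "\<And>K'. K \<union> A \<subseteq> K' \<Longrightarrow> good K' (B - A) (Restr R (B - A))"
      using good.IH by blast
    moreover have "K \<union> A \<subseteq> K' \<union> A" using good.prems by auto
    ultimately show "\<exists>A. root_cell R B A \<and> good (K' \<union> A) (B - A) (Restr R (B - A))"
      by blast
  qed
qed

lemma good_Union:
  assumes S: "S \<subseteq> I" and P: "Sep K S \<P>" and R: "R \<subseteq> (\<Union>B\<in>\<P>. B \<times> B)"
    and B: "\<And>B. B \<in> \<P> \<Longrightarrow> good K B (Restr R B)"
  shows "good K S R"
proof -
  let ?t = "\<lambda>B \<P>'. Sep K B \<P>' \<and> Restr R B \<subseteq> (\<Union>C\<in>\<P>'. C \<times> C) \<and>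
    (\<forall>C\<in>\<P>'. \<exists>A. root_cell R C A \<and> good (K \<union> A) (C - A) (Restr R (C - A)))"
  have "\<exists>\<P>'. ?t B \<P>'" if "B \<in> \<P>" for B
    using B[OF that]
  proof cases
    case (good \<P>')
    have "\<exists>A. root_cell R C A \<and> good (K \<union> A) (C - A) (Restr R (C - A))" if "C \<in> \<P>'" for C
    proof -
      from bspec[OF good(4) that] obtain A where A: "root_cell (Restr R B) C A"
        "good (K \<union> A) (C - A) (Restr (Restr R B) (C - A))" by blast
      have CB: "C \<subseteq> B" using that Sep_partition[OF good(2)] by (auto simp: partition_on_def)
      then have "C - A \<subseteq> B" by auto
      with CB A have "root_cell R C A" "good (K \<union> A) (C - A) (Restr R (C - A))"
        by (simp_all add: root_cell_Restr Restr_Restr)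
      then show ?thesis by blast
    qed
    then show ?thesis using good(2,3) by (intro exI[of _ \<P>'] conjI ballI)
  qed
  then have "\<forall>B\<in>\<P>. \<exists>\<P>'. ?t B \<P>'" by (intro ballI)
  from bchoice[OF this] obtain Q where Q': "\<forall>B\<in>\<P>. ?t B (Q B)" by (elim exE)
  note Q = conjunct1[OF bspec[OF Q']] conjunct1[OF conjunct2[OF bspec[OF Q']]]
    bspec[OF conjunct2[OF conjunct2[OF bspec[OF Q']]]]
  show ?thesis
  proof (rule good.good[OF S _ _ ballI])
    show "Sep K S (\<Union>B\<in>\<P>. Q B)" by (rule Sep_Union[OF P Q(1)])
    show "R \<subseteq> (\<Union>B\<in>\<Union> (Q ` \<P>). B \<times> B)"
    proof
      fix x assume "x \<in> R"
      then obtain B where "B \<in> \<P>" "x \<in> Restr R B" using R by blast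
      then show "x \<in> (\<Union>B\<in>\<Union> (Q ` \<P>). B \<times> B)" using Q(2)[of B] by blast
    qed
    fix C assume "C \<in> (\<Union>B\<in>\<P>. Q B)"
    then obtain B where "B \<in> \<P>" "C \<in> Q B" by blast
    from Q(3)[OF this]
    show "\<exists>A. root_cell R C A \<and> good (K \<union> A) (C - A) (Restr R (C - A))" .
  qed
qed

lemma good_subset_I: "good K S R \<Longrightarrow> S \<subseteq> I"
  by (erule good.cases) simp

lemma good_single:
  assumes "B \<subseteq> I" "B \<noteq> {}" "indep B K" "R \<subseteq> B \<times> B" "root_cell R B A"
    "good (K \<union> A) (B - A) (Restr R (B - A))"
  shows "good K B R"
  by (rule good.good[OF assms(1) Sep_trivial[OF assms(3,2)]]) (use assms in auto)

text \<open>A root cell that meets \<open>G\<close> shrinks to its trace; one that misses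
  \<open>G\<close> disappears and the forest below it moves up. This is the operation that compares
  arbitrary trees.\<close>

lemma good_restrict:
  assumes "good K S R" "G \<subseteq> S"
  shows "good (K \<union> (S - G)) G (Restr R G)"
  using assms
proof (induction arbitrary: G rule: good.induct)
  case (good S K \<P> R)
  let ?K = "K \<union> (S - G)"
  have sub: "B \<subseteq> S" if "B \<in> \<P>" for B
    using that Sep_partition[OF good.hyps(2)] by (auto simp: partition_on_def)
  have S': "Sep ?K G ((\<inter>) G ` \<P> - {{}})" by (rule Sep_restrict[OF good.hyps(2) good.prems])
  show ?case
  proof (rule good_Union[OF _ S'])
    show "G \<subseteq> I" using good by auto
    show "Restr R G \<subseteq> (\<Union>B\<in>(\<inter>) G ` \<P> - {{}}. B \<times> B)" using good.hyps(3) by blast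
    fix C assume C: "C \<in> (\<inter>) G ` \<P> - {{}}"
    then obtain B where B: "B \<in> \<P>" "C = G \<inter> B" "C \<noteq> {}" by auto
    from bspec[OF good.IH B(1)] obtain A where A: "root_cell R B A"
      and IH: "\<And>G. G \<subseteq> B - A \<Longrightarrow> good (K \<union> A \<union> (B - A - G)) G (Restr (Restr R (B - A)) G)"
      by blast
    note AB = root_cellD(2)[OF A]
    have BS: "B \<subseteq> S" using sub B by auto
    have CG: "C \<subseteq> G" "C \<subseteq> B" using B by auto
    have "good ?K C (Restr R C)"
    proof (cases "A \<inter> G = {}")
      case True
      have CB: "C \<subseteq> B - A" using B True by auto
      have "good ?K C (Restr (Restr R (B - A)) C)"
        by (rule good_mono[OF IH[OF CB]]) (use AB BS True B in auto)
      then show ?thesis by (simp only: Restr_Restr[OF CB])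
    next
      case False
      let ?A = "A \<inter> C"
      have A': "?A \<noteq> {}" using False AB B by auto
      have CB: "C - ?A \<subseteq> B - A" using CG by auto
      have g: "good (?K \<union> ?A) (C - ?A) (Restr (Restr R (B - A)) (C - ?A))"
        by (rule good_mono[OF IH[OF CB]]) (use AB BS B in auto)
      then have g: "good (?K \<union> ?A) (C - ?A) (Restr R (C - ?A))" by (simp only: Restr_Restr[OF CB])
      show ?thesis
      proof (rule good_single[OF _ B(3)])
        show "C \<subseteq> I" using CG BS good.hyps(1) by auto
        show "indep C ?K" using Sep_indep[OF S' C] .
        show "root_cell (Restr R C) C ?A"
          using root_cell_restrict[OF A CG(2) A'] by (simp only: root_cell_Restr[OF subset_refl])
        show "good (?K \<union> ?A) (C - ?A) (Restr (Restr R C) (C - ?A))"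
          using g by (simp only: Restr_Restr[OF Diff_subset])
      qed auto
    qed
    then show "good ?K C (Restr (Restr R G) C)" by (simp only: Restr_Restr[OF CG(1)])
  qed
qed

lemma good_drop_context:
  assumes "good K' S R" "indep S K" "K \<subseteq> K'" "K' \<inter> S = {}"
  shows "good K S R"
  using assms
proof (induction arbitrary: K rule: good.induct)
  case (good S K' \<P> R)
  have P: "Sep K S \<P>" by (rule Sep_drop_context) (use good in auto)
  show ?case
  proof (rule good.good[OF good.hyps(1) P good.hyps(3)], intro ballI)
    fix B assume B: "B \<in> \<P>"
    then have BS: "B \<subseteq> S" using Sep_partition[OF P] by (auto simp: partition_on_def)
    from bspec[OF good.IH B] obtain A where A: "root_cell R B A"
      and IH: "\<And>K. indep (B - A) K \<Longrightarrow> K \<subseteq> K' \<union> A \<Longrightarrow> (K' \<union> A) \<inter> (B - A) = {} \<Longrightarrow>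
        good K (B - A) (Restr R (B - A))"
      by blast
    have "indep (B - A) (K \<union> A)"
      using indep_sub[OF Sep_indep[OF P B], of "B - A"] root_cellD(2)[OF A] by (simp add: double_diff)
    then have "good (K \<union> A) (B - A) (Restr R (B - A))"
      by (rule IH) (use good.prems BS in auto)
    then show "\<exists>A. root_cell R B A \<and> good (K \<union> A) (B - A) (Restr R (B - A))"
      using A by blast
  qed
qed

lemma good_empty: "good K {} {}"
  by (rule good.good[of _ _ "{}"]) (auto simp: Sep_def partition_on_def eqv_def sect_empty)

lemma good_field: "good K S R \<Longrightarrow> R \<subseteq> S \<times> S"
  by (erule good.cases) (use Sep_partition in \<open>fastforce simp: partition_on_def\<close>)

end

section \<open>Binary mixtures, and points put together block by block\<close>

definition mix :: "real \<Rightarrow> 'a pmf \<Rightarrow> 'a pmf \<Rightarrow> 'a pmf" where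
  "mix r p q = bind_pmf (bernoulli_pmf r) (\<lambda>b. if b then p else q)"

lemma mix_half_commute: "mix (1 / 2) p q = mix (1 / 2) q p"
  by (rule pmf_eqI) (simp add: mix_def pmf_bind)

lemma sect_bind: "sect S z (bind_pmf \<mu> k) = bind_pmf \<mu> (\<lambda>t. sect S z (k t))"
  by (simp add: sect_def map_bind_pmf)

lemma sect_mix: "sect S z (mix r p q) = mix r (sect S z p) (sect S z q)"
  unfolding mix_def sect_bind by (rule bind_pmf_cong) auto

lemma finite_bernoulli [simp]: "finite (set_pmf (bernoulli_pmf r))"
  by (rule finite_subset[OF subset_UNIV]) simp

lemma mix_in_lotteries: "p \<in> lotteries Z \<Longrightarrow> q \<in> lotteries Z \<Longrightarrow> mix r p q \<in> lotteries Z"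
  unfolding mix_def by (rule bind_in_lotteries) auto

text \<open>The outcome of the coin can be read off the coordinates in \<open>A\<close>.\<close>

lemma condaff_mix:
  assumes V: "condaff (lotteries Z) A V" and pq: "p \<in> lotteries Z" "q \<in> lotteries Z"
    and r: "0 \<le> r" "r \<le> 1"
    and dis: "\<And>f g. f \<in> set_pmf p \<Longrightarrow> g \<in> set_pmf q \<Longrightarrow> \<exists>i\<in>A. f i \<noteq> g i"
  shows "V (mix r p q) = r * V p + (1 - r) * V q"
proof -
  have "V (mix r p q) = measure_pmf.expectation (bernoulli_pmf r) (\<lambda>b. V (if b then p else q))"
    unfolding mix_def
  proof (rule condaff_bind[OF V finite_bernoulli])
    fix t t' f f' assume "t \<noteq> t'" "f \<in> set_pmf (if t then p else q)" "f' \<in> set_pmf (if t' then p else q)"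
    then show "\<exists>i\<in>A. f i \<noteq> f' i" using dis[of f f'] dis[of f' f] by (cases t; cases t') fastforce+
  qed (use pq in auto)
  also have "\<dots> = r * V p + (1 - r) * V q" using r by simp
  finally show ?thesis .
qed

lemma expectation_mix:
  fixes h :: "'a \<Rightarrow> real"
  assumes "finite (set_pmf p)" "finite (set_pmf q)" "0 \<le> r" "r \<le> 1"
  shows "measure_pmf.expectation (mix r p q) h =
    r * measure_pmf.expectation p h + (1 - r) * measure_pmf.expectation q h"
  unfolding mix_def using assms by (subst expectation_bind_finite) auto

lemma assemble_point:
  assumes P: "partition_on S \<P>" and c: "\<And>B. B \<in> \<P> \<Longrightarrow> c B \<in> PiE I X" and z: "z \<in> PiE I X"
  shows "\<exists>y\<in>PiE I X. (\<forall>B\<in>\<P>. \<forall>i\<in>B. y i = c B i) \<and> (\<forall>i. i \<notin> S \<longrightarrow> y i = z i)"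
proof -
  define b where "b i = (THE B. B \<in> \<P> \<and> i \<in> B)" for i
  define y where "y i = (if i \<in> S then c (b i) i else z i)" for i
  have b: "b i = B" if "B \<in> \<P>" "i \<in> B" for B i
    unfolding b_def
  proof (rule the_equality)
    show "B' = B" if "B' \<in> \<P> \<and> i \<in> B'" for B'
      using P that \<open>B \<in> \<P>\<close> \<open>i \<in> B\<close> by (auto simp: partition_on_def disjoint_def)
  qed (use that in auto)
  have S: "\<exists>B\<in>\<P>. i \<in> B" if "i \<in> S" for i using P that by (auto simp: partition_on_def)
  have "y i = c B i" if "B \<in> \<P>" "i \<in> B" for B i
    using that b P by (auto simp: y_def partition_on_def)
  moreover have "y i = z i" if "i \<notin> S" for i using that by (simp add: y_def)
  moreover have "y i \<in> X i" if "i \<in> I" for i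
  proof (cases "i \<in> S")
    case True
    then obtain B where "B \<in> \<P>" "i \<in> B" using S by auto
    then show ?thesis using True b c[of B] that by (auto simp: y_def)
  qed (use z that in \<open>auto simp: y_def\<close>)
  moreover have "y i = undefined" if "i \<notin> I" for i
  proof (cases "i \<in> S")
    case True
    then obtain B where "B \<in> \<P>" "i \<in> B" using S by auto
    then show ?thesis using True b c[of B] that by (auto simp: y_def PiE_iff extensional_def)
  qed (use z that in \<open>auto simp: y_def PiE_iff extensional_def\<close>)
  ultimately show ?thesis by (intro bexI[of _ y]) (auto simp: PiE_iff extensional_def)
qed

context lottery_pref
begin

section \<open>Certainty equivalents\<close>

lemmas assemble = assemble_point[where I = I and X = "\<lambda>i. {lo i..hi i}", folded Z_def]

abbreviation "bot_pt \<equiv> restrict lo I"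
abbreviation "top_pt \<equiv> restrict hi I"

text \<open>The intermediate value theorem along the diagonal from the bottom to the top
  point.\<close>

lemma intermediate_point:
  assumes h: "continuous_on Z h" and c: "h bot_pt \<le> (c :: real)" "c \<le> h top_pt"
  obtains y where "y \<in> Z" "h y = c"
proof -
  define d where "d t = (\<lambda>i\<in>I. lo i + t * (hi i - lo i))" for t :: real
  have dZ: "d t \<in> Z" if "0 \<le> t" "t \<le> 1" for t
  proof -
    have "lo i + t * (hi i - lo i) \<le> hi i" if "i \<in> I" for i
    proof -
      have "t * (hi i - lo i) \<le> 1 * (hi i - lo i)"
        by (rule mult_right_mono) (use lo_less_hi[OF that] \<open>t \<le> 1\<close> in auto)
      then show ?thesis by (simp add: algebra_simps)
    qed
    then show ?thesis using that lo_less_hi by (auto simp: d_def Z_def less_imp_le)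
  qed
  have "continuous_on {0..1} d"
  proof (rule continuous_on_coordinatewise_then_product)
    fix i show "continuous_on {0..1} (\<lambda>t. d t i)"
      by (cases "i \<in> I") (auto simp: d_def intro!: continuous_intros)
  qed
  then have "continuous_on {0..1} (\<lambda>t. h (d t))"
    by (rule continuous_on_compose2[OF h]) (use dZ in auto)
  moreover have "d 0 = bot_pt" "d 1 = top_pt" by (auto simp: d_def restrict_def)
  ultimately obtain t where "0 \<le> t" "t \<le> 1" "h (d t) = c"
    using IVT'[of "\<lambda>t. h (d t)" 0 c 1] c by auto
  then show ?thesis using that dZ by blast
qed

lemma bot_le: "y \<in> Z \<Longrightarrow> i \<in> I \<Longrightarrow> bot_pt i \<le> y i" and le_top: "y \<in> Z \<Longrightarrow> i \<in> I \<Longrightarrow> y i \<le> top_pt i"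
  by (auto simp: Z_def)

lemma repr_point_bounds:
  assumes "repr S z V" "z \<in> Z" "y \<in> Z" "S \<subseteq> I"
  shows "V (return_pmf bot_pt) \<le> V (return_pmf y)" "V (return_pmf y) \<le> V (return_pmf top_pt)"
proof -
  show "V (return_pmf bot_pt) \<le> V (return_pmf y)"
    by (rule repr_mono[OF assms(1,2) lo_in_Z assms(3)]) (use bot_le assms in blast)
  show "V (return_pmf y) \<le> V (return_pmf top_pt)"
    by (rule repr_mono[OF assms(1,2,3) hi_in_Z]) (use le_top assms in blast)
qed

text \<open>Given the coordinates in the root cell, what remains is a lottery on
  \<open>B - A\<close>, which has an equivalent point by induction. Hence all conditional values of
  \<open>V\<close> lie between its values at the bottom and the top point, so does their mean, and
  continuity supplies a point with that value.\<close>

lemma good_certainty_equivalent: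
  assumes "good K S R" "z \<in> Z" "p \<in> L"
  shows "\<exists>y\<in>Z. eqv S z p (return_pmf y)"
  using assms
proof (induction arbitrary: z p rule: good.induct)
  case (good S K \<P> R)
  have "\<exists>y\<in>Z. eqv B z p (return_pmf y)" if B: "B \<in> \<P>" for B
  proof -
    have BI: "B \<subseteq> I" using B Sep_partition[OF good.hyps(2)] good.hyps(1) by (auto simp: partition_on_def)
    from bspec[OF good.IH B] obtain A where A: "root_cell R B A"
      and IH: "\<And>z p. z \<in> Z \<Longrightarrow> p \<in> L \<Longrightarrow> \<exists>y\<in>Z. eqv (B - A) z p (return_pmf y)"
      by blast
    obtain V where V: "repr B z V" "condaff L A V"
      using root_cellD(3)[OF A] good.prems(1) unfolding Util_def by blast
    let ?c = "\<lambda>f. cond_pmf p (cyl A f)"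
    have bd: "V (return_pmf bot_pt) \<le> V (?c f) \<and> V (?c f) \<le> V (return_pmf top_pt)"
      if f: "f \<in> set_pmf p" for f
    proof -
      have fZ: "f \<in> Z" using f good.prems(2) by (rule lotteriesD(2)[rotated])
      have qL: "?c f \<in> L" using cond_in_lotteries[OF good.prems(2) f] .
      let ?z = "override_on z f A"
      have zZ: "?z \<in> Z" using good.prems fZ by simp
      obtain y where y: "y \<in> Z" "eqv (B - A) ?z (?c f) (return_pmf y)" using IH[OF zZ qL] by blast
      \<comment> \<open>The coordinates of \<open>f\<close> in \<open>A\<close> together with the
        inductively found equivalent below \<open>A\<close>.\<close>
      define u where "u = override_on ?z y (B - A)"
      have uZ: "u \<in> Z" using y zZ by (simp add: u_def)
      have e: "sect B z (?c f) = sect (B - A) ?z (?c f)"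
      proof (rule sect_cong_set)
        fix g assume "g \<in> set_pmf (?c f)"
        then have "g \<in> cyl A f" using f by simp
        then show "override_on z g B = override_on ?z g (B - A)"
          using root_cellD(2)[OF A] by (intro ext) (auto simp: cyl_def override_on_apply)
      qed
      have "override_on z u B = u"
        using root_cellD(2)[OF A] by (intro ext) (auto simp: u_def override_on_apply)
      then have "eqv B z (?c f) (return_pmf u)"
        using y(2) unfolding eqv_def e by (simp add: u_def)
      then have "V (?c f) = V (return_pmf u)"
        using repr_eq[OF V(1) qL, of "return_pmf u"] uZ by simp
      then show ?thesis using repr_point_bounds[OF V(1) good.prems(1) uZ BI] by simp
    qed
    have "V p = measure_pmf.expectation p (\<lambda>f. V (?c f))"
      using V(2) good.prems(2) by (auto simp: condaff_def)
    then have bd: "V (return_pmf bot_pt) \<le> V p" "V p \<le> V (return_pmf top_pt)"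
      using expectation_in_interval[OF lotteriesD(1)[OF good.prems(2)] bd] by auto
    have "continuous_on Z (\<lambda>y. V (return_pmf y))" using V(1) by (simp add: repr_def)
    then obtain y where y: "y \<in> Z" "V (return_pmf y) = V p" using bd by (rule intermediate_point)
    then have "eqv B z p (return_pmf y)"
      using repr_eq[OF V(1) good.prems(2), of "return_pmf y"] by simp
    with y(1) show ?thesis by blast
  qed
  then have "\<forall>B\<in>\<P>. \<exists>y. y \<in> Z \<and> eqv B z p (return_pmf y)" by blast
  from bchoice[OF this] obtain c
    where c': "\<forall>B\<in>\<P>. c B \<in> Z \<and> eqv B z p (return_pmf (c B))" by (elim exE)
  note c = conjunct1[OF bspec[OF c']] conjunct2[OF bspec[OF c']]
  obtain y where y: "y \<in> Z" "\<forall>B\<in>\<P>. \<forall>i\<in>B. y i = c B i"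
    using assemble[where c = c, OF Sep_partition[OF good.hyps(2)] c(1) good.prems(1)] by blast
  have "eqv S z p (return_pmf y)"
  proof (rule Sep_eqv'[OF good.hyps(2) good.prems])
    fix B assume B: "B \<in> \<P>"
    have "override_on z y B = override_on z (c B) B" using bspec[OF y(2) B] by (auto simp: override_on_def)
    then show "eqv B z p (return_pmf y)" using c(2)[OF B] by (simp add: eqv_def)
  qed (use y(1) in simp)
  then show ?case using y(1) by blast
qed

end

text \<open>The equivalents are asked for on arbitrary \<open>S\<close>, not just on subtrees;
  restricting one tree to \<open>S\<close> provides them.\<close>

locale lottery_pref_ce = lottery_pref +
  assumes certainty_equivalent: "S \<subseteq> I \<Longrightarrow> z \<in> Z \<Longrightarrow> p \<in> L \<Longrightarrow> \<exists>y\<in>Z. eqv S z p (return_pmf y)"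
begin

lemma repr_bounds:
  assumes V: "repr S z V" and h: "z \<in> Z" "p \<in> L" "S \<subseteq> I"
  shows "V (return_pmf bot_pt) \<le> V p" "V p \<le> V (return_pmf top_pt)"
proof -
  obtain y where y: "y \<in> Z" "eqv S z p (return_pmf y)" using certainty_equivalent h by blast
  then have "V p = V (return_pmf y)" using repr_eq[OF V h(2), of "return_pmf y"] by simp
  then show "V (return_pmf bot_pt) \<le> V p" "V p \<le> V (return_pmf top_pt)"
    using repr_point_bounds[OF V h(1) y(1) h(3)] by simp_all
qed

lemma repr_top_bot:
  assumes "repr S z V" "z \<in> Z" "S \<subseteq> I" "S \<noteq> {}"
  shows "V (return_pmf bot_pt) < V (return_pmf top_pt)"
proof -
  obtain i where i: "i \<in> S" using assms(4) by auto
  show ?thesis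
  proof (rule repr_strict_mono[OF assms(1,2) lo_in_Z hi_in_Z _ i])
    show "bot_pt j \<le> top_pt j" if "j \<in> S" for j
      using bot_le[OF hi_in_Z] that assms(3) by blast
    show "bot_pt i < top_pt i" using i assms(3) lo_less_hi by auto
  qed
qed

text \<open>
  The cells \<open>A\<close> and \<open>A'\<close> may be disjoint: conditioning on either one splits a mixture of the top and
  the bottom point.
\<close>

lemma repr_unique:
  assumes S: "S \<subseteq> I" "z \<in> Z"
    and V: "repr S z V" "condaff L A V" "A \<noteq> {}" "A \<subseteq> S"
    and V': "repr S z V'" "condaff L A' V'" "A' \<noteq> {}" "A' \<subseteq> S"
  obtains a b where "a > 0" "\<And>p. p \<in> L \<Longrightarrow> V' p = a * V p + b"
proof -
  let ?m = "\<lambda>V. V (return_pmf bot_pt)" and ?M = "\<lambda>V. V (return_pmf top_pt)"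
  have S0: "S \<noteq> {}" using V by auto
  note lt = repr_top_bot[OF V(1) S(2,1) S0] repr_top_bot[OF V'(1) S(2,1) S0]
  have lohi: "return_pmf top_pt \<in> L" "return_pmf bot_pt \<in> L"
    using lo_in_Z hi_in_Z by simp_all
  have mixV: "U (mix r (return_pmf top_pt) (return_pmf bot_pt)) = r * ?M U + (1 - r) * ?m U"
    if r: "0 \<le> r" "r \<le> 1" and U: "condaff L D U" and D: "D \<noteq> {}" "D \<subseteq> S" for U D r
  proof (rule condaff_mix[OF U lohi r])
    obtain i where "i \<in> D" using D by auto
    then show "\<exists>i\<in>D. f i \<noteq> g i"
      if "f \<in> set_pmf (return_pmf top_pt)" "g \<in> set_pmf (return_pmf bot_pt)" for f g
      using that lo_less_hi[of i] D S by (intro bexI[of _ i]) auto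
  qed
  have eq: "V' p = ((?M V' - ?m V') / (?M V - ?m V)) * V p
      + (?m V' - ((?M V' - ?m V') / (?M V - ?m V)) * ?m V)" if p: "p \<in> L" for p
  proof -
    define r where "r = (V p - ?m V) / (?M V - ?m V)"
    have r: "0 \<le> r" "r \<le> 1"
      using repr_bounds[OF V(1) S(2) p S(1)] lt by (auto simp: r_def field_simps)
    let ?q = "mix r (return_pmf top_pt) (return_pmf bot_pt)"
    have q: "?q \<in> L" using lohi by (rule mix_in_lotteries)
    have "V ?q = ?m V + r * (?M V - ?m V)" by (simp add: mixV[OF r V(2-4)] algebra_simps)
    also have "\<dots> = V p" using lt by (simp add: r_def)
    finally have "eqv S z p ?q" using repr_eq[OF V(1) p q] by simp
    then have "V' p = V' ?q" using repr_eq[OF V'(1) p q] by simp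
    also have "\<dots> = ?m V' + r * (?M V' - ?m V')" by (simp add: mixV[OF r V'(2-4)] algebra_simps)
    also have "r * (?M V' - ?m V') = ((?M V' - ?m V') / (?M V - ?m V)) * (V p - ?m V)"
      by (simp add: r_def)
    finally show ?thesis by (simp only: right_diff_distrib)
  qed
  show ?thesis
    by (rule that[of "(?M V' - ?m V') / (?M V - ?m V)"]) (use lt eq in auto)
qed

lemma Util_Un:
  assumes S: "S \<subseteq> I" and A: "A \<noteq> {}" "A \<subseteq> S" "Util A S" and A': "A' \<noteq> {}" "A' \<subseteq> S" "Util A' S"
  shows "Util (A \<union> A') S"
  unfolding Util_def
proof
  fix z assume z: "z \<in> Z"
  obtain V where V: "repr S z V" "condaff L A V" using A(3) z unfolding Util_def by blast
  obtain V' where V': "repr S z V'" "condaff L A' V'" using A'(3) z unfolding Util_def by blast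
  obtain a b where "a > 0" and ab: "\<And>p. p \<in> L \<Longrightarrow> V p = a * V' p + b"
    by (rule repr_unique[OF S z V' A'(1,2) V A(1,2)]) blast
  have "condaff L A' V" by (rule condaff_affine[OF V'(2) ab])
  then have "condaff L (A \<union> A') V" by (rule condaff_Un[OF V(2)])
  with V(1) show "\<exists>V. repr S z V \<and> condaff L (A \<union> A') V" by blast
qed

end

section \<open>Additive blocks\<close>

lemma sect_const:
  assumes "\<And>g i. g \<in> set_pmf q \<Longrightarrow> i \<in> S \<Longrightarrow> g i = f i"
  shows "sect S z q = return_pmf (override_on z f S)"
proof -
  have "sect S z q = map_pmf (\<lambda>_. override_on z f S) q"
    unfolding sect_def
  proof (rule map_pmf_cong[OF refl])
    fix g assume "g \<in> set_pmf q"
    then show "override_on z g S = override_on z f S" using assms by (auto simp: override_on_def)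
  qed
  then show ?thesis by simp
qed

lemma sect_eq_sub:
  assumes "sect G z p = sect G z q" "C \<subseteq> G"
  shows "sect C z p = sect C z q"
proof -
  have "sect C z r = sect C z (sect G z r)" for r
    using assms(2) by (simp add: sect_sect Int_absorb1)
  then show ?thesis using assms(1) by metis
qed

definition glue :: "nat set \<Rightarrow> point pmf \<Rightarrow> point pmf \<Rightarrow> point pmf" where
  "glue G p q = map_pmf (\<lambda>(f, h). override_on h f G) (pair_pmf p q)"

lemma sect_glue_left:
  assumes "C \<subseteq> G"
  shows "sect C z (glue G p q) = sect C z p"
proof -
  have "sect C z (glue G p q) = map_pmf (\<lambda>x. override_on z (fst x) C) (pair_pmf p q)"
    unfolding sect_def glue_def map_pmf_comp
    by (rule map_pmf_cong) (use assms in \<open>auto simp: fun_eq_iff override_on_apply split: prod.splits\<close>)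
  also have "\<dots> = sect C z (map_pmf fst (pair_pmf p q))" by (simp add: sect_def map_pmf_comp)
  finally show ?thesis by (simp add: map_fst_pair_pmf)
qed

lemma sect_glue_right:
  assumes "C \<inter> G = {}"
  shows "sect C z (glue G p q) = sect C z q"
proof -
  have "sect C z (glue G p q) = map_pmf (\<lambda>x. override_on z (snd x) C) (pair_pmf p q)"
    unfolding sect_def glue_def map_pmf_comp
    by (rule map_pmf_cong) (use assms in \<open>auto simp: fun_eq_iff override_on_apply split: prod.splits\<close>)
  also have "\<dots> = sect C z (map_pmf snd (pair_pmf p q))" by (simp add: sect_def map_pmf_comp)
  finally show ?thesis by (simp add: map_snd_pair_pmf)
qed

lemma set_glue: "set_pmf (glue G p q) = (\<lambda>(f, h). override_on h f G) ` (set_pmf p \<times> set_pmf q)"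
  by (simp add: glue_def)

context lottery_pref_ce
begin

lemma glue_in_L: "p \<in> L \<Longrightarrow> q \<in> L \<Longrightarrow> glue G p q \<in> L"
  unfolding lotteries_def by (auto simp: set_glue intro!: override_in_Z)

definition EU :: "(point pmf \<Rightarrow> real) \<Rightarrow> bool" where
  "EU V \<longleftrightarrow> (\<forall>p\<in>L. V p = measure_pmf.expectation p (\<lambda>f. V (return_pmf f)))"

lemma EUD: "EU V \<Longrightarrow> p \<in> L \<Longrightarrow> V p = measure_pmf.expectation p (\<lambda>f. V (return_pmf f))"
  by (simp only: EU_def)

text \<open>Given all coordinates in \<open>S\<close>, the section is a sure point, so averaging
  conditional values is averaging over points.\<close>

lemma condaff_iff_EU:
  assumes V: "repr S z V" and z: "z \<in> Z"
  shows "condaff L S V \<longleftrightarrow> EU V"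
proof -
  have "measure_pmf.expectation p (\<lambda>f. V (cond_pmf p (cyl S f))) =
      measure_pmf.expectation p (\<lambda>f. V (return_pmf f))" if p: "p \<in> L" for p
  proof (rule expectation_cong)
    fix f assume f: "f \<in> set_pmf p"
    have "sect S z (cond_pmf p (cyl S f)) = return_pmf (override_on z f S)"
      by (rule sect_const) (use set_cond_cyl[OF f, of S] in \<open>auto simp: cyl_def\<close>)
    then have "eqv S z (cond_pmf p (cyl S f)) (return_pmf f)" by (simp add: eqv_def)
    then show "V (cond_pmf p (cyl S f)) = V (return_pmf f)"
      using repr_eq[OF V cond_in_lotteries[OF p f], of "return_pmf f"] lotteriesD(2)[OF p f] by simp
  qed
  then show ?thesis unfolding condaff_def EU_def by simp
qed

lemma repr_point_cong:
  assumes V: "repr S z V" and "x \<in> Z" "y \<in> Z" "\<And>i. i \<in> S \<Longrightarrow> x i = y i"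
  shows "V (return_pmf x) = V (return_pmf y)"
proof -
  have "override_on z x S = override_on z y S" using assms(4) by (auto simp: override_on_def)
  then have "eqv S z (return_pmf x) (return_pmf y)" by (simp add: eqv_def)
  then show ?thesis using repr_eq[OF V, of "return_pmf x" "return_pmf y"] assms(2,3) by simp
qed

lemma repr_scale:
  assumes "repr S z V" "a > 0"
  shows "repr S z (\<lambda>p. a * V p)"
  using assms unfolding repr_def by (auto intro: continuous_intros)

lemma EU_scale:
  assumes "EU V"
  shows "EU (\<lambda>p. a * V p)"
  unfolding EU_def
proof
  fix p assume p: "p \<in> L"
  show "a * V p = measure_pmf.expectation p (\<lambda>f. a * V (return_pmf f))"
    using expectation_affine[OF lotteriesD(1)[OF p], of a "\<lambda>f. V (return_pmf f)" 0] EUD[OF assms p] by simp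
qed

lemma EU_add:
  assumes "EU V" "EU V'"
  shows "EU (\<lambda>p. V p + V' p)"
  unfolding EU_def
proof
  fix p assume p: "p \<in> L"
  show "V p + V' p = measure_pmf.expectation p (\<lambda>f. V (return_pmf f) + V' (return_pmf f))"
    using expectation_add[OF lotteriesD(1)[OF p], of "\<lambda>f. V (return_pmf f)" "\<lambda>f. V' (return_pmf f)"]
      EUD[OF assms(1) p] EUD[OF assms(2) p] by simp
qed

lemma EU_mix_points:
  assumes "EU V" "x \<in> Z" "y \<in> Z"
  shows "V (mix (1 / 2) (return_pmf x) (return_pmf y)) = (V (return_pmf x) + V (return_pmf y)) / 2"
proof -
  have "mix (1 / 2) (return_pmf x) (return_pmf y) \<in> L" by (rule mix_in_lotteries) (use assms in auto)
  from EUD[OF assms(1) this] show ?thesis by (simp add: expectation_mix field_simps)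
qed

text \<open>Each block of \<open>\<P>\<close> lies inside \<open>G\<close> or outside it, so the
  partition cannot see any correlation between \<open>B \<inter> G\<close> and
  \<open>B - G\<close>.\<close>

lemma Sep_marginals:
  assumes P: "Sep K S \<P>" and G: "G \<in> \<P>" and B: "B \<subseteq> S" and z: "z \<in> Z" "p \<in> L" "q \<in> L"
    and e: "sect (B \<inter> G) z p = sect (B \<inter> G) z q" "sect (B - G) z p = sect (B - G) z q"
  shows "eqv B z p q"
proof (rule Sep_eqv'[OF Sep_restrict[OF P B] z])
  fix C assume "C \<in> (\<inter>) B ` \<P> - {{}}"
  then obtain G' where G': "G' \<in> \<P>" "C = B \<inter> G'" by auto
  have "C \<subseteq> B \<inter> G \<or> C \<subseteq> B - G"
    using Sep_partition[OF P] G G' by (cases "G = G'") (auto simp: partition_on_def disjoint_def)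
  then have "sect C z p = sect C z q" using sect_eq_sub e by blast
  then show "eqv C z p q" by (simp add: eqv_def)
qed

text \<open>Swapping the coordinates in \<open>B \<inter> G\<close> between two equally likely
  points preserves the marginals on both sides; expected utility turns the resulting indifference
  into an additive identity.\<close>

lemma EU_additive:
  assumes V: "repr B z V" "EU V" and P: "Sep K S \<P>" "G \<in> \<P>" and B: "B \<subseteq> S" and z: "z \<in> Z"
    and x: "x \<in> Z" "y \<in> Z"
  shows "V (return_pmf x) + V (return_pmf y) =
    V (return_pmf (override_on x y (B \<inter> G))) + V (return_pmf (override_on y x (B \<inter> G)))"
proof -
  let ?x = "override_on x y (B \<inter> G)" and ?y = "override_on y x (B \<inter> G)"
  let ?p = "mix (1 / 2) (return_pmf x) (return_pmf y)" and ?q = "mix (1 / 2) (return_pmf ?x) (return_pmf ?y)"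
  have xy: "?x \<in> Z" "?y \<in> Z" using x by simp_all
  have L: "?p \<in> L" "?q \<in> L" using x xy by (auto intro!: mix_in_lotteries)
  have "override_on z ?x (B \<inter> G) = override_on z y (B \<inter> G)"
    "override_on z ?y (B \<inter> G) = override_on z x (B \<inter> G)"
    "override_on z ?x (B - G) = override_on z x (B - G)"
    "override_on z ?y (B - G) = override_on z y (B - G)"
    by (auto simp: override_on_def)
  then have "sect (B \<inter> G) z ?p = sect (B \<inter> G) z ?q" "sect (B - G) z ?p = sect (B - G) z ?q"
    by (simp_all add: sect_mix) (rule mix_half_commute)
  then have "eqv B z ?p ?q" by (rule Sep_marginals[OF P B z L])
  then have "V ?p = V ?q" using repr_eq[OF V(1) L] by simp
  then show ?thesis using EU_mix_points[OF V(2) x] EU_mix_points[OF V(2) xy] by simp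
qed

section \<open>Splitting a tree across separable blocks\<close>

text \<open>The form in which separability enters the splitting: \<open>V\<close> is blind to
  correlation between \<open>G\<close> and \<open>H\<close>.\<close>

definition determined :: "nat set \<Rightarrow> nat set \<Rightarrow> point \<Rightarrow> (point pmf \<Rightarrow> real) \<Rightarrow> bool" where
  "determined G H z V \<longleftrightarrow> (\<forall>p\<in>L. \<forall>q\<in>L. sect G z p = sect G z q \<longrightarrow> sect H z p = sect H z q \<longrightarrow> V p = V q)"

lemma determinedD:
  assumes "determined G H z V" "p \<in> L" "q \<in> L" "sect G z p = sect G z q" "sect H z p = sect H z q"
  shows "V p = V q"
  by (rule assms(1)[unfolded determined_def, rule_format]) (fact assms)+

lemma determined_commute:
  assumes "determined G H z V"
  shows "determined H G z V"
  unfolding determined_def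
proof (intro ballI impI)
  fix p q assume "p \<in> L" "q \<in> L" "sect H z p = sect H z q" "sect G z p = sect G z q"
  then show "V p = V q" by (intro determinedD[OF assms])
qed

context
  fixes B z V A G H i0
  assumes V: "repr B z V" "condaff L A V" and z: "z \<in> Z"
    and GH: "G \<inter> H = {}"
    and det: "determined G H z V"
    and i0: "i0 \<in> A" "i0 \<in> G" "i0 \<in> I"
begin

text \<open>
  The two half-half mixtures behind the two sides have the same marginals on \<open>G\<close> and on \<open>H\<close>, and
  each is split by the coordinate \<open>i0\<close>.
\<close>

lemma split_exchange:
  assumes q: "q1 \<in> L" "q1' \<in> L" "q \<in> L" "q' \<in> L"
    and dis: "\<And>f f'. f \<in> set_pmf q1 \<Longrightarrow> f' \<in> set_pmf q1' \<Longrightarrow> f i0 \<noteq> f' i0"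
  shows "V (glue G q1 q) + V (glue G q1' q') = V (glue G q1 q') + V (glue G q1' q)"
proof -
  have m: "V (mix (1 / 2) (glue G q1 r) (glue G q1' r')) = (V (glue G q1 r) + V (glue G q1' r')) / 2"
    if r: "r \<in> L" "r' \<in> L" for r r'
  proof -
    have "V (mix (1 / 2) (glue G q1 r) (glue G q1' r')) =
        1 / 2 * V (glue G q1 r) + (1 - 1 / 2) * V (glue G q1' r')"
    proof (rule condaff_mix[OF V(2)])
      fix f g assume "f \<in> set_pmf (glue G q1 r)" "g \<in> set_pmf (glue G q1' r')"
      then show "\<exists>i\<in>A. f i \<noteq> g i"
        using dis i0 by (intro bexI[of _ i0]) (auto simp: set_glue)
    qed (use q r glue_in_L in auto)
    then show ?thesis by simp
  qed
  have "V (mix (1 / 2) (glue G q1 q) (glue G q1' q')) = V (mix (1 / 2) (glue G q1 q') (glue G q1' q))"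
  proof (rule determinedD[OF det])
    show "sect G z (mix (1 / 2) (glue G q1 q) (glue G q1' q')) =
        sect G z (mix (1 / 2) (glue G q1 q') (glue G q1' q))"
      by (simp add: sect_mix sect_glue_left)
    have "H \<inter> G = {}" using GH by auto
    then show "sect H z (mix (1 / 2) (glue G q1 q) (glue G q1' q')) =
        sect H z (mix (1 / 2) (glue G q1 q') (glue G q1' q))"
      by (simp add: sect_mix sect_glue_right) (rule mix_half_commute)
  qed (use q glue_in_L mix_in_lotteries in auto)
  then show ?thesis using m q by simp
qed

lemma fresh_value:
  assumes "finite F"
  obtains s where "s \<in> {lo i0..hi i0}" "s \<notin> F"
proof -
  have "infinite ({lo i0..hi i0} - F)"
    using assms lo_less_hi[OF i0(3)] by (simp add: infinite_Icc)
  then show ?thesis using that by (metis DiffE ex_in_conv finite.emptyI)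
qed

lemma update_in_Z: "g \<in> Z \<Longrightarrow> s \<in> {lo i0..hi i0} \<Longrightarrow> g(i0 := s) \<in> Z"
  using i0 by (auto simp: Z_def PiE_iff extensional_def)

text \<open>A value \<open>s\<close> of the coordinate \<open>i0\<close> that occurs neither in
  \<open>q1\<close> nor in \<open>g\<close> gives a point distinguishable from both. Exchanging each
  of them with that point expresses both differences by the same third one.\<close>

lemma split_difference:
  assumes q: "q1 \<in> L" "q \<in> L" "q' \<in> L" and g: "g \<in> Z"
  shows "V (glue G q1 q) - V (glue G q1 q') = V (glue G (return_pmf g) q) - V (glue G (return_pmf g) q')"
proof -
  have "finite (insert (g i0) ((\<lambda>f. f i0) ` set_pmf q1))" using lotteriesD(1)[OF q(1)] by simp
  then obtain s where s: "s \<in> {lo i0..hi i0}" "s \<notin> insert (g i0) ((\<lambda>f. f i0) ` set_pmf q1)"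
    by (rule fresh_value)
  let ?g = "g(i0 := s)"
  have gL: "return_pmf ?g \<in> L" "return_pmf g \<in> L" using update_in_Z[OF g s(1)] g by simp_all
  have "V (glue G q1 q) + V (glue G (return_pmf ?g) q') = V (glue G q1 q') + V (glue G (return_pmf ?g) q)"
    by (rule split_exchange[OF q(1) gL(1) q(2,3)]) (use s in auto)
  moreover have "V (glue G (return_pmf g) q) + V (glue G (return_pmf ?g) q') =
      V (glue G (return_pmf g) q') + V (glue G (return_pmf ?g) q)"
    by (rule split_exchange[OF gL(2,1) q(2,3)]) (use s in auto)
  ultimately show ?thesis by simp
qed

text \<open>Each outcome \<open>h\<close> of \<open>q\<close> is tagged by its own value of
  \<open>i0\<close>, which makes \<open>V\<close> affine in the mixture over \<open>h\<close>.
  Correlating tags with outcomes or making them independent yields the same marginals on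
  \<open>G\<close> and \<open>H\<close>, hence the same value; the tags then drop out because by
  \<open>split_difference\<close> increments in the second argument of \<open>glue\<close> do not
  depend on the first.\<close>

lemma split_affine:
  assumes q: "q \<in> L" and g: "g \<in> Z"
  shows "V (glue G (return_pmf g) q) =
    measure_pmf.expectation q (\<lambda>h. V (glue G (return_pmf g) (return_pmf h)))"
proof -
  note fin = lotteriesD(1)[OF q]
  have "infinite {lo i0..hi i0}" using lo_less_hi[OF i0(3)] by (simp add: infinite_Icc)
  then obtain F where F: "F \<subseteq> {lo i0..hi i0}" "finite F" "card F = card (set_pmf q)"
    using infinite_arbitrarily_large by metis
  then obtain t where t: "t ` set_pmf q \<subseteq> F" "inj_on t (set_pmf q)"
    using card_le_inj[OF fin F(2)] by auto
  define a where "a h = g(i0 := t h)" for h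
  have aZ: "a h \<in> Z" if "h \<in> set_pmf q" for h
  proof -
    have "t h \<in> {lo i0..hi i0}" using t(1) F(1) that by blast
    then show ?thesis unfolding a_def by (rule update_in_Z[OF g])
  qed
  have hZ: "h \<in> Z" if "h \<in> set_pmf q" for h using lotteriesD(2)[OF q that] .
  \<comment> \<open>\<open>?k1\<close> attaches to each tag the outcome it belongs to,
    \<open>?k2\<close> attaches all of \<open>q\<close> to every tag.\<close>
  let ?k1 = "\<lambda>h. glue G (return_pmf (a h)) (return_pmf h)" and ?k2 = "\<lambda>h. glue G (return_pmf (a h)) q"
  have k: "?k1 h \<in> L" "?k2 h \<in> L" if "h \<in> set_pmf q" for h
    using aZ[OF that] hZ[OF that] q by (auto intro!: glue_in_L)
  have dis: "\<exists>i\<in>A. f i \<noteq> f' i"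
    if "h \<in> set_pmf q" "h' \<in> set_pmf q" "h \<noteq> h'" "f \<in> set_pmf (glue G (return_pmf (a h)) r)"
      "f' \<in> set_pmf (glue G (return_pmf (a h')) r')" for h h' f f' r r'
    using that t(2) i0 by (intro bexI[of _ i0]) (auto simp: set_glue a_def inj_on_def)
  have e1: "V (bind_pmf q ?k1) = measure_pmf.expectation q (\<lambda>h. V (?k1 h))"
    by (rule condaff_bind[OF V(2) fin k(1)]) (use dis in blast)+
  have e2: "V (bind_pmf q ?k2) = measure_pmf.expectation q (\<lambda>h. V (?k2 h))"
    by (rule condaff_bind[OF V(2) fin k(2)]) (use dis in blast)+
  have HG: "H \<inter> G = {}" using GH by auto
  have "V (bind_pmf q ?k1) = V (bind_pmf q ?k2)"
  proof (rule determinedD[OF det])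
    show "sect G z (bind_pmf q ?k1) = sect G z (bind_pmf q ?k2)"
      by (simp only: sect_bind sect_glue_left[OF subset_refl])
    have "sect H z (bind_pmf q ?k1) = sect H z q"
      by (simp add: sect_bind sect_glue_right[OF HG]) (simp add: sect_def map_pmf_def)
    moreover have "sect H z (bind_pmf q ?k2) = sect H z q"
      by (simp only: sect_bind sect_glue_right[OF HG] bind_pmf_const)
    ultimately show "sect H z (bind_pmf q ?k1) = sect H z (bind_pmf q ?k2)" by simp
  qed (use fin k in \<open>auto intro!: bind_in_lotteries\<close>)
  then have "measure_pmf.expectation q (\<lambda>h. V (?k1 h)) = measure_pmf.expectation q (\<lambda>h. V (?k2 h))"
    by (simp only: e1 e2)
  also have "\<dots> = measure_pmf.expectation q (\<lambda>h. V (?k1 h) +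
      ((-1) * V (glue G (return_pmf g) (return_pmf h)) + V (glue G (return_pmf g) q)))"
  proof (rule expectation_cong)
    fix h assume h: "h \<in> set_pmf q"
    have "V (?k2 h) - V (?k1 h) =
        V (glue G (return_pmf g) q) - V (glue G (return_pmf g) (return_pmf h))"
      by (rule split_difference) (use aZ[OF h] hZ[OF h] q g in auto)
    then show "V (?k2 h) = V (?k1 h) +
      ((-1) * V (glue G (return_pmf g) (return_pmf h)) + V (glue G (return_pmf g) q))" by simp
  qed
  also have "\<dots> = measure_pmf.expectation q (\<lambda>h. V (?k1 h)) +
      ((-1) * measure_pmf.expectation q (\<lambda>h. V (glue G (return_pmf g) (return_pmf h)))
        + V (glue G (return_pmf g) q))"
    by (subst expectation_add[OF fin], subst expectation_affine[OF fin]) (rule refl)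
  finally show ?thesis by simp
qed

text \<open>A section at \<open>z\<close> has its \<open>G\<close> part sure, so
  \<open>split_affine\<close> applies with \<open>g = z\<close>.\<close>

lemma split_EU:
  assumes G': "G' \<subseteq> H"
  shows "EU (\<lambda>p. V (sect G' z p))"
  unfolding EU_def
proof
  fix p assume p: "p \<in> L"
  have e: "V (sect G' z r) = V (glue G (return_pmf z) (sect G' z r))" if "r \<in> L" for r
  proof (rule determinedD[OF det])
    have HG: "H \<inter> G = {}" using GH by auto
    have 1: "sect G z (sect G' z r) = return_pmf z"
    proof -
      have "G' \<inter> G = {}" using G' GH by auto
      then show ?thesis by (simp add: sect_sect sect_empty)
    qed
    show "sect G z (sect G' z r) = sect G z (glue G (return_pmf z) (sect G' z r))"
      by (simp add: 1 sect_glue_left)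
    show "sect H z (sect G' z r) = sect H z (glue G (return_pmf z) (sect G' z r))"
      by (simp add: sect_glue_right[OF HG])
  qed (use z that glue_in_L in auto)
  have "V (sect G' z p) = measure_pmf.expectation (sect G' z p)
      (\<lambda>h. V (glue G (return_pmf z) (return_pmf h)))"
    unfolding e[OF p] by (rule split_affine) (use p z in auto)
  also have "\<dots> = measure_pmf.expectation p (\<lambda>f. V (glue G (return_pmf z) (sect G' z (return_pmf f))))"
    by (subst sect_def) simp
  also have "\<dots> = measure_pmf.expectation p (\<lambda>f. V (sect G' z (return_pmf f)))"
  proof (rule expectation_cong)
    fix f assume "f \<in> set_pmf p"
    then show "V (glue G (return_pmf z) (sect G' z (return_pmf f))) = V (sect G' z (return_pmf f))"
      using e[of "return_pmf f"] lotteriesD(2)[OF p] by simp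
  qed
  finally show "V (sect G' z p) = \<dots>" .
qed

end

text \<open>With a coordinate of \<open>A\<close> on each side, the splitting works in both
  directions: \<open>V\<close> is additive across \<open>G\<close> and \<open>H\<close>, and affine
  in either part.\<close>

lemma split_EU_both:
  assumes V: "repr B z V" "condaff L A V" and z: "z \<in> Z"
    and GH: "G \<inter> H = {}"
    and det: "determined G H z V"
    and i: "i \<in> A" "i \<in> G" "i \<in> I" and j: "j \<in> A" "j \<in> H" "j \<in> I"
  shows "EU V"
  unfolding EU_def
proof
  fix p assume p: "p \<in> L"
  note fin = lotteriesD(1)[OF p]
  have HG: "H \<inter> G = {}" using GH by auto
  have zL: "return_pmf z \<in> L" using z by simp
  have det': "determined H G z V" by (rule determined_commute[OF det])
  note G = split_difference[OF V z GH det i] split_affine[OF V z GH det i]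
  note H = split_affine[OF V z HG det' j]
  have swap: "V (glue G q r) = V (glue H r q)" if "q \<in> L" "r \<in> L" for q r
    by (rule determinedD[OF det]) (use that glue_in_L HG GH in \<open>auto simp: sect_glue_left sect_glue_right\<close>)
  have self: "V q = V (glue G q q)" if "q \<in> L" for q
    by (rule determinedD[OF det]) (use that glue_in_L HG in \<open>auto simp: sect_glue_left sect_glue_right\<close>)
  have sum: "V (glue G q r) = V (glue G q (return_pmf z)) + V (glue G (return_pmf z) r)
      - V (glue G (return_pmf z) (return_pmf z))" if "q \<in> L" "r \<in> L" for q r
    using G(1)[OF that zL z] by simp
  have "V p = V (glue H (return_pmf z) p) + V (glue G (return_pmf z) p)
      + (- V (glue G (return_pmf z) (return_pmf z)))"
    using self[OF p] sum[OF p p] swap[OF p zL] by simp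
  also have "V (glue H (return_pmf z) p) =
      measure_pmf.expectation p (\<lambda>f. V (glue H (return_pmf z) (return_pmf f)))"
    by (rule H) (use p z in auto)
  also have "V (glue G (return_pmf z) p) =
      measure_pmf.expectation p (\<lambda>f. V (glue G (return_pmf z) (return_pmf f)))"
    by (rule G) (use p z in auto)
  also have "measure_pmf.expectation p (\<lambda>f. V (glue H (return_pmf z) (return_pmf f))) +
      measure_pmf.expectation p (\<lambda>f. V (glue G (return_pmf z) (return_pmf f)))
      + (- V (glue G (return_pmf z) (return_pmf z))) =
    measure_pmf.expectation p (\<lambda>f. 1 * (V (glue H (return_pmf z) (return_pmf f)) +
      V (glue G (return_pmf z) (return_pmf f))) + (- V (glue G (return_pmf z) (return_pmf z))))"
    unfolding expectation_affine[OF fin] expectation_add[OF fin] by simp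
  also have "\<dots> = measure_pmf.expectation p (\<lambda>f. V (return_pmf f))"
  proof (rule expectation_cong)
    fix f assume "f \<in> set_pmf p"
    then have f: "return_pmf f \<in> L" using lotteriesD(2)[OF p] by simp
    show "1 * (V (glue H (return_pmf z) (return_pmf f)) + V (glue G (return_pmf z) (return_pmf f)))
        + (- V (glue G (return_pmf z) (return_pmf z))) = V (return_pmf f)"
      using self[OF f] sum[OF f f] swap[OF f zL] by simp
  qed
  finally show "V p = measure_pmf.expectation p (\<lambda>f. V (return_pmf f))" .
qed

end

section \<open>Joining overlapping expected-utility blocks\<close>

text \<open>The exchanges are available only up to the size \<open>e\<close>, but \<open>e\<close>
  is the same everywhere in the box, so they can be chained into shifts along a whole antidiagonal.
  The antidiagonals are thus the level sets, and monotonicity orders them.\<close>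

lemma box_sum_order:
  fixes \<Phi> :: "real \<Rightarrow> real \<Rightarrow> real"
  assumes strict: "\<And>s t s' t'. a \<le> s \<Longrightarrow> s \<le> s' \<Longrightarrow> s' \<le> A \<Longrightarrow> b \<le> t \<Longrightarrow> t \<le> t' \<Longrightarrow> t' \<le> B \<Longrightarrow>
      s < s' \<or> t < t' \<Longrightarrow> \<Phi> s t < \<Phi> s' t'"
    and e: "e > 0"
    and exch: "\<And>s t d. 0 < d \<Longrightarrow> d \<le> e \<Longrightarrow> a \<le> s \<Longrightarrow> s + d \<le> A \<Longrightarrow> b \<le> t - d \<Longrightarrow> t \<le> B \<Longrightarrow>
      \<Phi> s t = \<Phi> (s + d) (t - d)"
    and box: "a \<le> s" "s \<le> A" "b \<le> t" "t \<le> B" "a \<le> s'" "s' \<le> A" "b \<le> t'" "t' \<le> B"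
  shows "\<Phi> s t \<le> \<Phi> s' t' \<longleftrightarrow> s + t \<le> s' + t'"
proof -
  have step: "\<Phi> s t = \<Phi> (s + d) (t - d)"
    if h: "0 \<le> d" "a \<le> s" "s + d \<le> A" "b \<le> t - d" "t \<le> B" for s t d
  proof (cases "d = 0")
    case False
    then have d: "d > 0" using h by simp
    \<comment> \<open>The shift is cut into \<open>n\<close> equal pieces of length
      \<open>c\<close>, each at most \<open>e\<close>.\<close>
    obtain n :: nat where n: "d / e < real n" using reals_Archimedean2 by blast
    then have n0: "real n > 0" using d e by (meson divide_pos_pos less_trans)
    define c where "c = d / n"
    have de: "0 < c" "c \<le> e" and nc: "real n * c = d"
      using n n0 d e by (auto simp: c_def field_simps)
    have "k \<le> n \<Longrightarrow> \<Phi> s t = \<Phi> (s + real k * c) (t - real k * c)" for k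
    proof (induction k)
      case (Suc k)
      have "real (Suc k) * c \<le> real n * c"
        by (rule mult_right_mono) (use Suc.prems de in auto)
      moreover have S: "real (Suc k) * c = real k * c + c" by (simp add: algebra_simps)
      moreover have "0 \<le> real k * c" using de by simp
      ultimately have "\<Phi> (s + real k * c) (t - real k * c)
          = \<Phi> (s + real k * c + c) (t - real k * c - c)"
        using h nc by (intro exch de) linarith+
      then show ?case using Suc unfolding S by (simp add: add.assoc diff_diff_eq)
    qed simp
    from this[of n] show ?thesis by (simp add: nc)
  qed simp
  have lev: "\<Phi> s t = \<Phi> s' t'"
    if h: "a \<le> s" "s \<le> A" "b \<le> t" "t \<le> B" "a \<le> s'" "s' \<le> A" "b \<le> t'" "t' \<le> B" "s + t = s' + t'"
    for s t s' t'
  proof (cases "s \<le> s'")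
    case True
    have "\<Phi> s t = \<Phi> (s + (s' - s)) (t - (s' - s))" by (rule step) (use h True in linarith)+
    moreover have "t - (s' - s) = t'" using h by linarith
    ultimately show ?thesis by simp
  next
    case False
    have "\<Phi> s' t' = \<Phi> (s' + (s - s')) (t' - (s - s'))" by (rule step) (use h False in linarith)+
    moreover have "t' - (s - s') = t" using h by linarith
    ultimately show ?thesis by simp
  qed
  have lt: "\<Phi> s t < \<Phi> s' t'"
    if h: "a \<le> s" "s \<le> A" "b \<le> t" "t \<le> B" "a \<le> s'" "s' \<le> A" "b \<le> t'" "t' \<le> B" "s + t < s' + t'"
    for s t s' t'
  proof -
    \<comment> \<open>Slide \<open>(s, t)\<close> along its antidiagonal to a point that lies
      coordinatewise below \<open>(s', t')\<close>; the second term of the minimum keeps the second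
      coordinate at least \<open>b\<close>.\<close>
    define s1 where "s1 = min s' (s + t - b)"
    define t1 where "t1 = s + t - s1"
    have b1: "a \<le> s1" "s1 \<le> s'" "b \<le> t1" "t1 \<le> t'" "s1 + t1 = s + t"
      using h by (auto simp: s1_def t1_def min_def)
    have "\<Phi> s t = \<Phi> s1 t1" by (rule lev) (use h b1 in linarith)+
    also have "\<dots> < \<Phi> s' t'" by (rule strict) (use h b1 in linarith)+
    finally show ?thesis .
  qed
  consider "s + t < s' + t'" | "s + t = s' + t'" | "s' + t' < s + t" by linarith
  then show ?thesis
  proof cases
    case 1
    then show ?thesis using lt[OF box 1] by simp
  next
    case 2
    then show ?thesis using lev[OF box 2] by simp
  next
    case 3
    then show ?thesis using lt[OF box(5-8) box(1-4) 3] by simp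
  qed
qed

context lottery_pref_ce
begin

lemma continuous_repr: "repr S z V \<Longrightarrow> continuous_on Z (\<lambda>y. V (return_pmf y))"
  by (simp add: repr_def)

lemma continuous_override:
  assumes "repr S z V" "x \<in> Z"
  shows "continuous_on Z (\<lambda>y. V (return_pmf (override_on x y b)))"
  using continuous_section[OF assms(2) continuous_repr[OF assms(1)], of b] by simp

text \<open>By additivity, raising the coordinates in \<open>b\<close> from bottom to top gains the
  same amount \<open>d\<close> over every base. An interval of length at most \<open>d\<close> thus
  fits over a suitable base, and continuity in the coordinates in \<open>b\<close> attains both its
  ends.\<close>

lemma shift_points:
  assumes V: "repr S z V" and z: "z \<in> Z" and S: "S \<subseteq> I"
    and add: "\<And>x y. x \<in> Z \<Longrightarrow> y \<in> Z \<Longrightarrow> V (return_pmf x) + V (return_pmf y) =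
      V (return_pmf (override_on x y b)) + V (return_pmf (override_on y x b))"
    and e: "0 \<le> e" "e \<le> V (return_pmf (override_on bot_pt top_pt b)) - V (return_pmf bot_pt)"
    and s: "V (return_pmf bot_pt) \<le> s" "s + e \<le> V (return_pmf top_pt)"
  obtains x x' where "x \<in> Z" "x' \<in> Z" "\<And>i. i \<notin> b \<Longrightarrow> x i = x' i"
    "V (return_pmf x) = s" "V (return_pmf x') = s + e"
proof -
  let ?v = "\<lambda>x. V (return_pmf x)"
  note Z = lo_in_Z hi_in_Z
  define d where "d = ?v (override_on bot_pt top_pt b) - ?v bot_pt"
  have d1: "?v (override_on x top_pt b) = ?v (override_on x bot_pt b) + d" if x: "x \<in> Z" for x
  proof -
    have "override_on (override_on x bot_pt b) top_pt b = override_on x top_pt b"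
      "override_on top_pt (override_on x bot_pt b) b = override_on top_pt bot_pt b"
      by (auto simp: override_on_def)
    then have "?v (override_on x bot_pt b) + ?v top_pt = ?v (override_on x top_pt b) + ?v (override_on top_pt bot_pt b)"
      using add[of "override_on x bot_pt b" top_pt] x Z by simp
    moreover have "?v bot_pt + ?v top_pt = ?v (override_on bot_pt top_pt b) + ?v (override_on top_pt bot_pt b)"
      using add[OF Z] .
    ultimately show ?thesis by (simp add: d_def)
  qed
  \<comment> \<open>The smallest base value from which raising \<open>b\<close> still reaches
    \<open>s + e\<close>; since \<open>e\<close> is at most \<open>d\<close>, it does not exceed
    \<open>s\<close>.\<close>
  define r where "r = max (?v bot_pt) (s + e - d)"
  have r1: "?v (override_on bot_pt bot_pt b) \<le> r" by (simp add: r_def)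
  have r2: "r \<le> ?v (override_on top_pt bot_pt b)"
  proof -
    have "?v top_pt = ?v (override_on top_pt bot_pt b) + d" using d1[OF Z(2)] by simp
    moreover have "?v bot_pt \<le> ?v (override_on top_pt bot_pt b)"
      by (rule repr_point_bounds(1)[OF V z _ S]) (use Z in simp)
    ultimately show ?thesis using s by (simp add: r_def)
  qed
  have ov: "override_on bot_pt x (- b) = override_on x bot_pt b" for x
    by (auto simp: override_on_def)
  have "continuous_on Z (\<lambda>x. ?v (override_on bot_pt x (- b)))" by (rule continuous_override[OF V Z(1)])
  then obtain xa where xa: "xa \<in> Z" "?v (override_on bot_pt xa (- b)) = r"
    by (rule intermediate_point[of _ r]) (use r1 r2 ov in auto)
  have bnd: "?v (override_on xa bot_pt b) \<le> s" "s + e \<le> ?v (override_on xa top_pt b)"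
    using xa d1[OF xa(1)] s e by (auto simp: ov r_def d_def)
  have ct: "continuous_on Z (\<lambda>x. ?v (override_on xa x b))" by (rule continuous_override[OF V xa(1)])
  obtain y where y: "y \<in> Z" "?v (override_on xa y b) = s"
    by (rule intermediate_point[OF ct, of s]) (use bnd e in auto)
  obtain y' where y': "y' \<in> Z" "?v (override_on xa y' b) = s + e"
    by (rule intermediate_point[OF ct, of "s + e"]) (use bnd e in auto)
  show ?thesis
    by (rule that[of "override_on xa y b" "override_on xa y' b"]) (use xa y y' in auto)
qed

text \<open>On their overlaps with \<open>C\<close>, both \<open>F1\<close> and \<open>F2\<close>
  are measured in the unit of \<open>V\<close>. A small gain on \<open>D1 \<inter> C\<close> can
  therefore be offset by an equal loss on \<open>D2 \<inter> C\<close> within an indifference class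
  of \<open>C\<close>, and \<open>box_sum_order\<close> leaves the sum as the only
  possibility.\<close>

lemma join_repr:
  assumes z: "z \<in> Z" and D: "D1 \<inter> D2 = {}" "D1 \<subseteq> I" "D2 \<subseteq> I"
    and eqvD: "\<And>p q. p \<in> L \<Longrightarrow> q \<in> L \<Longrightarrow> eqv D1 z p q \<Longrightarrow> eqv D2 z p q \<Longrightarrow> eqv (D1 \<union> D2) z p q"
    and F1: "\<And>w. w \<in> Z \<Longrightarrow> (\<And>i. i \<notin> D1 \<union> D2 \<Longrightarrow> w i = z i) \<Longrightarrow> repr D1 w F1"
    and F2: "\<And>w. w \<in> Z \<Longrightarrow> (\<And>i. i \<notin> D1 \<union> D2 \<Longrightarrow> w i = z i) \<Longrightarrow> repr D2 w F2"
    and V: "\<And>w. w \<in> Z \<Longrightarrow> (\<And>i. i \<notin> D1 \<union> D2 \<Longrightarrow> w i = z i) \<Longrightarrow> repr C w V"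
    and ne: "D1 \<inter> C \<noteq> {}" "D2 \<inter> C \<noteq> {}"
    and A1: "\<And>x y. x \<in> Z \<Longrightarrow> y \<in> Z \<Longrightarrow> F1 (return_pmf x) + F1 (return_pmf y) =
      F1 (return_pmf (override_on x y (D1 \<inter> C))) + F1 (return_pmf (override_on y x (D1 \<inter> C)))"
    and A2: "\<And>x y. x \<in> Z \<Longrightarrow> y \<in> Z \<Longrightarrow> F2 (return_pmf x) + F2 (return_pmf y) =
      F2 (return_pmf (override_on x y (D2 \<inter> C))) + F2 (return_pmf (override_on y x (D2 \<inter> C)))"
    and C1: "\<And>x y. x \<in> Z \<Longrightarrow> y \<in> Z \<Longrightarrow>
      F1 (return_pmf (override_on x y (D1 \<inter> C))) - F1 (return_pmf x) =
      V (return_pmf (override_on x y (D1 \<inter> C))) - V (return_pmf x)"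
    and C2: "\<And>x y. x \<in> Z \<Longrightarrow> y \<in> Z \<Longrightarrow>
      F2 (return_pmf (override_on x y (D2 \<inter> C))) - F2 (return_pmf x) =
      V (return_pmf (override_on x y (D2 \<inter> C))) - V (return_pmf x)"
  shows "repr (D1 \<union> D2) z (\<lambda>p. F1 p + F2 p)"
proof -
  let ?D = "D1 \<union> D2" and ?b = "D1 \<inter> C" and ?c = "D2 \<inter> C"
  let ?f = "\<lambda>x. F1 (return_pmf x)" and ?g = "\<lambda>x. F2 (return_pmf x)" and ?v = "\<lambda>x. V (return_pmf x)"
  let ?h = "\<lambda>x. override_on z x ?D"
  let ?w = "\<lambda>x. W (return_pmf (?h x))"
  note F1z = F1[OF z refl] and F2z = F2[OF z refl]
  have hZ: "?h x \<in> Z" if "x \<in> Z" for x using that z by simp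
  have ho: "?h x i = z i" if "i \<notin> ?D" for x i using that by (simp add: override_on_apply)
  have f_cong: "?f x = ?f y" if "x \<in> Z" "y \<in> Z" "\<And>i. i \<in> D1 \<Longrightarrow> x i = y i" for x y
    by (rule repr_point_cong[OF F1z that])
  have g_cong: "?g x = ?g y" if "x \<in> Z" "y \<in> Z" "\<And>i. i \<in> D2 \<Longrightarrow> x i = y i" for x y
    by (rule repr_point_cong[OF F2z that])
  have mono: "?w x \<le> ?w x'" "?f x < ?f x' \<or> ?g x < ?g x' \<Longrightarrow> ?w x < ?w x'"
    if x: "x \<in> Z" "x' \<in> Z" "?f x \<le> ?f x'" "?g x \<le> ?g x'" for x x'
  proof -
    \<comment> \<open>The passage from \<open>x\<close> to \<open>x'\<close> changes one block at a
      time, at contexts at which \<open>F1\<close> and \<open>F2\<close> represent the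
      order.\<close>
    define m where "m = override_on x x' D1"
    have mZ: "m \<in> Z" using x by (simp add: m_def)
    have o1: "override_on (?h x) x D1 = ?h x" "override_on (?h x) x' D1 = ?h m"
      "override_on (?h m) x D2 = ?h m" "override_on (?h m) x' D2 = ?h x'"
      using D(1) by (auto simp: fun_eq_iff override_on_apply m_def)
    have a: "?f y \<le> ?f y' \<longleftrightarrow> W (return_pmf (override_on (?h x) y D1)) \<le> W (return_pmf (override_on (?h x) y' D1))"
      if "y \<in> Z" "y' \<in> Z" for y y'
      using repr_le[OF F1[OF hZ[OF x(1)] ho], of "return_pmf y" "return_pmf y'"] that by simp
    have b: "?g y \<le> ?g y' \<longleftrightarrow> W (return_pmf (override_on (?h m) y D2)) \<le> W (return_pmf (override_on (?h m) y' D2))"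
      if "y \<in> Z" "y' \<in> Z" for y y'
      using repr_le[OF F2[OF hZ[OF mZ] ho], of "return_pmf y" "return_pmf y'"] that by simp
    have "?f x \<le> ?f x' \<longleftrightarrow> ?w x \<le> ?w m" "?f x' \<le> ?f x \<longleftrightarrow> ?w m \<le> ?w x"
      using a[OF x(1,2)] a[OF x(2,1)] by (simp_all only: o1)
    moreover have "?g x \<le> ?g x' \<longleftrightarrow> ?w m \<le> ?w x'" "?g x' \<le> ?g x \<longleftrightarrow> ?w x' \<le> ?w m"
      using b[OF x(1,2)] b[OF x(2,1)] by (simp_all only: o1)
    ultimately show "?w x \<le> ?w x'" "?f x < ?f x' \<or> ?g x < ?g x' \<Longrightarrow> ?w x < ?w x'"
      using x(3,4) by linarith+
  qed
  \<comment> \<open>Only coordinates in \<open>C\<close> change. The gain in \<open>F1\<close> and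
    the loss in \<open>F2\<close> are changes of \<open>V\<close> of the same size, so
    \<open>V\<close>, and with it the position in the order on \<open>C\<close>, stays put.\<close>
  have exch: "?w x = ?w y"
    if x: "x \<in> Z" "y \<in> Z" and off: "\<And>i. i \<in> ?D - C \<Longrightarrow> x i = y i" and sum: "?f y - ?f x = ?g x - ?g y" for x y
  proof -
    let ?m = "override_on (?h x) (?h y) ?b"
    note hx = hZ[OF x(1)] and hy = hZ[OF x(2)]
    have mZ: "?m \<in> Z" using hx hy by simp
    have o: "override_on ?m (?h y) ?c = ?h y" "override_on (?h x) (?h y) C = ?h y"
      "override_on (?h x) (?h x) C = ?h x"
      using off by (auto simp: fun_eq_iff override_on_apply)
    have "?f ?m - ?f (?h x) = ?v ?m - ?v (?h x)" using C1[OF hx hy] .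
    moreover have "?f ?m = ?f y"
      by (rule f_cong[OF mZ x(2)]) (use off in \<open>auto simp: override_on_apply\<close>)
    moreover have "?f (?h x) = ?f x" by (rule f_cong[OF hx x(1)]) (simp add: override_on_apply)
    moreover have "?g (?h y) - ?g ?m = ?v (?h y) - ?v ?m" using C2[OF mZ hy] by (simp only: o)
    moreover have "?g ?m = ?g x"
      by (rule g_cong[OF mZ x(1)]) (use D(1) in \<open>auto simp: override_on_apply\<close>)
    moreover have "?g (?h y) = ?g y" by (rule g_cong[OF hy x(2)]) (simp add: override_on_apply)
    ultimately have "?v (?h x) = ?v (?h y)" using sum by linarith
    then have "eqv C (?h x) (return_pmf (?h x)) (return_pmf (?h y))"
      using repr_eq[OF V[OF hx ho], of "return_pmf (?h x)" "return_pmf (?h y)"] hx hy by simp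
    then show ?thesis by (simp only: eqv_def sect_return o)
  qed
  \<comment> \<open>\<open>W\<close> as a function of the two utility levels. By
    \<open>mono\<close>, points with equal levels have equal \<open>W\<close>, so any choice gives
    the same value.\<close>
  define \<Phi> where "\<Phi> s t = ?w (SOME x. x \<in> Z \<and> ?f x = s \<and> ?g x = t)" for s t
  have \<Phi>: "\<Phi> (?f x) (?g x) = ?w x" if x: "x \<in> Z" for x
  proof -
    define y where "y = (SOME y. y \<in> Z \<and> ?f y = ?f x \<and> ?g y = ?g x)"
    have "y \<in> Z \<and> ?f y = ?f x \<and> ?g y = ?g x" unfolding y_def by (rule someI[of _ x]) (use x in simp)
    then have "?w y = ?w x" using mono(1)[of x y] mono(1)[of y x] x by simp
    then show ?thesis by (simp add: \<Phi>_def y_def)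
  qed
  let ?a = "?f bot_pt" and ?A = "?f top_pt" and ?B = "?g bot_pt" and ?B' = "?g top_pt"
  have pair: "\<exists>x\<in>Z. ?f x = ?f x1 \<and> ?g x = ?g x2 \<and> (\<forall>i. x i = (if i \<in> D2 then x2 i else x1 i))"
    if "x1 \<in> Z" "x2 \<in> Z" for x1 x2
  proof (intro bexI[of _ "override_on x1 x2 D2"] conjI)
    show "?f (override_on x1 x2 D2) = ?f x1"
      by (rule f_cong) (use that D(1) in \<open>auto simp: override_on_apply\<close>)
    show "?g (override_on x1 x2 D2) = ?g x2"
      by (rule g_cong) (use that D(1) in \<open>auto simp: override_on_apply\<close>)
  qed (use that in \<open>auto simp: override_on_apply\<close>)
  have ex: "\<exists>x\<in>Z. ?f x = s \<and> ?g x = t" if h: "?a \<le> s" "s \<le> ?A" "?B \<le> t" "t \<le> ?B'" for s t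
  proof -
    obtain x1 where "x1 \<in> Z" "?f x1 = s"
      by (rule intermediate_point[OF continuous_repr[OF F1z] h(1,2)])
    moreover obtain x2 where "x2 \<in> Z" "?g x2 = t"
      by (rule intermediate_point[OF continuous_repr[OF F2z] h(3,4)])
    ultimately show ?thesis using pair by metis
  qed
  \<comment> \<open>A shift of at most this size fits into the range of either overlap, wherever in
    the box it starts.\<close>
  define e where "e = min (?f (override_on bot_pt top_pt ?b) - ?a) (?g (override_on bot_pt top_pt ?c) - ?B)"
  have e: "e > 0"
  proof -
    obtain i where i: "i \<in> ?b" using ne by auto
    obtain j where j: "j \<in> ?c" using ne by auto
    have lt: "bot_pt k < top_pt k" if "k \<in> I" for k using lo_less_hi that by simp
    note le = less_imp_le[OF lt]
    have "?a < ?f (override_on bot_pt top_pt ?b)"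
      by (rule repr_strict_mono[OF F1z z lo_in_Z, of _ i])
         (use lo_in_Z hi_in_Z le D i lt in \<open>auto simp: override_on_apply simp del: restrict_apply\<close>)
    moreover have "?B < ?g (override_on bot_pt top_pt ?c)"
      by (rule repr_strict_mono[OF F2z z lo_in_Z, of _ j])
         (use lo_in_Z hi_in_Z le D j lt in \<open>auto simp: override_on_apply simp del: restrict_apply\<close>)
    ultimately show ?thesis by (simp add: e_def)
  qed
  have order: "\<Phi> s t \<le> \<Phi> s' t' \<longleftrightarrow> s + t \<le> s' + t'"
    if "?a \<le> s" "s \<le> ?A" "?B \<le> t" "t \<le> ?B'" "?a \<le> s'" "s' \<le> ?A" "?B \<le> t'" "t' \<le> ?B'" for s t s' t'
  proof (rule box_sum_order[OF _ e _ that])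
    fix s t s' t' assume h: "?a \<le> s" "s \<le> s'" "s' \<le> ?A" "?B \<le> t" "t \<le> t'" "t' \<le> ?B'" "s < s' \<or> t < t'"
    obtain x where x: "x \<in> Z" "?f x = s" "?g x = t" using ex[of s t] h by force
    obtain x' where x': "x' \<in> Z" "?f x' = s'" "?g x' = t'" using ex[of s' t'] h by force
    show "\<Phi> s t < \<Phi> s' t'" using mono(2)[OF x(1) x'(1)] \<Phi>[OF x(1)] \<Phi>[OF x'(1)] x x' h by simp
  next
    fix s t d assume h: "0 < d" "d \<le> e" "?a \<le> s" "s + d \<le> ?A" "?B \<le> t - d" "t \<le> ?B'"
    obtain x1 x1' where x1: "x1 \<in> Z" "x1' \<in> Z" "\<And>i. i \<notin> ?b \<Longrightarrow> x1 i = x1' i" "?f x1 = s" "?f x1' = s + d"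
      by (rule shift_points[OF F1z z D(2) A1, of d s]) (use h in \<open>auto simp: e_def\<close>)
    obtain x2 x2' where x2: "x2 \<in> Z" "x2' \<in> Z" "\<And>i. i \<notin> ?c \<Longrightarrow> x2 i = x2' i"
        "?g x2 = t - d" "?g x2' = t - d + d"
      by (rule shift_points[OF F2z z D(3) A2, of d "t - d"]) (use h in \<open>auto simp: e_def\<close>)
    obtain x where x: "x \<in> Z" "?f x = s" "?g x = t" "\<And>i. x i = (if i \<in> D2 then x2' i else x1 i)"
      using pair[OF x1(1) x2(2)] x1 x2 by force
    obtain y where y: "y \<in> Z" "?f y = s + d" "?g y = t - d" "\<And>i. y i = (if i \<in> D2 then x2 i else x1' i)"
      using pair[OF x1(2) x2(1)] x1 x2 by force
    have "?w x = ?w y"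
      by (rule exch[OF x(1) y(1)]) (use x y x1(3) x2(3) in auto)
    then show "\<Phi> s t = \<Phi> (s + d) (t - d)" using \<Phi>[OF x(1)] \<Phi>[OF y(1)] x y by simp
  qed
  \<comment> \<open>Lotteries are reduced to points by taking certainty equivalents on the two
    blocks separately.\<close>
  have point: "\<exists>x\<in>Z. ?f x = F1 p \<and> ?g x = F2 p \<and> eqv ?D z p (return_pmf x)" if p: "p \<in> L" for p
  proof -
    obtain x1 where x1: "x1 \<in> Z" "eqv D1 z p (return_pmf x1)"
      using certainty_equivalent[OF D(2) z p] by blast
    obtain x2 where x2: "x2 \<in> Z" "eqv D2 z p (return_pmf x2)"
      using certainty_equivalent[OF D(3) z p] by blast
    obtain x where x: "x \<in> Z" "?f x = ?f x1" "?g x = ?g x2" using pair[OF x1(1) x2(1)] by blast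
    have f: "?f x = F1 p" using repr_eq[OF F1z p, of "return_pmf x1"] x1 x by simp
    have g: "?g x = F2 p" using repr_eq[OF F2z p, of "return_pmf x2"] x2 x by simp
    have "eqv D1 z p (return_pmf x)" "eqv D2 z p (return_pmf x)"
      using f g repr_eq[OF F1z p, of "return_pmf x"] repr_eq[OF F2z p, of "return_pmf x"] x by simp_all
    then have "eqv ?D z p (return_pmf x)" using eqvD p x by simp
    then show ?thesis using x f g by blast
  qed
  show ?thesis
    unfolding repr_def
  proof (intro conjI ballI)
    show "continuous_on Z (\<lambda>y. F1 (return_pmf y) + F2 (return_pmf y))"
      by (intro continuous_intros continuous_repr[OF F1z] continuous_repr[OF F2z])
    fix p q assume p: "p \<in> L" and q: "q \<in> L"
    obtain x where x: "x \<in> Z" "?f x = F1 p" "?g x = F2 p" "eqv ?D z p (return_pmf x)" using point[OF p] by blast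
    obtain y where y: "y \<in> Z" "?f y = F1 q" "?g y = F2 q" "eqv ?D z q (return_pmf y)" using point[OF q] by blast
    have "F1 p + F2 p \<le> F1 q + F2 q \<longleftrightarrow> \<Phi> (?f x) (?g x) \<le> \<Phi> (?f y) (?g y)"
      unfolding x(2,3)[symmetric] y(2,3)[symmetric]
      by (rule order[symmetric]) (use x(1) y(1) z D repr_point_bounds[OF F1z] repr_point_bounds[OF F2z] in auto)
    also have "\<dots> \<longleftrightarrow> ?w x \<le> ?w y" using \<Phi>[OF x(1)] \<Phi>[OF y(1)] by simp
    also have "\<dots> \<longleftrightarrow> W (sect ?D z p) \<le> W (sect ?D z q)" using x(4) y(4) by (simp add: eqv_def)
    finally show "F1 p + F2 p \<le> F1 q + F2 q \<longleftrightarrow> W (sect ?D z p) \<le> W (sect ?D z q)" .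
  qed
qed

end

section \<open>Depth\<close>

text \<open>
  The number of cells above or equal to that of \<open>i\<close>.  It equals \<^const>\<open>depth\<close>, which counts the
  vertex \<open>o\<close> but not the cell of \<open>i\<close> itself.
\<close>

definition dep :: "('a \<times> 'a) set \<Rightarrow> 'a \<Rightarrow> nat" where
  "dep R i = card ((\<lambda>j. {k. (j, k) \<in> R \<and> (k, j) \<in> R}) ` {j. (j, i) \<in> R})"

lemma finite_below: "finite R \<Longrightarrow> finite {j. (j, i) \<in> R}"
  by (rule finite_subset[of _ "fst ` R"]) force+

lemma dep_pos: "finite R \<Longrightarrow> (i, i) \<in> R \<Longrightarrow> dep R i \<ge> 1"
  unfolding dep_def using finite_below[of R i]
  by (metis (no_types, lifting) One_nat_def Suc_leI card_gt_0_iff empty_iff finite_imageI image_is_empty mem_Collect_eq)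

text \<open>Every class of the restricted relation is the trace of a class of \<open>R\<close>, so
  freezing dimensions never increases depth.\<close>

lemma dep_Restr_le:
  assumes "finite R"
  shows "dep (Restr R G) i \<le> dep R i"
proof -
  have "(\<lambda>j. {k. (j, k) \<in> Restr R G \<and> (k, j) \<in> Restr R G}) ` {j. (j, i) \<in> Restr R G}
      \<subseteq> (\<lambda>c. c \<inter> G) ` (\<lambda>j. {k. (j, k) \<in> R \<and> (k, j) \<in> R}) ` {j. (j, i) \<in> R}"
    by (auto simp: image_image)
  then have "dep (Restr R G) i \<le> card ((\<lambda>c. c \<inter> G) ` (\<lambda>j. {k. (j, k) \<in> R \<and> (k, j) \<in> R}) ` {j. (j, i) \<in> R})"
    unfolding dep_def by (rule card_mono[rotated]) (use finite_below[OF assms] in auto)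
  also have "\<dots> \<le> dep R i"
    unfolding dep_def by (rule card_image_le) (use finite_below[OF assms] in auto)
  finally show ?thesis .
qed

lemma dep_block:
  assumes "R \<subseteq> (\<Union>B\<in>\<P>. B \<times> B)" "disjoint \<P>" "B \<in> \<P>" "i \<in> B"
  shows "dep R i = dep (Restr R B) i"
proof -
  have B: "k \<in> B" if "(j, k) \<in> R \<or> (k, j) \<in> R" "j \<in> B" for j k
    using assms(1-3) that by (fastforce simp: disjoint_def)
  then have "{j. (j, i) \<in> R} = {j. (j, i) \<in> Restr R B}" using assms(4) by auto
  moreover have "{k. (j, k) \<in> R \<and> (k, j) \<in> R} = {k. (j, k) \<in> Restr R B \<and> (k, j) \<in> Restr R B}"
    if "(j, i) \<in> Restr R B" for j
    using that B by auto
  ultimately show ?thesis unfolding dep_def by (metis (mono_tags, lifting) image_cong mem_Collect_eq)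
qed

lemma dep_cell_eq:
  assumes "A \<subseteq> B" "R' \<subseteq> (B - A) \<times> (B - A)" "i \<in> A"
  shows "dep (A \<times> B \<union> R') i = 1"
proof -
  let ?Q = "A \<times> B \<union> R'"
  have "{j. (j, i) \<in> ?Q} = A" using assms by auto
  moreover have "{k. (j, k) \<in> ?Q \<and> (k, j) \<in> ?Q} = A" if "j \<in> A" for j using assms that by auto
  ultimately have "(\<lambda>j. {k. (j, k) \<in> ?Q \<and> (k, j) \<in> ?Q}) ` {j. (j, i) \<in> ?Q} = {A}"
    using assms(3) by (auto simp del: Un_iff)
  then show ?thesis by (simp only: dep_def) simp
qed

lemma dep_cell_below:
  assumes A: "A \<noteq> {}" "A \<subseteq> B" and R': "R' \<subseteq> (B - A) \<times> (B - A)" "finite R'" and i: "i \<in> B - A"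
  shows "dep (A \<times> B \<union> R') i = 1 + dep R' i"
proof -
  let ?Q = "A \<times> B \<union> R'"
  let ?c = "\<lambda>Q j. {k. (j, k) \<in> Q \<and> (k, j) \<in> Q}"
  have e: "{j. (j, i) \<in> ?Q} = A \<union> {j. (j, i) \<in> R'}" using i by auto
  have c1: "?c ?Q j = A" if "j \<in> A" for j using A R' that by auto
  have c2: "?c ?Q j = ?c R' j" if "(j, i) \<in> R'" for j using A R' that by auto
  have "?c ?Q ` {j. (j, i) \<in> ?Q} = insert A (?c R' ` {j. (j, i) \<in> R'})"
  proof -
    have "?c ?Q ` A = {A}" using c1 A(1) by (auto simp del: Un_iff)
    moreover have "?c ?Q ` {j. (j, i) \<in> R'} = ?c R' ` {j. (j, i) \<in> R'}"
      using c2 by (intro image_cong) auto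
    ultimately show ?thesis unfolding e image_Un by simp
  qed
  moreover have "A \<notin> ?c R' ` {j. (j, i) \<in> R'}" using A R' by blast
  ultimately show ?thesis
    unfolding dep_def using finite_below[OF R'(2), of i] by simp
qed

context lottery_pref
begin

lemma good_finite: "good K S R \<Longrightarrow> finite R"
  using good_field good_subset_I finite_I by (meson finite_SigmaI finite_subset)

lemma good_refl:
  assumes "good K S R"
  shows "\<forall>i\<in>S. (i, i) \<in> R"
  using assms
proof (induction rule: good.induct)
  case (good S K \<P> R)
  show ?case
  proof
    fix i assume "i \<in> S"
    then obtain B where B: "B \<in> \<P>" "i \<in> B" using Sep_partition[OF good.hyps(2)] by (auto simp: partition_on_def)
    from bspec[OF good.IH B(1)] obtain A where A: "root_cell R B A"
      and IH: "\<forall>i\<in>B - A. (i, i) \<in> Restr R (B - A)" by blast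
    show "(i, i) \<in> R"
    proof (cases "i \<in> A")
      case True
      then have "(i, i) \<in> A \<times> B \<union> Restr R (B - A)" using B by auto
      then show ?thesis unfolding root_cellD(4)[OF A, symmetric] by auto
    next
      case False
      then show ?thesis using IH B by auto
    qed
  qed
qed

lemma root_cell_dep:
  assumes A: "root_cell R B A" and fin: "finite R" and i: "i \<in> B"
  shows "i \<in> A \<Longrightarrow> dep (Restr R B) i = 1"
    and "i \<notin> A \<Longrightarrow> dep (Restr R B) i = 1 + dep (Restr R (B - A)) i"
proof -
  note h = root_cellD[OF A]
  have s: "Restr R (B - A) \<subseteq> (B - A) \<times> (B - A)" by auto
  show "dep (Restr R B) i = 1" if "i \<in> A"
    unfolding h(4) by (rule dep_cell_eq[OF h(2) s that])
  show "dep (Restr R B) i = 1 + dep (Restr R (B - A)) i" if "i \<notin> A"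
    unfolding h(4) by (rule dep_cell_below[OF h(1,2) s]) (use fin i that in auto)
qed

end

section \<open>The coarsest expected-utility blocks\<close>

context lottery_pref_ce
begin

text \<open>On \<open>D \<inter> C\<close> both utilities represent the same order, so they agree
  there up to a positive affine map. Additivity carries the resulting ratio of increments from the
  base point \<open>z\<close> to all other points.\<close>

lemma section_ratio:
  assumes F: "repr D z F" "EU F" and V: "repr C z V" "EU V" and z: "z \<in> Z" and D: "D \<subseteq> I"
    and ne: "D \<inter> C \<noteq> {}"
    and AF: "\<And>x y. x \<in> Z \<Longrightarrow> y \<in> Z \<Longrightarrow> F (return_pmf x) + F (return_pmf y) =
      F (return_pmf (override_on x y (D \<inter> C))) + F (return_pmf (override_on y x (D \<inter> C)))"
    and AV: "\<And>x y. x \<in> Z \<Longrightarrow> y \<in> Z \<Longrightarrow> V (return_pmf x) + V (return_pmf y) =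
      V (return_pmf (override_on x y (D \<inter> C))) + V (return_pmf (override_on y x (D \<inter> C)))"
  shows "\<exists>a>0. \<forall>x\<in>Z. \<forall>y\<in>Z.
      a * F (return_pmf (override_on x y (D \<inter> C))) - a * F (return_pmf x) =
      V (return_pmf (override_on x y (D \<inter> C))) - V (return_pmf x)"
proof -
  let ?b = "D \<inter> C"
  have sL: "sect ?b z p \<in> L" if "p \<in> L" for p using that z by simp
  have cc: "condaff L D F" "condaff L C V"
    using F V condaff_iff_EU[OF F(1) z] condaff_iff_EU[OF V(1) z] by simp_all
  have c1: "condaff L (D \<inter> ?b) (\<lambda>p. F (sect ?b z p))" by (rule condaff_sect[OF cc(1)]) (rule sL)
  have c2: "condaff L (C \<inter> ?b) (\<lambda>p. V (sect ?b z p))" by (rule condaff_sect[OF cc(2)]) (rule sL)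
  have b: "D \<inter> ?b = ?b" "C \<inter> ?b = ?b" by auto
  have bI: "?b \<subseteq> I" using D by auto
  obtain a b where a: "a > 0" "\<And>p. p \<in> L \<Longrightarrow> V (sect ?b z p) = a * F (sect ?b z p) + b"
    by (rule repr_unique[OF bI z repr_section[OF F(1) z Int_lower1] c1[unfolded b] ne subset_refl
          repr_section[OF V(1) z Int_lower2] c2[unfolded b] ne subset_refl]) (rule that)
  \<comment> \<open>Additivity makes the effect of changing the coordinates in \<open>?b\<close>
    independent of all other coordinates, which may thus be those of \<open>z\<close>.\<close>
  have red: "U (return_pmf (override_on x y ?b)) - U (return_pmf x) =
      U (return_pmf (override_on z y ?b)) - U (return_pmf (override_on z x ?b))"
    if x: "x \<in> Z" "y \<in> Z" and AU: "\<And>x y. x \<in> Z \<Longrightarrow> y \<in> Z \<Longrightarrow> U (return_pmf x) + U (return_pmf y) =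
      U (return_pmf (override_on x y ?b)) + U (return_pmf (override_on y x ?b))"
    for x y and U :: "point pmf \<Rightarrow> real"
  proof -
    have "override_on x (override_on z y ?b) ?b = override_on x y ?b"
      "override_on (override_on z y ?b) x ?b = override_on z x ?b"
      by (auto simp: fun_eq_iff override_on_apply)
    then show ?thesis using AU[of x "override_on z y ?b"] x z by simp
  qed
  show ?thesis
  proof (intro exI[of _ a] conjI a(1) ballI)
    fix x y assume x: "x \<in> Z" "y \<in> Z"
    have "V (return_pmf (override_on z u ?b)) = a * F (return_pmf (override_on z u ?b)) + b"
      if "u \<in> Z" for u
      using a(2)[of "return_pmf u"] that by simp
    note v = this[OF x(1)] this[OF x(2)]
    have "a * F (return_pmf (override_on x y ?b)) - a * F (return_pmf x) =
        a * (F (return_pmf (override_on x y ?b)) - F (return_pmf x))"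
      by (simp only: right_diff_distrib)
    also have "\<dots> = a * (F (return_pmf (override_on z y ?b)) - F (return_pmf (override_on z x ?b)))"
      by (simp only: red[OF x AF])
    also have "\<dots> = V (return_pmf (override_on z y ?b)) - V (return_pmf (override_on z x ?b))"
      unfolding v right_diff_distrib by linarith
    also have "\<dots> = V (return_pmf (override_on x y ?b)) - V (return_pmf x)"
      by (simp only: red[OF x AV])
    finally show "a * F (return_pmf (override_on x y ?b)) - a * F (return_pmf x) =
      V (return_pmf (override_on x y ?b)) - V (return_pmf x)" .
  qed
qed

lemma restrict_two_blocks:
  assumes P: "partition_on S \<P>" and D: "D1 \<in> \<P>" "D2 \<in> \<P>" and B: "B \<in> (\<inter>) (D1 \<union> D2) ` \<P> - {{}}"
  shows "B = D1 \<or> B = D2"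
proof -
  from B obtain B' where B': "B' \<in> \<P>" "B = (D1 \<union> D2) \<inter> B'" "B \<noteq> {}" by (elim DiffE imageE) simp
  have dis: "C \<inter> C' = {}" if "C \<in> \<P>" "C' \<in> \<P>" "C \<noteq> C'" for C C'
    by (rule disjointD[OF partition_onD2[OF P] that])
  consider "D1 = B'" "D2 = B'" | "D1 = B'" "D2 \<noteq> B'" | "D1 \<noteq> B'" "D2 = B'" | "D1 \<noteq> B'" "D2 \<noteq> B'" by blast
  then show ?thesis
  proof cases
    case 2
    have "D2 \<inter> B' = {}" by (rule dis[OF D(2) B'(1) 2(2)])
    then show ?thesis using B'(2) 2(1) by blast
  next
    case 3
    have "D1 \<inter> B' = {}" by (rule dis[OF D(1) B'(1) 3(1)])
    then show ?thesis using B'(2) 3(2) by blast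
  next
    case 4
    have "D1 \<inter> B' = {}" "D2 \<inter> B' = {}" by (rule dis[OF D(1) B'(1) 4(1)], rule dis[OF D(2) B'(1) 4(2)])
    then show ?thesis using B'(2,3) by blast
  qed (use B'(2) in blast)
qed

lemma Util_EU:
  assumes "Util S S" "z \<in> Z"
  shows "\<exists>V. repr S z V \<and> EU V"
proof -
  from assms obtain V where V: "repr S z V" "condaff L S V" unfolding Util_def by blast
  then have "EU V" using condaff_iff_EU[OF V(1) assms(2)] by simp
  with V(1) show ?thesis by blast
qed

text \<open>The function is built at \<open>z\<close> but serves at all contexts that agree with
  \<open>z\<close> on \<open>K\<close>. In this form it yields both that the union is expected
  utility and that its order depends on \<open>K\<close> alone.\<close>

lemma join_common_utility:
  assumes P: "Sep K S \<P>" "S \<subseteq> I" "K \<inter> S = {}" and D: "D1 \<in> \<P>" "D2 \<in> \<P>" "D1 \<noteq> D2"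
    and U: "Util D1 D1" "Util D2 D2" and Q: "Sep K S \<Q>" "C \<in> \<Q>" "Util C C"
    and ne: "D1 \<inter> C \<noteq> {}" "D2 \<inter> C \<noteq> {}" and z: "z \<in> Z"
  shows "\<exists>F. (\<forall>w\<in>Z. (\<forall>i\<in>K. w i = z i) \<longrightarrow> repr (D1 \<union> D2) w F) \<and> EU F"
proof -
  have sub: "D1 \<subseteq> S" "D2 \<subseteq> S" "C \<subseteq> S"
    using D Q(2) Sep_partition[OF P(1)] Sep_partition[OF Q(1)] by (auto simp: partition_on_def)
  have dis: "D1 \<inter> D2 = {}" using D Sep_partition[OF P(1)] by (auto simp: partition_on_def disjoint_def)
  obtain F1 where F1: "repr D1 z F1" "EU F1" using Util_EU[OF U(1) z] by blast
  obtain F2 where F2: "repr D2 z F2" "EU F2" using Util_EU[OF U(2) z] by blast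
  obtain V where V: "repr C z V" "EU V" using Util_EU[OF Q(3) z] by blast
  note AF1 = EU_additive[OF F1 Q(1,2) sub(1) z] and AF2 = EU_additive[OF F2 Q(1,2) sub(2) z]
  note AV1 = EU_additive[OF V P(1) D(1) sub(3) z, unfolded Int_commute[of C D1]]
  note AV2 = EU_additive[OF V P(1) D(2) sub(3) z, unfolded Int_commute[of C D2]]
  have DI: "D1 \<subseteq> I" "D2 \<subseteq> I" using sub P(2) by auto
  obtain a1 where a1: "a1 > 0" "\<forall>x\<in>Z. \<forall>y\<in>Z.
      a1 * F1 (return_pmf (override_on x y (D1 \<inter> C))) - a1 * F1 (return_pmf x) =
      V (return_pmf (override_on x y (D1 \<inter> C))) - V (return_pmf x)"
    using section_ratio[OF F1 V z DI(1) ne(1) AF1 AV1] by blast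
  obtain a2 where a2: "a2 > 0" "\<forall>x\<in>Z. \<forall>y\<in>Z.
      a2 * F2 (return_pmf (override_on x y (D2 \<inter> C))) - a2 * F2 (return_pmf x) =
      V (return_pmf (override_on x y (D2 \<inter> C))) - V (return_pmf x)"
    using section_ratio[OF F2 V z DI(2) ne(2) AF2 AV2] by blast
  let ?F = "\<lambda>p. a1 * F1 p + a2 * F2 p"
  have eqvD: "eqv (D1 \<union> D2) w p q"
    if h: "w \<in> Z" "p \<in> L" "q \<in> L" "eqv D1 w p q" "eqv D2 w p q" for w p q
  proof -
    have DS: "D1 \<union> D2 \<subseteq> S" using sub by auto
    show ?thesis
    proof (rule Sep_eqv'[OF Sep_restrict[OF P(1) DS] h(1-3)])
      fix B assume "B \<in> (\<inter>) (D1 \<union> D2) ` \<P> - {{}}"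
      then have "B = D1 \<or> B = D2"
        by (rule restrict_two_blocks[OF Sep_partition[OF P(1)] D(1,2)])
      then show "eqv B w p q" using h by auto
    qed
  qed
  show ?thesis
  proof (intro exI[of _ ?F] conjI ballI impI)
    show "EU ?F" by (intro EU_add EU_scale F1 F2)
    fix w assume w: "w \<in> Z" "\<forall>i\<in>K. w i = z i"
    have K: "z i = w' i" if "\<And>i. i \<notin> D1 \<union> D2 \<Longrightarrow> w' i = w i" "i \<in> K" for w' i
    proof -
      have "i \<notin> D1 \<union> D2" using that(2) P(3) sub by blast
      then show ?thesis using that w(2) by simp
    qed
    show "repr (D1 \<union> D2) w ?F"
    proof (rule join_repr[OF w(1) dis DI, where C = C and V = V])
      fix w' assume w': "w' \<in> Z" "\<And>i. i \<notin> D1 \<union> D2 \<Longrightarrow> w' i = w i"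
      show "repr D1 w' (\<lambda>p. a1 * F1 p)"
        by (intro repr_scale a1(1) repr_context[OF F1(1) Sep_indep[OF P(1) D(1)] z w'(1)] K w'(2))
      show "repr D2 w' (\<lambda>p. a2 * F2 p)"
        by (intro repr_scale a2(1) repr_context[OF F2(1) Sep_indep[OF P(1) D(2)] z w'(1)] K w'(2))
      show "repr C w' V"
        by (intro repr_context[OF V(1) Sep_indep[OF Q(1,2)] z w'(1)] K w'(2))
    next
      fix x y assume x: "x \<in> Z" "y \<in> Z"
      show "a1 * F1 (return_pmf x) + a1 * F1 (return_pmf y) =
        a1 * F1 (return_pmf (override_on x y (D1 \<inter> C))) + a1 * F1 (return_pmf (override_on y x (D1 \<inter> C)))"
        using AF1[OF x] by (metis distrib_left)
      show "a2 * F2 (return_pmf x) + a2 * F2 (return_pmf y) =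
        a2 * F2 (return_pmf (override_on x y (D2 \<inter> C))) + a2 * F2 (return_pmf (override_on y x (D2 \<inter> C)))"
        using AF2[OF x] by (metis distrib_left)
      show "a1 * F1 (return_pmf (override_on x y (D1 \<inter> C))) - a1 * F1 (return_pmf x) =
        V (return_pmf (override_on x y (D1 \<inter> C))) - V (return_pmf x)"
        using a1(2) x by blast
      show "a2 * F2 (return_pmf (override_on x y (D2 \<inter> C))) - a2 * F2 (return_pmf x) =
        V (return_pmf (override_on x y (D2 \<inter> C))) - V (return_pmf x)"
        using a2(2) x by blast
    next
      show "eqv (D1 \<union> D2) w p q" if "p \<in> L" "q \<in> L" "eqv D1 w p q" "eqv D2 w p q" for p q
        by (rule eqvD[OF w(1) that])
    qed (rule ne)+
  qed
qed

lemma Util_joinI: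
  assumes "\<And>z. z \<in> Z \<Longrightarrow> \<exists>F. repr D z F \<and> EU F"
  shows "Util D D"
  unfolding Util_def
proof
  fix z assume z: "z \<in> Z"
  then obtain F where F: "repr D z F" "EU F" using assms by blast
  then have "condaff L D F" using condaff_iff_EU[OF F(1) z] by simp
  with F(1) show "\<exists>V. repr D z V \<and> condaff L D V" by blast
qed

text \<open>Lotteries that are indifferent on the union may fail to be so on \<open>D1\<close> and
  on \<open>D2\<close>, so separability of \<open>\<P>\<close> does not apply directly. It serves to
  replace them by sure points that differ on the union alone; for these, the other blocks can be
  treated as context.\<close>

lemma join_Sep:
  assumes P: "Sep K S \<P>" "S \<subseteq> I" "K \<inter> S = {}" and D: "D1 \<in> \<P>" "D2 \<in> \<P>" "D1 \<noteq> D2"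
    and ind: "indep (D1 \<union> D2) K"
  shows "Sep K S (insert (D1 \<union> D2) (\<P> - {D1, D2}))"
  unfolding Sep_def
proof (intro conjI ballI impI)
  let ?D = "D1 \<union> D2" and ?P = "insert (D1 \<union> D2) (\<P> - {D1, D2})"
  note part = Sep_partition[OF P(1)]
  have DS: "?D \<subseteq> S" using D part by (auto simp: partition_on_def)
  have dis: "B \<inter> B' = {}" if "B \<in> \<P>" "B' \<in> \<P>" "B \<noteq> B'" for B B'
    using part that by (auto simp: partition_on_def disjoint_def)
  show "partition_on S ?P"
  proof (rule partition_onI)
    have "\<Union> ?P = \<Union> \<P>" using D(1,2) by blast
    then show "\<Union> ?P = S" using partition_onD1[OF part] by simp
    have n: "{} \<notin> \<P>" using partition_onD3[OF part] .
    then have "D1 \<noteq> {}" using D(1) by metis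
    then show "{} \<notin> ?P" using n by simp
    have d: "disjnt ?D B" if "B \<in> \<P> - {D1, D2}" for B
      using dis[OF D(1), of B] dis[OF D(2), of B] that by (auto simp: disjnt_def)
    fix B B' assume B: "B \<in> ?P" "B' \<in> ?P" "B \<noteq> B'"
    consider "B = ?D" "B' \<in> \<P> - {D1, D2}" | "B' = ?D" "B \<in> \<P> - {D1, D2}"
      | "B \<in> \<P>" "B' \<in> \<P>" using B by auto
    then show "disjnt B B'"
    proof cases
      case 1
      then show ?thesis using d by simp
    next
      case 2
      then show ?thesis using disjnt_sym[OF d[OF 2(2)]] by (simp only: 2(1))
    next
      case 3
      then show ?thesis using dis B(3) by (simp add: disjnt_def)
    qed
  qed
  show ind': "indep B K" if "B \<in> ?P" for B
  proof (cases "B = ?D")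
    case True
    then show ?thesis using ind by simp
  next
    case False
    then have "B \<in> \<P>" using that by simp
    then show ?thesis by (rule Sep_indep[OF P(1)])
  qed
  fix z p q assume z: "z \<in> Z" "p \<in> L" "q \<in> L"
    and h: "\<forall>B\<in>?P. \<exists>w\<in>Z. (\<forall>i\<in>K. w i = z i) \<and> eqv B w p q"
  have e: "eqv B z p q" if B: "B \<in> ?P" for B
  proof -
    from bspec[OF h B] obtain w where w: "w \<in> Z" "\<forall>i\<in>K. w i = z i" "eqv B w p q"
      by (elim bexE conjE)
    have "eqv B w p q \<longleftrightarrow> eqv B z p q"
      by (rule indep_eqv[OF ind'[OF B] w(1) z(1) _ z(2,3)]) (use w(2) in simp)
    with w(3) show ?thesis by simp
  qed
  have BI: "B \<subseteq> I" if "B \<in> \<P>" for B using that partition_onD1[OF part] P(2) by blast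
  have "\<forall>B\<in>\<P>. \<exists>y. y \<in> Z \<and> eqv B z r (return_pmf y)" if "r \<in> L" for r
    using certainty_equivalent[OF BI z(1) that] by blast
  from bchoice[OF this[OF z(2)]] bchoice[OF this[OF z(3)]] obtain c c'
    where cc: "\<forall>B\<in>\<P>. c B \<in> Z \<and> eqv B z p (return_pmf (c B))"
      "\<forall>B\<in>\<P>. c' B \<in> Z \<and> eqv B z q (return_pmf (c' B))" by (elim exE)
  \<comment> \<open>Outside \<open>D1\<close> and \<open>D2\<close> the point for \<open>q\<close>
    reuses the equivalents of \<open>p\<close>, which is justified because the two lotteries are
    indifferent on those blocks.\<close>
  define c'' where "c'' B = (if B \<in> {D1, D2} then c' B else c B)" for B
  have cZ: "c B \<in> Z" "c'' B \<in> Z" if "B \<in> \<P>" for B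
    using cc that by (auto simp: c''_def)
  obtain y where y: "y \<in> Z" "\<forall>B\<in>\<P>. \<forall>i\<in>B. y i = c B i" "\<forall>i. i \<notin> S \<longrightarrow> y i = z i"
    using assemble[where c = c, OF part cZ(1) z(1)] by blast
  obtain y' where y': "y' \<in> Z" "\<forall>B\<in>\<P>. \<forall>i\<in>B. y' i = c'' B i" "\<forall>i. i \<notin> S \<longrightarrow> y' i = z i"
    using assemble[where c = c'', OF part cZ(2) z(1)] by blast
  have oy: "override_on z y B = override_on z (c B) B" "override_on z y' B = override_on z (c'' B) B"
    if "B \<in> \<P>" for B
    using bspec[OF y(2) that] bspec[OF y'(2) that] by (auto simp: fun_eq_iff override_on_apply)
  have py: "eqv B z p (return_pmf y)" if "B \<in> \<P>" for B
    using bspec[OF cc(1) that] oy(1)[OF that] by (simp add: eqv_def)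
  have qy: "eqv B z q (return_pmf y')" if "B \<in> \<P>" for B
  proof (cases "B \<in> {D1, D2}")
    case True
    then show ?thesis using bspec[OF cc(2) that] oy(2)[OF that] by (simp add: eqv_def c''_def)
  next
    case False
    then have "eqv B z p q" using e that by simp
    then show ?thesis using bspec[OF cc(1) that] oy(2)[OF that] False by (simp add: eqv_def c''_def)
  qed
  have yL: "return_pmf y \<in> L" "return_pmf y' \<in> L" using y(1) y'(1) by simp_all
  have eD: "eqv ?D z r r'" if "r \<in> L" "r' \<in> L" "\<And>B. B \<in> \<P> \<Longrightarrow> eqv B z r r'" for r r'
  proof (rule Sep_eqv'[OF Sep_restrict[OF P(1) DS] z(1) that(1,2)])
    fix B assume "B \<in> (\<inter>) ?D ` \<P> - {{}}"
    then have "B = D1 \<or> B = D2" by (rule restrict_two_blocks[OF part D(1,2)])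
    then show "eqv B z r r'" using that(3) D(1,2) by metis
  qed
  have "eqv ?D z p (return_pmf y)" "eqv ?D z q (return_pmf y')" "eqv ?D z p q"
    by (rule eD[OF z(2) yL(1) py], assumption, rule eD[OF z(3) yL(2) qy], assumption, rule e, simp)
  then have a: "eqv ?D z (return_pmf y) (return_pmf y')" by (simp add: eqv_def)
  \<comment> \<open>The context moves from \<open>z\<close> to \<open>y\<close>, so that the
    comparison on the union becomes one between the full points \<open>y\<close> and
    \<open>y'\<close>.\<close>
  have "z i = y i" if "i \<in> K" for i
  proof -
    have "i \<notin> S" using that P(3) by blast
    then show ?thesis using y(3) by simp
  qed
  then have "eqv ?D z (return_pmf y) (return_pmf y') \<longleftrightarrow> eqv ?D y (return_pmf y) (return_pmf y')"
    by (rule indep_eqv[OF ind z(1) y(1) _ yL])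
  with a have "eqv ?D y (return_pmf y) (return_pmf y')" by simp
  moreover have "override_on y y' ?D = y'"
  proof
    fix i show "override_on y y' ?D i = y' i"
    proof (cases "i \<in> S \<and> i \<notin> ?D")
      case True
      then obtain B where B: "B \<in> \<P>" "i \<in> B" using part by (auto simp: partition_on_def)
      then have "B \<notin> {D1, D2}" using True by auto
      then have "y i = y' i" using bspec[OF y(2) B(1)] bspec[OF y'(2) B(1)] B by (simp add: c''_def)
      then show ?thesis by (simp add: override_on_apply)
    qed (use y y' in \<open>auto simp: override_on_apply\<close>)
  qed
  ultimately have W: "W (return_pmf y) = W (return_pmf y')" by (simp add: eqv_def)
  have "override_on z y S = y" "override_on z y' S = y'"
    using y(3) y'(3) by (auto simp: fun_eq_iff override_on_apply)
  with W have "eqv S z (return_pmf y) (return_pmf y')" by (simp add: eqv_def)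
  moreover have "eqv S z p (return_pmf y)" by (rule Sep_eqv'[OF P(1) z(1,2) yL(1) py])
  moreover have "eqv S z q (return_pmf y')" by (rule Sep_eqv'[OF P(1) z(1,3) yL(2) qy])
  ultimately show "eqv S z p q" by (simp add: eqv_def)
qed

lemma join:
  assumes P: "Sep K S \<P>" "S \<subseteq> I" "K \<inter> S = {}" and D: "D1 \<in> \<P>" "D2 \<in> \<P>" "D1 \<noteq> D2"
    and U: "Util D1 D1" "Util D2 D2" and Q: "Sep K S \<Q>" "C \<in> \<Q>" "Util C C"
    and ne: "D1 \<inter> C \<noteq> {}" "D2 \<inter> C \<noteq> {}"
  shows "Util (D1 \<union> D2) (D1 \<union> D2)" "Sep K S (insert (D1 \<union> D2) (\<P> - {D1, D2}))"
proof -
  note ju = join_common_utility[OF P D U Q ne]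
  show "Util (D1 \<union> D2) (D1 \<union> D2)"
  proof (rule Util_joinI)
    fix z assume z: "z \<in> Z"
    from ju[OF z] obtain F where "\<forall>w\<in>Z. (\<forall>i\<in>K. w i = z i) \<longrightarrow> repr (D1 \<union> D2) w F" "EU F" by blast
    then show "\<exists>F. repr (D1 \<union> D2) z F \<and> EU F" using z by (intro exI[of _ F]) simp
  qed
  show "Sep K S (insert (D1 \<union> D2) (\<P> - {D1, D2}))"
  proof (rule join_Sep[OF P D])
    show "indep (D1 \<union> D2) K"
      unfolding indep_def
    proof (intro ballI impI)
      fix z z' p q assume h: "z \<in> Z" "z' \<in> Z" "\<forall>i\<in>K. z i = z' i" "p \<in> L" "q \<in> L"
      obtain F where F: "\<forall>w\<in>Z. (\<forall>i\<in>K. w i = z i) \<longrightarrow> repr (D1 \<union> D2) w F"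
        using ju[OF h(1)] by blast
      have a: "repr (D1 \<union> D2) z F" using F h by simp
      have b: "repr (D1 \<union> D2) z' F" using F h by simp
      show "W (sect (D1 \<union> D2) z p) \<le> W (sect (D1 \<union> D2) z q) \<longleftrightarrow>
          W (sect (D1 \<union> D2) z' p) \<le> W (sect (D1 \<union> D2) z' q)"
        using repr_le[OF a h(4,5)] repr_le[OF b h(4,5)] by blast
    qed
  qed
qed

end

section \<open>The simplest tree\<close>

text \<open>
  The last conjunct is the uniqueness of the simplest tree: depths and cells determine it.
\<close>

definition best :: "nat set \<Rightarrow> (nat \<times> nat) set \<Rightarrow> (nat \<times> nat) set \<Rightarrow> bool" where
  "best S Q R \<longleftrightarrow> (\<forall>i\<in>S. dep Q i \<le> dep R i) \<and>
     ((\<forall>i\<in>S. dep Q i = dep R i) \<longrightarrow> R \<inter> R\<inverse> \<subseteq> Q \<and> (Q \<inter> Q\<inverse> \<subseteq> R \<longrightarrow> R = Q))"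

lemma partition_subset: "partition_on S \<P> \<Longrightarrow> B \<in> \<P> \<Longrightarrow> B \<subseteq> S"
  by (auto simp: partition_on_def)

lemma partition_ex: "partition_on S \<P> \<Longrightarrow> i \<in> S \<Longrightarrow> \<exists>B\<in>\<P>. i \<in> B"
  by (auto simp: partition_on_def)

lemma partition_eq: "partition_on S \<P> \<Longrightarrow> B \<in> \<P> \<Longrightarrow> C \<in> \<P> \<Longrightarrow> i \<in> B \<Longrightarrow> i \<in> C \<Longrightarrow> B = C"
  using disjointD[OF partition_onD2] by blast

lemma ex_min_measure:
  fixes m :: "'a \<Rightarrow> nat"
  assumes "Q x"
  shows "\<exists>x. Q x \<and> (\<forall>y. Q y \<longrightarrow> m x \<le> m y)"
  using ex_has_least_nat[of Q x m, OF assms] .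

section \<open>Finest and coarsest separating partitions, and the inductive construction\<close>

context lottery_pref_ce
begin

text \<open>A separating partition that relates the fewest pairs of dimensions cannot shrink under
  common refinement, so it refines every other one.\<close>

lemma finest_Sep:
  assumes "Sep K S \<P>0" "S \<subseteq> I" "K \<inter> S = {}"
  obtains \<P> where "Sep K S \<P>" "\<And>\<Q> B. Sep K S \<Q> \<Longrightarrow> B \<in> \<P> \<Longrightarrow> \<exists>C\<in>\<Q>. B \<subseteq> C"
proof -
  let ?E = "\<lambda>\<P> :: nat set set. \<Union>B\<in>\<P>. B \<times> B"
  have "\<exists>\<P>. Sep K S \<P> \<and> (\<forall>\<Q>. Sep K S \<Q> \<longrightarrow> card (?E \<P>) \<le> card (?E \<Q>))"
    by (rule ex_min_measure[where Q = "Sep K S", OF assms(1)])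
  then obtain \<P> where P: "Sep K S \<P>" "\<And>\<Q>. Sep K S \<Q> \<Longrightarrow> card (?E \<P>) \<le> card (?E \<Q>)" by blast
  have fS: "finite S" using assms(2) finite_I by (rule finite_subset)
  have sub: "?E \<P> \<subseteq> S \<times> S" using partition_subset[OF Sep_partition[OF P(1)]] by blast
  then have fE: "finite (?E \<P>)" using fS by (meson finite_SigmaI finite_subset)
  have "\<exists>C\<in>\<Q>. B \<subseteq> C" if Q: "Sep K S \<Q>" and B: "B \<in> \<P>" for \<Q> B
  proof -
    let ?R = "\<Union>B\<in>\<P>. (\<inter>) B ` \<Q> - {{}}"
    have R: "Sep K S ?R" by (rule Sep_refine[OF P(1) Q assms(3)])
    have "?E ?R \<subseteq> ?E \<P>" by blast
    then have "?E ?R = ?E \<P>" using P(2)[OF R] fE by (simp add: card_seteq)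
    moreover have "?E ?R \<subseteq> ?E \<Q>" by blast
    ultimately have EQ: "?E \<P> \<subseteq> ?E \<Q>" by simp
    have "B \<noteq> {}" using partition_onD3[OF Sep_partition[OF P(1)]] B by metis
    then obtain i where i: "i \<in> B" by blast
    then have "i \<in> S" using partition_subset[OF Sep_partition[OF P(1)] B] by blast
    then obtain C where C: "C \<in> \<Q>" "i \<in> C" using partition_ex[OF Sep_partition[OF Q]] by blast
    have "B \<subseteq> C"
    proof
      fix j assume "j \<in> B"
      then have "(i, j) \<in> ?E \<Q>" using EQ B i by blast
      then obtain C' where "C' \<in> \<Q>" "i \<in> C'" "j \<in> C'" by blast
      then show "j \<in> C" using partition_eq[OF Sep_partition[OF Q] C(1) _ C(2)] by blast
    qed
    then show ?thesis using C(1) by blast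
  qed
  then show ?thesis by (rule that[OF P(1)])
qed

text \<open>Take as few blocks as possible among the separating partitions that consist of finest
  blocks and expected-utility blocks. If an expected-utility block of any separating partition met
  two of them, \<open>join\<close> would merge these two.\<close>

lemma coarsest_EU_Sep:
  assumes P: "Sep K S \<P>" "S \<subseteq> I" "K \<inter> S = {}"
    and fine: "\<And>\<Q> B. Sep K S \<Q> \<Longrightarrow> B \<in> \<P> \<Longrightarrow> \<exists>C\<in>\<Q>. B \<subseteq> C"
  obtains \<Q> where "Sep K S \<Q>" "\<And>D. D \<in> \<Q> \<Longrightarrow> D \<in> \<P> \<or> Util D D"
    "\<And>\<R> C. Sep K S \<R> \<Longrightarrow> C \<in> \<R> \<Longrightarrow> Util C C \<Longrightarrow> \<exists>D\<in>\<Q>. C \<subseteq> D"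
proof -
  let ?q = "\<lambda>\<Q>. Sep K S \<Q> \<and> (\<forall>D\<in>\<Q>. D \<in> \<P> \<or> Util D D)"
  have "?q \<P>" using P(1) by simp
  from ex_min_measure[where Q = ?q, OF this, of card]
  obtain \<Q> where q: "Sep K S \<Q>" "\<forall>D\<in>\<Q>. D \<in> \<P> \<or> Util D D" "\<And>\<R>. ?q \<R> \<Longrightarrow> card \<Q> \<le> card \<R>"
    by blast
  note part = Sep_partition[OF q(1)]
  have fin: "finite \<Q>"
    using finite_elements[OF finite_subset[OF P(2) finite_I] part] .
  have "\<exists>D\<in>\<Q>. C \<subseteq> D" if R: "Sep K S \<R>" and C: "C \<in> \<R>" "Util C C" for \<R> C
  proof -
    have "C \<noteq> {}" using partition_onD3[OF Sep_partition[OF R]] C(1) by metis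
    then obtain i where i: "i \<in> C" by blast
    have CS: "C \<subseteq> S" using partition_subset[OF Sep_partition[OF R] C(1)] .
    then obtain D1 where D1: "D1 \<in> \<Q>" "i \<in> D1" using partition_ex[OF part] i by blast
    \<comment> \<open>A finest block that meets \<open>C\<close> lies inside it and inherits
      expected utility; all other blocks have it by choice of \<open>\<Q>\<close>.\<close>
    have EUD: "Util D D" if D: "D \<in> \<Q>" "j \<in> D" "j \<in> C" for D j
    proof (cases "D \<in> \<P>")
      case True
      then obtain C' where C': "C' \<in> \<R>" "D \<subseteq> C'" using fine[OF R] by blast
      then have "C' = C" using partition_eq[OF Sep_partition[OF R] C'(1) C(1), of j] D by blast
      then have DC: "D \<subseteq> C" using C' by simp
      have "Util (C \<inter> D) D" by (rule Util_sub[OF C(2) DC])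
      then show ?thesis using DC by (simp add: Int_absorb1)
    next
      case False
      then show ?thesis using q(2) D(1) by blast
    qed
    have "C \<subseteq> D1"
    proof (rule ccontr)
      assume "\<not> C \<subseteq> D1"
      then obtain j where j: "j \<in> C" "j \<notin> D1" by blast
      then obtain D2 where D2: "D2 \<in> \<Q>" "j \<in> D2" using partition_ex[OF part] CS by blast
      have ne: "D1 \<noteq> D2" using j D2 by blast
      have m: "D1 \<inter> C \<noteq> {}" "D2 \<inter> C \<noteq> {}" using i j D1 D2 by blast+
      let ?N = "insert (D1 \<union> D2) (\<Q> - {D1, D2})"
      note J = join[OF q(1) P(2,3) D1(1) D2(1) ne EUD[OF D1 i] EUD[OF D2 j(1)] R C m]
      have "?q ?N" using J q(2) by simp
      then have "card \<Q> \<le> card ?N" by (rule q(3))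
      also have "\<dots> \<le> Suc (card (\<Q> - {D1, D2}))" using fin by (simp add: card_insert_le_m1)
      also have "card (\<Q> - {D1, D2}) = card \<Q> - 2"
        using D1(1) D2(1) ne fin by (subst card_Diff_subset) auto
      finally have "card \<Q> \<le> Suc (card \<Q> - 2)" .
      moreover have "card {D1, D2} \<le> card \<Q>" by (rule card_mono[OF fin]) (use D1 D2 in simp)
      ultimately show False using ne by simp
    qed
    then show ?thesis using D1(1) by blast
  qed
  then show ?thesis using q(1,2) by (intro that[of \<Q>]) blast+
qed

text \<open>The coordinate \<open>i\<close> of the root cell splits mixtures across
  \<open>G0\<close> and \<open>B - G0\<close>, so the blocks beside \<open>G0\<close> are expected
  utility. A second coordinate \<open>j\<close> of the root cell on the other side makes all of
  \<open>B\<close> expected utility.\<close>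

lemma blocks_of_component:
  assumes P: "Sep K S \<P>" "S \<subseteq> I" and G0: "G0 \<in> \<P>" "G0 \<subseteq> B" and B: "B \<subseteq> S"
    and A: "root_cell R B A" and i: "i \<in> A" "i \<in> G0"
  shows "j \<in> A \<Longrightarrow> j \<notin> G0 \<Longrightarrow> Util B B"
    and "G \<in> \<P> \<Longrightarrow> G \<subseteq> B \<Longrightarrow> G \<noteq> G0 \<Longrightarrow> Util G G"
proof -
  let ?H = "B - G0"
  have AB: "A \<subseteq> B" using root_cellD(2)[OF A] .
  have GH: "G0 \<inter> ?H = {}" by blast
  have det: "determined G0 ?H z V" if V: "repr B z V" and z: "z \<in> Z" for z V
    unfolding determined_def
  proof (intro ballI impI)
    fix p q assume h: "p \<in> L" "q \<in> L" "sect G0 z p = sect G0 z q" "sect ?H z p = sect ?H z q"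
    have "B \<inter> G0 = G0" using G0(2) by blast
    then have "eqv B z p q" using Sep_marginals[OF P(1) G0(1) B z h(1,2)] h(3,4) by simp
    then show "V p = V q" using repr_eq[OF V h(1,2)] by simp
  qed
  have ex: "\<exists>V. repr B z V \<and> condaff L A V" if "z \<in> Z" for z
    using root_cellD(3)[OF A] that unfolding Util_def by blast
  have iI: "i \<in> I" using i(1) AB B P(2) by blast
  show "Util B B" if j: "j \<in> A" "j \<notin> G0"
  proof (rule Util_joinI)
    fix z assume z: "z \<in> Z"
    obtain V where V: "repr B z V" "condaff L A V" using ex[OF z] by blast
    have jI: "j \<in> ?H" "j \<in> I" using j AB B P(2) by blast+
    have "EU V" by (rule split_EU_both[OF V z GH det[OF V(1) z] i(1,2) iI j(1) jI])
    then show "\<exists>F. repr B z F \<and> EU F" using V(1) by blast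
  qed
  show "Util G G" if G: "G \<in> \<P>" "G \<subseteq> B" "G \<noteq> G0"
  proof (rule Util_joinI)
    fix z assume z: "z \<in> Z"
    obtain V where V: "repr B z V" "condaff L A V" using ex[OF z] by blast
    have "G \<inter> G0 = {}" using disjointD[OF partition_onD2[OF Sep_partition[OF P(1)]] G(1) G0(1) G(3)] .
    then have "G \<subseteq> ?H" using G(2) by blast
    then have "EU (\<lambda>p. V (sect G z p))"
      by (rule split_EU[OF V z GH det[OF V(1) z] i(1,2) iI])
    moreover have "repr G z (\<lambda>p. V (sect G z p))" by (rule repr_section[OF V(1) z G(2)])
    ultimately show "\<exists>F. repr G z F \<and> EU F" by blast
  qed
qed

text \<open>The hypothesis \<open>dep\<close> is where equality of depths will enter. If the root
  cell leaves its finest block, the component is expected utility and lies in a block of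
  \<open>\<Q>\<close>. Otherwise a further finest block in the component would be expected utility
  yet at depth two or more, against \<open>dep\<close>; so the component is just the one finest
  block.\<close>

lemma same_block:
  assumes P: "Sep K S \<P>" "S \<subseteq> I"
    and fine: "\<And>\<Q> B. Sep K S \<Q> \<Longrightarrow> B \<in> \<P> \<Longrightarrow> \<exists>C\<in>\<Q>. B \<subseteq> C"
    and Q: "Sep K S \<Q>" "\<And>\<R> C. Sep K S \<R> \<Longrightarrow> C \<in> \<R> \<Longrightarrow> Util C C \<Longrightarrow> \<exists>D\<in>\<Q>. C \<subseteq> D"
    and dep: "\<And>G k. G \<in> \<P> \<Longrightarrow> Util G G \<Longrightarrow> k \<in> G \<Longrightarrow> dep R k = 1"
    and R: "good K S R" and ij: "(i, j) \<in> R"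
  shows "\<exists>D\<in>\<Q>. i \<in> D \<and> j \<in> D"
  using R
proof cases
  case (good \<R>)
  note partP = Sep_partition[OF P(1)] and partR = Sep_partition[OF good(2)]
  obtain B where B: "B \<in> \<R>" "i \<in> B" "j \<in> B" using good(3) ij by blast
  have BS: "B \<subseteq> S" using partition_subset[OF partR B(1)] .
  obtain A where A: "root_cell R B A" using bspec[OF good(4) B(1)] by blast
  note hA = root_cellD[OF A]
  obtain a where a: "a \<in> A" using hA(1) by blast
  obtain G0 where G0: "G0 \<in> \<P>" "a \<in> G0" using partition_ex[OF partP] a hA(2) BS by blast
  have inB: "G \<subseteq> B" if G: "G \<in> \<P>" "k \<in> G" "k \<in> B" for G k
  proof -
    obtain C where C: "C \<in> \<R>" "G \<subseteq> C" using fine[OF good(2) G(1)] by blast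
    then have "C = B" using partition_eq[OF partR C(1) B(1), of k] G by blast
    then show ?thesis using C by simp
  qed
  have G0B: "G0 \<subseteq> B" using inB[OF G0] a hA(2) by blast
  note bl = blocks_of_component[OF P G0(1) G0B BS A a G0(2)]
  show ?thesis
  proof (cases "A \<subseteq> G0")
    case False
    then obtain k where "k \<in> A" "k \<notin> G0" by blast
    then have "Util B B" by (rule bl(1))
    then obtain D where "D \<in> \<Q>" "B \<subseteq> D" using Q(2)[OF good(2) B(1)] by blast
    then show ?thesis using B by blast
  next
    case True
    have inG0: "k \<in> G0" if k: "k \<in> B" for k
    proof (rule ccontr)
      assume n: "k \<notin> G0"
      obtain G where G: "G \<in> \<P>" "k \<in> G" using partition_ex[OF partP] k BS by blast
      have GB: "G \<subseteq> B" using inB[OF G k] .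
      have "G \<noteq> G0" using G n by blast
      then have "Util G G" by (rule bl(2)[OF G(1) GB])
      then have d: "dep R k = 1" by (rule dep[OF G(1) _ G(2)])
      have "dep R k = dep (Restr R B) k"
        by (rule dep_block[OF good(3) partition_onD2[OF partR] B(1) k])
      have kA: "k \<notin> A" using n True by blast
      have fin: "finite R" using good_finite[OF R] .
      have kR: "(k, k) \<in> Restr R (B - A)" using good_refl[OF R] k kA BS by blast
      have "dep R k = 1 + dep (Restr R (B - A)) k"
        using root_cell_dep(2)[OF A fin k kA] \<open>dep R k = dep (Restr R B) k\<close> by simp
      moreover have "dep (Restr R (B - A)) k \<ge> 1" by (rule dep_pos[OF _ kR]) (use fin in simp)
      ultimately show False using d by simp
    qed
    obtain D where "D \<in> \<Q>" "G0 \<subseteq> D" using fine[OF Q(1) G0(1)] by blast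
    then show ?thesis using inG0 B by blast
  qed
qed

lemma best_EU:
  assumes S: "S \<subseteq> I" "S \<noteq> {}" "indep S K" and U: "Util S S"
  shows "good K S (S \<times> S)" "good K S R \<Longrightarrow> best S (S \<times> S) R"
proof -
  have e: "Restr (S \<times> S) (S - S) = {}" by simp
  have "root_cell (S \<times> S) S S" unfolding root_cell_def using S U by auto
  then show "good K S (S \<times> S)"
    by (rule good_single[OF S(1-3) subset_refl]) (simp add: good_empty)
  have d: "dep (S \<times> S) i = 1" if "i \<in> S" for i
    using dep_cell_eq[OF subset_refl, of "{}" S i] that by simp
  show "best S (S \<times> S) R" if R: "good K S R"
    unfolding best_def
  proof (intro conjI impI ballI)
    note f = good_field[OF R]
    fix i assume i: "i \<in> S"
    have "dep R i \<ge> 1" by (rule dep_pos[OF good_finite[OF R]]) (use good_refl[OF R] i in blast)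
    then show "dep (S \<times> S) i \<le> dep R i" using d[OF i] by simp
  next
    show "R \<inter> R\<inverse> \<subseteq> S \<times> S" using good_field[OF R] by blast
    assume "S \<times> S \<inter> (S \<times> S)\<inverse> \<subseteq> R"
    then show "R = S \<times> S" using good_field[OF R] by blast
  qed
qed

text \<open>Every tree on \<open>S\<close> has a single root cell, and it is contained in the
  largest one, \<open>A\<close>. Restricting the rest of the tree to \<open>S - A\<close> gives a
  competitor of the tree obtained by induction, at no greater depth.\<close>

lemma best_single:
  assumes S: "S \<subseteq> I" "S \<noteq> {}" "indep S K" "K \<inter> S = {}"
    and single: "\<And>\<Q>. Sep K S \<Q> \<Longrightarrow> \<Q> = {S}"
    and R0: "good K S R0"
    and IH: "\<And>K' S' R'. card S' < card S \<Longrightarrow> S' \<subseteq> I \<Longrightarrow> indep S' K' \<Longrightarrow> K' \<inter> S' = {} \<Longrightarrow> good K' S' R' \<Longrightarrow>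
      \<exists>Q. good K' S' Q \<and> (\<forall>R. good K' S' R \<longrightarrow> best S' Q R)"
  shows "\<exists>Q. good K S Q \<and> (\<forall>R. good K S R \<longrightarrow> best S Q R)"
proof -
  have fS: "finite S" using S(1) finite_I by (rule finite_subset)
  have dec: "\<exists>A. root_cell R S A \<and> good (K \<union> A) (S - A) (Restr R (S - A))" if R: "good K S R" for R
    using R
  proof cases
    case (good \<R>)
    have "S \<in> \<R>" using single[OF good(2)] by simp
    then show ?thesis using bspec[OF good(4)] by blast
  qed
  let ?q = "\<lambda>A. A \<noteq> {} \<and> A \<subseteq> S \<and> Util A S"
  obtain A0 where A0: "root_cell R0 S A0" using dec[OF R0] by blast
  have "?q A0" using root_cellD[OF A0] by blast
  \<comment> \<open>Fewest dimensions outside \<open>A\<close> means largest \<open>A\<close>;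
    \<open>Util_Un\<close> then puts every admissible cell inside it.\<close>
  from ex_min_measure[where Q = ?q, OF this, of "\<lambda>A. card (S - A)"]
  obtain A where A: "A \<noteq> {}" "A \<subseteq> S" "Util A S" and min: "\<And>B. ?q B \<Longrightarrow> card (S - A) \<le> card (S - B)"
    by blast
  have max: "B \<subseteq> A" if B: "B \<noteq> {}" "B \<subseteq> S" "Util B S" for B
  proof (rule ccontr)
    assume "\<not> B \<subseteq> A"
    then have "S - (A \<union> B) \<subset> S - A" using B(2) by blast
    then have "card (S - (A \<union> B)) < card (S - A)" by (rule psubset_card_mono[rotated]) (use fS in simp)
    moreover have "?q (A \<union> B)" using Util_Un[OF S(1) A B] A B by simp
    ultimately show False using min[of "A \<union> B"] by simp
  qed
  let ?G = "S - A"
  have GI: "?G \<subseteq> I" using S(1) by blast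
  have SG: "S - ?G = A" using A(2) by blast
  have ind: "indep ?G (K \<union> A)" using indep_sub[OF S(3), of ?G] SG by simp
  have KG: "(K \<union> A) \<inter> ?G = {}" using S(4) by blast
  have cG: "card ?G < card S" by (rule psubset_card_mono[OF fS]) (use A in blast)
  have peel: "\<exists>B. root_cell R S B \<and> B \<subseteq> A \<and> good (K \<union> A) ?G (Restr R ?G)"
    if R: "good K S R" for R
  proof -
    obtain B where B: "root_cell R S B" "good (K \<union> B) (S - B) (Restr R (S - B))" using dec[OF R] by blast
    have BA: "B \<subseteq> A" using max root_cellD[OF B(1)] by blast
    have "?G \<subseteq> S - B" using BA by blast
    from good_restrict[OF B(2) this] have "good (K \<union> B \<union> (S - B - ?G)) ?G (Restr R ?G)"
      by (simp only: Restr_Restr[OF \<open>?G \<subseteq> S - B\<close>])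
    moreover have "K \<union> B \<union> (S - B - ?G) \<subseteq> K \<union> A" using BA by blast
    ultimately have "good (K \<union> A) ?G (Restr R ?G)" by (rule good_mono)
    then show ?thesis using B(1) BA by blast
  qed
  obtain R1 where R1: "good (K \<union> A) ?G R1" using peel[OF R0] by blast
  obtain Q where Q: "good (K \<union> A) ?G Q" "\<And>R. good (K \<union> A) ?G R \<Longrightarrow> best ?G Q R"
    using IH[OF cG GI ind KG R1] by blast
  have Qf: "Q \<subseteq> ?G \<times> ?G" by (rule good_field[OF Q(1)])
  let ?Q = "A \<times> S \<union> Q"
  have rQ: "Restr ?Q ?G = Q" "Restr ?Q S = ?Q" using Qf A(2) by blast+
  have rc: "root_cell ?Q S A" unfolding root_cell_def rQ using A by blast
  have gQ: "good K S ?Q"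
    by (rule good_single[OF S(1-3) _ rc]) (use Qf A(2) Q(1) rQ in auto)
  have finQ: "finite ?Q" by (rule good_finite[OF gQ])
  note dQ = root_cell_dep[OF rc finQ, unfolded rQ]
  have "best S ?Q R" if R: "good K S R" for R
  proof -
    obtain B where B: "root_cell R S B" "B \<subseteq> A" "good (K \<union> A) ?G (Restr R ?G)" using peel[OF R] by blast
    note hB = root_cellD[OF B(1)]
    have Rf: "R \<subseteq> S \<times> S" by (rule good_field[OF R])
    have finR: "finite R" by (rule good_finite[OF R])
    have RS: "Restr R S = R" using Rf by blast
    note dR = root_cell_dep[OF B(1) finR, unfolded RS]
    have bQ: "best ?G Q (Restr R ?G)" by (rule Q(2)[OF B(3)])
    have pos: "dep R i \<ge> 1" if "i \<in> S" for i
      by (rule dep_pos[OF finR]) (use good_refl[OF R] that in blast)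
    have sub: "dep (Restr R ?G) i \<le> dep (Restr R (S - B)) i" for i
    proof -
      have GB: "?G \<subseteq> S - B" using B(2) by blast
      have "dep (Restr (Restr R (S - B)) ?G) i \<le> dep (Restr R (S - B)) i"
        by (rule dep_Restr_le) (use finR in simp)
      then show ?thesis by (simp only: Restr_Restr[OF GB])
    qed
    have le: "dep Q i \<le> dep (Restr R ?G) i" if "i \<in> ?G" for i
      using bQ that unfolding best_def by blast
    have le1: "dep ?Q i \<le> dep R i" if i: "i \<in> S" for i
    proof (cases "i \<in> A")
      case True
      then show ?thesis using dQ(1)[OF i] pos[OF i] by simp
    next
      case False
      then have "i \<notin> B" using B(2) by blast
      then show ?thesis using dQ(2)[OF i False] dR(2)[OF i] le[of i] sub[of i] False i by simp
    qed
    moreover have "R \<inter> R\<inverse> \<subseteq> ?Q \<and> (?Q \<inter> ?Q\<inverse> \<subseteq> R \<longrightarrow> R = ?Q)" if eq: "\<forall>i\<in>S. dep ?Q i = dep R i"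
    proof -
      \<comment> \<open>A dimension of \<open>A\<close> outside \<open>B\<close> would have depth at
        least two in \<open>R\<close>, but it has depth one in \<open>?Q\<close>.\<close>
      have "A \<subseteq> B"
      proof
        fix i assume i: "i \<in> A"
        then have iS: "i \<in> S" using A(2) by blast
        show "i \<in> B"
        proof (rule ccontr)
          assume n: "i \<notin> B"
          have "(i, i) \<in> Restr R (S - B)" using good_refl[OF R] iS n by blast
          then have "dep (Restr R (S - B)) i \<ge> 1" by (rule dep_pos[rotated]) (use finR in simp)
          then have "dep R i \<ge> 2" using dR(2)[OF iS n] by simp
          then show False using dQ(1)[OF iS i] eq iS by simp
        qed
      qed
      with B(2) have AB: "B = A" by blast
      have dd: "\<forall>i\<in>?G. dep Q i = dep (Restr R ?G) i"
      proof
        fix i assume i: "i \<in> ?G"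
        then show "dep Q i = dep (Restr R ?G) i"
          using dQ(2)[of i] dR(2)[of i] eq AB by simp
      qed
      then have c: "Restr R ?G \<inter> (Restr R ?G)\<inverse> \<subseteq> Q" "Q \<inter> Q\<inverse> \<subseteq> Restr R ?G \<Longrightarrow> Restr R ?G = Q"
        using bQ unfolding best_def by blast+
      have Re: "R = A \<times> S \<union> Restr R ?G" using hB(4) unfolding RS AB .
      have "R \<inter> R\<inverse> \<subseteq> ?Q"
      proof
        fix x assume x: "x \<in> R \<inter> R\<inverse>"
        obtain i j where ij: "x = (i, j)" by (cases x)
        have r: "(i, j) \<in> R" "(j, i) \<in> R" using x ij by auto
        show "x \<in> ?Q"
        proof (cases "i \<in> A")
          case True
          then show ?thesis using r Rf ij by blast
        next
          case False
          have e: "(k, l) \<in> Restr R ?G" if "(k, l) \<in> R" "k \<notin> A" for k l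
            using Re that by blast
          have ij': "(i, j) \<in> Restr R ?G" by (rule e[OF r(1) False])
          then have "j \<notin> A" by blast
          then have "(j, i) \<in> Restr R ?G" by (rule e[OF r(2)])
          then show ?thesis using ij' c(1) ij by blast
        qed
      qed
      moreover have "R = ?Q" if "?Q \<inter> ?Q\<inverse> \<subseteq> R"
      proof -
        have "Q \<inter> Q\<inverse> \<subseteq> Restr R ?G" using that Qf by blast
        then have "Restr R ?G = Q" by (rule c(2))
        then show ?thesis using Re by simp
      qed
      ultimately show ?thesis by blast
    qed
    ultimately show ?thesis unfolding best_def by blast
  qed
  then show ?thesis using gQ by blast
qed

text \<open>The simplest trees on the blocks of \<open>\<Q>\<close> are put side by side. Another
  tree may tie blocks together, but restricting it to one block raises no depth, and if all depths
  are equal, then \<open>same_block\<close> shows that nothing was tied.\<close>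

lemma best_blocks:
  assumes S: "S \<subseteq> I" "K \<inter> S = {}" and nEU: "\<not> Util S S"
    and P: "Sep K S \<P>" "S \<notin> \<P>"
    and fine: "\<And>\<Q> B. Sep K S \<Q> \<Longrightarrow> B \<in> \<P> \<Longrightarrow> \<exists>C\<in>\<Q>. B \<subseteq> C"
    and R0: "good K S R0"
    and IH: "\<And>K' S' R'. card S' < card S \<Longrightarrow> S' \<subseteq> I \<Longrightarrow> indep S' K' \<Longrightarrow> K' \<inter> S' = {} \<Longrightarrow> good K' S' R' \<Longrightarrow>
      \<exists>Q. good K' S' Q \<and> (\<forall>R. good K' S' R \<longrightarrow> best S' Q R)"
  shows "\<exists>Q. good K S Q \<and> (\<forall>R. good K S R \<longrightarrow> best S Q R)"
proof -
  have fS: "finite S" using S(1) finite_I by (rule finite_subset)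
  obtain \<Q> where Q: "Sep K S \<Q>" "\<And>D. D \<in> \<Q> \<Longrightarrow> D \<in> \<P> \<or> Util D D"
    "\<And>\<R> C. Sep K S \<R> \<Longrightarrow> C \<in> \<R> \<Longrightarrow> Util C C \<Longrightarrow> \<exists>D\<in>\<Q>. C \<subseteq> D"
    using coarsest_EU_Sep[OF P(1) S fine] by metis
  note part = Sep_partition[OF Q(1)]
  have DS: "D \<subseteq> S" "D \<noteq> {}" if "D \<in> \<Q>" for D
    using partition_subset[OF part that] partition_onD3[OF part] that by metis+
  have DI: "D \<subseteq> I" if "D \<in> \<Q>" for D using DS(1)[OF that] S(1) by blast
  have indD: "indep D K" if "D \<in> \<Q>" for D by (rule Sep_indep[OF Q(1) that])
  have KD: "K \<inter> D = {}" if "D \<in> \<Q>" for D using DS(1)[OF that] S(2) by blast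
  have restr: "good K D (Restr R D)" if R: "good K S R" and D: "D \<in> \<Q>" for R D
  proof (rule good_drop_context[OF good_restrict[OF R DS(1)[OF D]] indD[OF D]])
    show "(K \<union> (S - D)) \<inter> D = {}" using KD[OF D] by blast
  qed simp
  have "\<exists>Q. good K D Q \<and> (\<forall>R. good K D R \<longrightarrow> best D Q R)" if D: "D \<in> \<Q>" for D
  proof -
    \<comment> \<open>Blocks of \<open>\<Q>\<close> are finest blocks or expected-utility blocks,
      and \<open>S\<close> is neither, so the induction hypothesis applies to
      \<open>D\<close>.\<close>
    have "D \<noteq> S" using Q(2)[OF D] P(2) nEU by metis
    then have "card D < card S" using DS(1)[OF D] fS by (simp add: psubset_card_mono psubsetI)
    then show ?thesis by (rule IH[OF _ DI[OF D] indD[OF D] KD[OF D] restr[OF R0 D]])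
  qed
  then have "\<forall>D\<in>\<Q>. \<exists>Q. good K D Q \<and> (\<forall>R. good K D R \<longrightarrow> best D Q R)" by (intro ballI)
  from bchoice[OF this] obtain r
    where r': "\<forall>D\<in>\<Q>. good K D (r D) \<and> (\<forall>R. good K D R \<longrightarrow> best D (r D) R)" by (elim exE)
  have rg: "good K D (r D)" if "D \<in> \<Q>" for D using bspec[OF r' that] by simp
  have rb: "best D (r D) R" if "D \<in> \<Q>" "good K D R" for D R using bspec[OF r' that(1)] that(2) by simp
  have rf: "r D \<subseteq> D \<times> D" if "D \<in> \<Q>" for D by (rule good_field[OF rg[OF that]])
  let ?Q = "\<Union>D\<in>\<Q>. r D"
  have sub: "?Q \<subseteq> (\<Union>D\<in>\<Q>. D \<times> D)" using rf by blast
  have Rr: "Restr ?Q D = r D" if D: "D \<in> \<Q>" for D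
  proof
    show "r D \<subseteq> Restr ?Q D" using rf[OF D] D by blast
    show "Restr ?Q D \<subseteq> r D"
    proof
      fix x assume x: "x \<in> Restr ?Q D"
      obtain i j where ij: "x = (i, j)" by (cases x)
      obtain E where E: "E \<in> \<Q>" "x \<in> r E" using x by blast
      have "i \<in> E" "i \<in> D" using rf[OF E(1)] E(2) x ij by auto
      then have "E = D" by (rule partition_eq[OF part E(1) D])
      then show "x \<in> r D" using E(2) by simp
    qed
  qed
  have gQ: "good K S ?Q"
    by (rule good_Union[OF S(1) Q(1) sub]) (simp only: Rr rg)
  have dQ: "dep ?Q i = dep (r D) i" if "D \<in> \<Q>" "i \<in> D" for i D
    using dep_block[OF sub partition_onD2[OF part] that] Rr[OF that(1)] by simp
  have "best S ?Q R" if R: "good K S R" for R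
  proof -
    have finR: "finite R" by (rule good_finite[OF R])
    have le: "dep (r D) i \<le> dep (Restr R D) i" "dep (Restr R D) i \<le> dep R i" if D: "D \<in> \<Q>" "i \<in> D" for D i
    proof -
      show "dep (r D) i \<le> dep (Restr R D) i"
        using rb[OF D(1) restr[OF R D(1)]] D(2) unfolding best_def by blast
      show "dep (Restr R D) i \<le> dep R i" by (rule dep_Restr_le[OF finR])
    qed
    have "dep ?Q i \<le> dep R i" if i: "i \<in> S" for i
    proof -
      obtain D where D: "D \<in> \<Q>" "i \<in> D" using partition_ex[OF part i] by blast
      then show ?thesis using dQ[OF D] le[OF D] by simp
    qed
    moreover have "R \<inter> R\<inverse> \<subseteq> ?Q \<and> (?Q \<inter> ?Q\<inverse> \<subseteq> R \<longrightarrow> R = ?Q)" if eq: "\<forall>i\<in>S. dep ?Q i = dep R i"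
    proof -
      \<comment> \<open>Such a \<open>G\<close> lies in an expected-utility block of
        \<open>\<Q>\<close>, where one cell is a possible tree and so all minimal depths are
        one.\<close>
      have dep1: "dep R k = 1" if G: "G \<in> \<P>" "Util G G" "k \<in> G" for G k
      proof -
        obtain D where D: "D \<in> \<Q>" "G \<subseteq> D" using fine[OF Q(1) G(1)] by blast
        have kD: "k \<in> D" using D(2) G(3) by blast
        have U: "Util D D"
        proof (cases "D \<in> \<P>")
          case True
          then have "D = G" using partition_eq[OF Sep_partition[OF P(1)] True G(1) kD G(3)] by simp
          then show ?thesis using G(2) by simp
        next
          case False
          then show ?thesis using Q(2)[OF D(1)] by simp
        qed
        note bE = best_EU[OF DI[OF D(1)] DS(2)[OF D(1)] indD[OF D(1)] U]
        have "dep (r D) k \<le> dep (D \<times> D) k"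
          using rb[OF D(1) bE(1)] kD unfolding best_def by blast
        also have "\<dots> = 1" using dep_cell_eq[OF subset_refl, of "{}" D k] kD by simp
        finally have "dep (r D) k \<le> 1" .
        moreover have kS: "k \<in> S" using DS(1)[OF D(1)] kD by blast
        moreover have "dep R k \<ge> 1"
          by (rule dep_pos[OF finR]) (use good_refl[OF R] kS in blast)
        ultimately show ?thesis using eq dQ[OF D(1) kD] by simp
      qed
      have blk: "\<exists>D\<in>\<Q>. i \<in> D \<and> j \<in> D" if "(i, j) \<in> R" for i j
        by (rule same_block[OF P(1) S(1) fine Q(1) Q(3) dep1 R that])
      have Rb: "(i, j) \<in> R \<longleftrightarrow> (\<exists>D\<in>\<Q>. (i, j) \<in> Restr R D)" for i j using blk[of i j] by blast
      have c: "Restr R D \<inter> (Restr R D)\<inverse> \<subseteq> r D" "r D \<inter> (r D)\<inverse> \<subseteq> Restr R D \<Longrightarrow> Restr R D = r D"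
        if D: "D \<in> \<Q>" for D
      proof -
        have "\<forall>i\<in>D. dep (r D) i = dep (Restr R D) i"
        proof
          fix i assume i: "i \<in> D"
          have "i \<in> S" using DS(1)[OF D] i by blast
          then show "dep (r D) i = dep (Restr R D) i" using le[OF D i] eq dQ[OF D i] by simp
        qed
        then show "Restr R D \<inter> (Restr R D)\<inverse> \<subseteq> r D" "r D \<inter> (r D)\<inverse> \<subseteq> Restr R D \<Longrightarrow> Restr R D = r D"
          using rb[OF D restr[OF R D]] unfolding best_def by blast+
      qed
      have "R \<inter> R\<inverse> \<subseteq> ?Q"
      proof
        fix x assume x: "x \<in> R \<inter> R\<inverse>"
        obtain i j where ij: "x = (i, j)" by (cases x)
        have r: "(i, j) \<in> R" "(j, i) \<in> R" using x ij by auto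
        obtain D where D: "D \<in> \<Q>" "i \<in> D" "j \<in> D" using blk[OF r(1)] by blast
        then have "x \<in> Restr R D \<inter> (Restr R D)\<inverse>" using r ij by blast
        then show "x \<in> ?Q" using c(1)[OF D(1)] D(1) by blast
      qed
      moreover have "R = ?Q" if h: "?Q \<inter> ?Q\<inverse> \<subseteq> R"
      proof -
        have "Restr R D = r D" if D: "D \<in> \<Q>" for D
        proof (rule c(2)[OF D])
          show "r D \<inter> (r D)\<inverse> \<subseteq> Restr R D" using h rf[OF D] D by blast
        qed
        then have "x \<in> R \<longleftrightarrow> x \<in> ?Q" for x using Rb[of "fst x" "snd x"] by simp
        then show ?thesis by blast
      qed
      ultimately show ?thesis by blast
    qed
    ultimately show ?thesis unfolding best_def by blast
  qed
  then show ?thesis using gQ by blast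
qed

theorem simplest_exists:
  assumes "S \<subseteq> I" "indep S K" "K \<inter> S = {}" "good K S R0"
  shows "\<exists>Q. good K S Q \<and> (\<forall>R. good K S R \<longrightarrow> best S Q R)"
  using assms
proof (induction "card S" arbitrary: K S R0 rule: less_induct)
  case less
  have IH: "\<exists>Q. good K' S' Q \<and> (\<forall>R. good K' S' R \<longrightarrow> best S' Q R)"
    if "card S' < card S" "S' \<subseteq> I" "indep S' K'" "K' \<inter> S' = {}" "good K' S' R'" for K' S' R'
    by (rule less.hyps[OF that])
  show ?case
  proof (cases "S = {}")
    case True
    have e: "R = {}" if "good K S R" for R using good_field[OF that] True by simp
    have "best S {} R" if "good K S R" for R
    proof -
      have "R = {}" by (rule e[OF that])
      then show ?thesis using True by (simp add: best_def)
    qed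
    then show ?thesis using good_empty[of K] True by blast
  next
    case False
    show ?thesis
    proof (cases "Util S S")
      case True
      then show ?thesis using best_EU[OF less.prems(1) False less.prems(2) True] by blast
    next
      case nEU: False
      obtain \<P>0 where "Sep K S \<P>0" using less.prems(4) by (rule good.cases) blast
      then obtain \<P> where P: "Sep K S \<P>"
        and fine: "\<And>\<Q> B. Sep K S \<Q> \<Longrightarrow> B \<in> \<P> \<Longrightarrow> \<exists>C\<in>\<Q>. B \<subseteq> C"
        using finest_Sep[OF _ less.prems(1,3)] by metis
      show ?thesis
      proof (cases "S \<in> \<P>")
        case True
        have "\<Q> = {S}" if Q: "Sep K S \<Q>" for \<Q>
        proof -
          note pQ = Sep_partition[OF Q]
          obtain C where C: "C \<in> \<Q>" "S \<subseteq> C" using fine[OF Q True] by blast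
          then have CS: "C = S" using partition_subset[OF pQ C(1)] by blast
          have "D = S" if D: "D \<in> \<Q>" for D
          proof -
            have "D \<noteq> {}" using partition_onD3[OF pQ] D by metis
            then obtain i where "i \<in> D" by blast
            then show ?thesis using partition_eq[OF pQ D C(1), of i] partition_subset[OF pQ D] CS by blast
          qed
          then show ?thesis using C CS by blast
        qed
        then show ?thesis
          by (rule best_single[OF less.prems(1) False less.prems(2,3) _ less.prems(4) IH])
      next
        case S: False
        show ?thesis by (rule best_blocks[OF less.prems(1,3) nEU P S fine less.prems(4) IH])
      qed
    qed
  qed
qed

end

section \<open>Clustered trees as preorders\<close>

text \<open>The classes of this preorder are the cells and its covering pairs are the edges between
  cells, so that no information about the tree is lost; see \<open>rct_eqI\<close>.\<close>

definition tree_rel :: "rct \<Rightarrow> (nat \<times> nat) set" where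
  "tree_rel T = {(i, j). \<exists>A\<in>fst T. \<exists>B\<in>fst T. i \<in> A \<and> j \<in> B \<and> (Some A, Some B) \<in> (snd T)\<^sup>*}"

lemma successively_rtrancl:
  "vs \<noteq> [] \<Longrightarrow> successively (\<lambda>v w. (v, w) \<in> E) vs \<Longrightarrow> (hd vs, last vs) \<in> E\<^sup>*"
proof (induction vs)
  case (Cons v vs)
  then show ?case by (cases vs) (auto intro: converse_rtrancl_into_rtrancl)
qed simp

lemma directed_path_rtrancl: "directed_path E a b vs \<Longrightarrow> (a, b) \<in> E\<^sup>*"
  using successively_rtrancl by (auto simp: directed_path_def)

locale rct =
  fixes I :: "nat set" and T :: rct
  assumes rct: "is_rct I T" and fin_I: "finite I"
begin

abbreviation "P \<equiv> fst T"
abbreviation "E \<equiv> snd T"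

lemma rct_unfolded: "partition_on I P \<and> E \<subseteq> vertices P \<times> vertices P \<and> asym E \<and>
     (\<forall>v\<in>vertices P. \<forall>w\<in>vertices P. (v, w) \<in> (E \<union> E\<inverse>)\<^sup>*) \<and>
     (\<nexists>vs. undirected_cycle E vs) \<and>
     (\<forall>v\<in>vertices P. v \<noteq> None \<longrightarrow> (\<exists>!vs. directed_path E None v vs))"
  using rct unfolding is_rct_def split_beta .

lemma partP: "partition_on I P"
  by (rule conjunct1[OF rct_unfolded])

lemma E_vertices: "E \<subseteq> vertices P \<times> vertices P"
  by (rule conjunct1[OF conjunct2[OF rct_unfolded]])

lemma paths:
  assumes "v \<in> vertices P" "v \<noteq> None"
  shows "\<exists>!vs. directed_path E None v vs"
  by (rule rct_unfolded[THEN conjunct2, THEN conjunct2, THEN conjunct2, THEN conjunct2, THEN conjunct2,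
        THEN bspec, THEN mp, OF assms])

lemma acyc: "(v, v) \<notin> E\<^sup>+"
  using is_rct_acyclic[OF rct] unfolding acyclic_def by simp

lemma antisym: 
  assumes "(v, w) \<in> E\<^sup>*" "(w, v) \<in> E\<^sup>*"
  shows "v = w"
proof (rule ccontr)
  assume "v \<noteq> w"
  then have "(v, w) \<in> E\<^sup>+" using assms(1) by (simp add: rtrancl_eq_or_trancl)
  then have "(v, v) \<in> E\<^sup>+" using assms(2) by (rule trancl_rtrancl_trancl)
  then show False using acyc by simp
qed

lemma from_root:
  assumes "v \<in> vertices P"
  shows "(None, v) \<in> E\<^sup>*"
proof (cases "v = None")
  case False
  then obtain vs where "directed_path E None v vs" using ex1_implies_ex[OF paths[OF assms False]] by (elim exE)
  then show ?thesis by (rule directed_path_rtrancl)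
qed simp

lemma no_parent_root: "(v, None) \<notin> E"
proof
  assume "(v, None) \<in> E"
  moreover then have "(None, v) \<in> E\<^sup>*" using E_vertices from_root by blast
  ultimately have "(None, None) \<in> E\<^sup>+" by (rule rtrancl_into_trancl1[rotated])
  then show False using acyc by simp
qed

lemma to_root: "(v, None) \<in> E\<^sup>* \<Longrightarrow> v = None"
  by (erule rtranclE) (simp_all add: no_parent_root)

text \<open>Two parents of \<open>x\<close> would give two directed paths from the root to
  \<open>x\<close>. Acyclicity keeps \<open>x\<close> off the path to its parent, so that the
  extension by \<open>x\<close> is again a path.\<close>

lemma unique_parent:
  assumes "(v, x) \<in> E" "(w, x) \<in> E"
  shows "v = w"
proof -
  have ex: "\<exists>vs. directed_path E None x (vs @ [x]) \<and> last vs = u" if u: "(u, x) \<in> E" for u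
  proof -
    have "u \<in> vertices P" using u E_vertices by blast
    from rtrancl_imp_directed_path[OF from_root[OF this]]
    obtain vs where vs: "directed_path E None u vs" by (elim exE)
    have "x \<notin> set vs"
    proof
      assume "x \<in> set vs"
      then obtain ys zs where e: "vs = ys @ x # zs" by (meson split_list)
      then have "successively (\<lambda>v w. (v, w) \<in> E) (x # zs)" "last (x # zs) = u"
        using vs unfolding directed_path_def e successively_append_iff by simp_all
      then have "(x, u) \<in> E\<^sup>*" using successively_rtrancl[of "x # zs" E] by simp
      then have "(x, x) \<in> E\<^sup>+" using u by (rule rtrancl_into_trancl1)
      then show False using acyc by simp
    qed
    then have "directed_path E None x (vs @ [x])"
      using vs u unfolding directed_path_def successively_append_iff by simp
    moreover have "last vs = u" using vs by (simp add: directed_path_def)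
    ultimately show ?thesis by (intro exI[of _ vs] conjI)
  qed
  have "x \<in> vertices P" using assms(1) E_vertices by blast
  moreover have "x \<noteq> None" using assms(1) no_parent_root by metis
  ultimately have ex1: "\<exists>!vs. directed_path E None x vs" by (rule paths)
  obtain vs where vs: "directed_path E None x (vs @ [x])" "last vs = v" using ex[OF assms(1)] by (elim exE conjE)
  obtain ws where ws: "directed_path E None x (ws @ [x])" "last ws = w" using ex[OF assms(2)] by (elim exE conjE)
  from ex1[unfolded Ex1_def] obtain us where "\<forall>ys. directed_path E None x ys \<longrightarrow> ys = us" by (elim exE conjE)
  note u = this[THEN spec, THEN mp]
  have "vs @ [x] = ws @ [x]" by (rule trans[OF u[OF vs(1)] u[OF ws(1), symmetric]])
  then have "vs = ws" by simp
  then show ?thesis using vs(2) ws(2) by simp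
qed

lemma target_cell:
  assumes "(v, w) \<in> E\<^sup>+"
  obtains B where "w = Some B" "B \<in> P"
proof -
  obtain u where "(u, w) \<in> E" using assms by (meson tranclE)
  then have "w \<in> vertices P" using E_vertices by blast
  moreover have "w \<noteq> None" using \<open>(u, w) \<in> E\<close> no_parent_root by metis
  ultimately show ?thesis using that by (auto simp: vertices_def)
qed

lemma source_cell:
  assumes "(v, w) \<in> E\<^sup>+" "v \<noteq> None"
  obtains A where "v = Some A" "A \<in> P"
proof -
  obtain u where "(v, u) \<in> E" using assms(1) by (meson tranclD)
  then have "v \<in> vertices P" using E_vertices by blast
  then show ?thesis using that assms(2) by (auto simp: vertices_def)
qed

lemma tree_rel_iff:
  assumes "A \<in> P" "B \<in> P" "i \<in> A" "j \<in> B"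
  shows "(i, j) \<in> tree_rel T \<longleftrightarrow> (Some A, Some B) \<in> E\<^sup>*"
  using assms partition_eq[OF partP] unfolding tree_rel_def by blast

lemma tree_relE:
  assumes "(i, j) \<in> tree_rel T"
  obtains A B where "A \<in> P" "B \<in> P" "i \<in> A" "j \<in> B" "(Some A, Some B) \<in> E\<^sup>*"
  using assms unfolding tree_rel_def by blast

lemma cell_in_I: "A \<in> P \<Longrightarrow> A \<subseteq> I" and cell_ne: "A \<in> P \<Longrightarrow> A \<noteq> {}"
  using partition_subset[OF partP] partition_onD3[OF partP] by metis+

lemma cell_eq:
  assumes "A \<in> P" "i \<in> A"
  shows "A = {j. (i, j) \<in> tree_rel T \<and> (j, i) \<in> tree_rel T}"
proof (intro equalityI subsetI CollectI conjI)
  fix j assume "j \<in> A"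
  then show "(i, j) \<in> tree_rel T" "(j, i) \<in> tree_rel T" using tree_rel_iff[OF assms(1) assms(1)] assms by auto
next
  fix j assume "j \<in> {j. (i, j) \<in> tree_rel T \<and> (j, i) \<in> tree_rel T}"
  then have j: "(i, j) \<in> tree_rel T" "(j, i) \<in> tree_rel T" by auto
  then obtain A' B where B: "B \<in> P" "j \<in> B" by (elim tree_relE)
  then have "(Some A, Some B) \<in> E\<^sup>*" "(Some B, Some A) \<in> E\<^sup>*"
    using j tree_rel_iff[OF assms(1) B(1) assms(2) B(2)] tree_rel_iff[OF B(1) assms(1) B(2) assms(2)] by auto
  then show "j \<in> A" using antisym B(2) by blast
qed

text \<open>Edges are the covering pairs of reachability: as parents are unique, every directed path
  into \<open>B\<close> ends with the same edge, and a vertex strictly between \<open>A\<close> and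
  \<open>B\<close> would reach \<open>B\<close> through \<open>A\<close>, closing a cycle.\<close>

lemma edge_iff:
  "(Some A, Some B) \<in> E \<longleftrightarrow> A \<in> P \<and> B \<in> P \<and> A \<noteq> B \<and> (Some A, Some B) \<in> E\<^sup>* \<and>
    (\<forall>C\<in>P. (Some A, Some C) \<in> E\<^sup>* \<longrightarrow> (Some C, Some B) \<in> E\<^sup>* \<longrightarrow> C = A \<or> C = B)" (is "?l \<longleftrightarrow> ?r")
proof
  assume e: ?l
  show ?r
  proof (intro conjI ballI impI)
    show "A \<in> P" "B \<in> P" using e E_vertices by (auto simp: vertices_def)
    show "A \<noteq> B" using e acyc[of "Some A"] by blast
    show "(Some A, Some B) \<in> E\<^sup>*" using e by blast
    fix C assume C: "(Some A, Some C) \<in> E\<^sup>*" "(Some C, Some B) \<in> E\<^sup>*"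
    show "C = A \<or> C = B"
    proof (cases "C = B")
      case False
      then obtain w where w: "(Some C, w) \<in> E\<^sup>*" "(w, Some B) \<in> E" using C(2) by (metis option.inject rtranclE)
      then have "w = Some A" using unique_parent e by blast
      then have "Some C = Some A" using antisym w(1) C(1) by blast
      then show ?thesis by simp
    qed simp
  qed
next
  assume r: ?r
  then obtain w where w: "(Some A, w) \<in> E\<^sup>*" "(w, Some B) \<in> E" by (metis option.inject rtranclE)
  have "w \<noteq> None" using to_root[of "Some A"] w(1) by (cases w) auto
  moreover have "w \<in> vertices P" using w(2) E_vertices by blast
  ultimately obtain C where C: "w = Some C" "C \<in> P" by (auto simp: vertices_def)
  then have "C = A \<or> C = B" using r w by blast
  moreover have "C \<noteq> B" using w(2) C acyc[of "Some B"] by blast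
  ultimately show ?l using w C by simp
qed

lemma root_edge_iff:
  "(None, Some B) \<in> E \<longleftrightarrow> B \<in> P \<and> (\<forall>C\<in>P. (Some C, Some B) \<in> E\<^sup>* \<longrightarrow> C = B)" (is "?l \<longleftrightarrow> ?r")
proof
  assume e: ?l
  show ?r
  proof (intro conjI ballI impI)
    show "B \<in> P" using e E_vertices by (auto simp: vertices_def)
    fix C assume C: "(Some C, Some B) \<in> E\<^sup>*"
    show "C = B"
    proof (rule ccontr)
      assume "C \<noteq> B"
      then obtain w where w: "(Some C, w) \<in> E\<^sup>*" "(w, Some B) \<in> E" using C by (metis option.inject rtranclE)
      then have "w = None" using unique_parent e by blast
      then show False using to_root[of "Some C"] w(1) by simp
    qed
  qed
next
  assume r: ?r
  then have "(None, Some B) \<in> E\<^sup>*" by (intro from_root) (simp add: vertices_def)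
  then obtain w where w: "(w, Some B) \<in> E" by (metis option.distinct(1) rtranclE)
  have "w = None"
  proof (rule ccontr)
    assume "w \<noteq> None"
    then obtain C where C: "w = Some C" "C \<in> P" using w E_vertices by (auto simp: vertices_def)
    then have "C = B" using r w by blast
    then show False using w C acyc[of "Some B"] by blast
  qed
  then show ?l using w by simp
qed

lemma tree_rel_sub: "tree_rel T \<subseteq> I \<times> I"
  using cell_in_I unfolding tree_rel_def by blast

lemma partition_eq_classes: "P = (\<lambda>i. {j. (i, j) \<in> tree_rel T \<and> (j, i) \<in> tree_rel T}) ` I"
proof (intro equalityI subsetI)
  fix A assume A: "A \<in> P"
  then obtain i where i: "i \<in> A" using cell_ne by blast
  then show "A \<in> (\<lambda>i. {j. (i, j) \<in> tree_rel T \<and> (j, i) \<in> tree_rel T}) ` I"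
    using cell_eq[OF A i] cell_in_I[OF A] by blast
next
  fix A assume "A \<in> (\<lambda>i. {j. (i, j) \<in> tree_rel T \<and> (j, i) \<in> tree_rel T}) ` I"
  then obtain i where i: "i \<in> I" "A = {j. (i, j) \<in> tree_rel T \<and> (j, i) \<in> tree_rel T}" by blast
  obtain B where B: "B \<in> P" "i \<in> B" using partition_ex[OF partP i(1)] by blast
  then show "A \<in> P" using cell_eq[OF B] i(2) by simp
qed

lemma depth_eq_dep:
  assumes i: "i \<in> I"
  shows "depth T i = dep (tree_rel T) i"
proof -
  obtain A where A: "A \<in> P" "i \<in> A" using partition_ex[OF partP i] by blast
  have the: "(THE A. A \<in> P \<and> i \<in> A) = A"
    by (rule the_equality) (use A partition_eq[OF partP] in blast)+
  have finP: "finite P" by (rule finite_elements[OF fin_I partP])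
  let ?L = "{B \<in> P. (Some B, Some A) \<in> E\<^sup>+}"
  have fL: "finite ?L" using finP by simp
  have anc: "ancestors T (Some A) = insert None (Some ` ?L)"
  proof (intro equalityI subsetI)
    fix w assume "w \<in> ancestors T (Some A)"
    then have w: "(w, Some A) \<in> E\<^sup>+" by (simp add: ancestors_def)
    show "w \<in> insert None (Some ` ?L)"
    proof (cases "w = None")
      case False
      then obtain B where "w = Some B" "B \<in> P" using source_cell[OF w] by blast
      then show ?thesis using w by simp
    qed simp
  next
    fix w assume "w \<in> insert None (Some ` ?L)"
    moreover have "(None, Some A) \<in> E\<^sup>+"
      using from_root[of "Some A"] A by (metis option.distinct(1) rtranclD image_eqI insertCI vertices_def)
    ultimately show "w \<in> ancestors T (Some A)" by (auto simp: ancestors_def)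
  qed
  have "depth T i = Suc (card ?L)"
    unfolding depth_def the anc using fL by (simp add: card_image)
  moreover have "(\<lambda>j. {k. (j, k) \<in> tree_rel T \<and> (k, j) \<in> tree_rel T}) ` {j. (j, i) \<in> tree_rel T} = insert A ?L"
    (is "?f ` ?J = _")
  proof (intro equalityI subsetI)
    fix C assume "C \<in> ?f ` ?J"
    then obtain j where j: "(j, i) \<in> tree_rel T" "C = ?f j" by blast
    then obtain B where B: "B \<in> P" "j \<in> B" by (elim tree_relE)
    then have "(Some B, Some A) \<in> E\<^sup>*" using j tree_rel_iff[OF B(1) A(1) B(2) A(2)] by simp
    moreover have "C = B" using cell_eq[OF B] j by simp
    ultimately show "C \<in> insert A ?L" using B(1) by (auto dest: rtranclD)
  next
    fix B assume "B \<in> insert A ?L"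
    then have B: "B \<in> P" "(Some B, Some A) \<in> E\<^sup>*" using A by auto
    then obtain j where j: "j \<in> B" using cell_ne by blast
    then have "(j, i) \<in> tree_rel T" "B = ?f j" using B tree_rel_iff[OF B(1) A(1) j A(2)] cell_eq[OF B(1) j] by auto
    then show "B \<in> ?f ` ?J" by blast
  qed
  moreover have "A \<notin> ?L" using acyc by blast
  ultimately show ?thesis unfolding dep_def using fL by simp
qed

end

lemma rct_eqI:
  assumes "is_rct I T" "is_rct I T'" "finite I" and e: "tree_rel T = tree_rel T'"
  shows "T = T'"
proof -
  interpret T: rct I T by unfold_locales fact+
  interpret T': rct I T' by unfold_locales fact+
  have P: "fst T = fst T'" using T.partition_eq_classes T'.partition_eq_classes e by simp
  have rt: "(Some A, Some B) \<in> (snd T)\<^sup>* \<longleftrightarrow> (Some A, Some B) \<in> (snd T')\<^sup>*" if AB: "A \<in> fst T" "B \<in> fst T" for A B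
  proof -
    obtain i j where ij: "i \<in> A" "j \<in> B" using AB T.cell_ne by blast
    show ?thesis using T.tree_rel_iff[OF AB ij] T'.tree_rel_iff[OF AB[unfolded P] ij] e by simp
  qed
  have "(v, w) \<in> snd T \<longleftrightarrow> (v, w) \<in> snd T'" for v w
  proof (cases w)
    case None
    then show ?thesis using T.no_parent_root T'.no_parent_root by simp
  next
    case w: (Some B)
    show ?thesis
    proof (cases v)
      case None
      then show ?thesis unfolding w None T.root_edge_iff T'.root_edge_iff using rt P by metis
    next
      case (Some A)
      then show ?thesis unfolding w Some T.edge_iff T'.edge_iff using rt P by metis
    qed
  qed
  then have "snd T = snd T'" by auto
  then show ?thesis using P by (simp add: prod_eq_iff)
qed

text \<open>On a cycle of the underlying graph, a vertex of maximal rank has both its neighbours as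
  parents. Uniqueness of parents makes the neighbours equal, which a cycle of length at least three
  excludes.\<close>

lemma is_rctI:
  fixes rank :: "vertex \<Rightarrow> nat"
  assumes P: "partition_on I P" and E: "E \<subseteq> vertices P \<times> vertices P"
    and rank: "\<And>v w. (v, w) \<in> E \<Longrightarrow> rank v < rank w"
    and par: "\<And>u v w. (u, w) \<in> E \<Longrightarrow> (v, w) \<in> E \<Longrightarrow> u = v"
    and root: "\<And>v. (v, None) \<notin> E" and reach: "\<And>v. v \<in> vertices P \<Longrightarrow> (None, v) \<in> E\<^sup>*"
  shows "is_rct I (P, E)"
  unfolding is_rct_def prod.case
proof (intro conjI ballI impI P E)
  show "asym E" by (rule asymI) (use rank in \<open>meson less_asym\<close>)
  fix v w assume vw: "v \<in> vertices P" "w \<in> vertices P"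
  have "(None, w) \<in> (E \<union> E\<inverse>)\<^sup>*" using reach[OF vw(2)] by (rule rtrancl_mono[THEN subsetD, rotated]) blast
  moreover have "(v, None) \<in> (E\<inverse>)\<^sup>*" using reach[OF vw(1)] by (rule rtrancl_converseI)
  then have "(v, None) \<in> (E \<union> E\<inverse>)\<^sup>*" by (rule rtrancl_mono[THEN subsetD, rotated]) blast
  ultimately show "(v, w) \<in> (E \<union> E\<inverse>)\<^sup>*" by (rule rtrancl_trans[rotated])
next
  show "\<nexists>vs. undirected_cycle E vs"
  proof
    assume "\<exists>vs. undirected_cycle E vs"
    then obtain vs where "undirected_cycle E vs" by blast
    then have n: "length vs \<ge> 3" and d: "distinct vs"
      and s: "\<And>k. Suc k < length vs \<Longrightarrow> (vs ! k, vs ! Suc k) \<in> E \<union> E\<inverse>"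
      and l: "(last vs, hd vs) \<in> E \<union> E\<inverse>"
      by (auto simp: undirected_cycle_def successively_conv_nth)
    let ?n = "length vs"
    have ne: "vs \<noteq> []" using n by auto
    have adj: "(vs ! k, vs ! (Suc k mod ?n)) \<in> E \<union> E\<inverse>" if "k < ?n" for k
    proof (cases "Suc k < ?n")
      case True
      then show ?thesis using s by simp
    next
      case False
      then have "Suc k = ?n" using that by simp
      moreover then have "k = ?n - 1" by simp
      ultimately show ?thesis using l ne by (simp add: last_conv_nth hd_conv_nth)
    qed
    obtain m where m: "m < ?n" "\<And>k. k < ?n \<Longrightarrow> rank (vs ! k) \<le> rank (vs ! m)"
    proof -
      have "\<exists>m. m < ?n \<and> (\<forall>k. k < ?n \<longrightarrow> rank (vs ! k) \<le> rank (vs ! m))"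
        by (rule ex_has_greatest_nat[of "\<lambda>k. k < ?n" 0 "\<lambda>k. rank (vs ! k)" "Suc (Max ((\<lambda>k. rank (vs ! k)) ` {..<?n}))"])
           (use n in \<open>auto intro!: le_imp_less_Suc Max_ge\<close>)
      then show ?thesis using that by blast
    qed
    \<comment> \<open>The positions next to \<open>m\<close> on the cycle, in the two
      directions.\<close>
    define a where "a = Suc m mod ?n"
    define b where "b = (m + ?n - 1) mod ?n"
    have "?n > 0" using n by linarith
    then have ab: "a < ?n" "b < ?n" unfolding a_def b_def by (rule mod_less_divisor)+
    have bm: "Suc b mod ?n = m"
    proof -
      have "Suc b mod ?n = (Suc (m + ?n - 1)) mod ?n" unfolding b_def by (simp add: mod_Suc_eq)
      moreover have "Suc (m + ?n - 1) = m + ?n" using n by linarith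
      ultimately show ?thesis using m(1) by (simp only: mod_add_self2 mod_less)
    qed
    have "(vs ! a, vs ! m) \<in> E"
      using adj[OF m(1)] rank[of "vs ! m" "vs ! a"] m(2)[OF ab(1)] unfolding a_def by fastforce
    moreover have "(vs ! b, vs ! m) \<in> E"
      using adj[OF ab(2)] rank[of "vs ! m" "vs ! b"] m(2)[OF ab(2)] unfolding bm by fastforce
    ultimately have "vs ! a = vs ! b" by (rule par)
    then have "a = b" using nth_eq_iff_index_eq[OF d ab] by simp
    \<comment> \<open>Two steps along the cycle lead back to \<open>m\<close>, which its length
      forbids.\<close>
    then have "Suc (Suc m mod ?n) mod ?n = m" using bm by (simp add: a_def)
    then have "(m + 2) mod ?n = m mod ?n" using m(1) by (simp add: mod_Suc_eq)
    then have e: "(m + 2) mod ?n = m" using m(1) by simp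
    show False
    proof (cases "m + 2 < ?n")
      case True
      then show False using e by simp
    next
      case False
      then have "(m + 2) mod ?n = m + 2 - ?n"
        using m(1) n by (subst le_mod_geq) (linarith, intro mod_less, linarith)
      then show False using e n False by linarith
    qed
  qed
next
  fix v assume v: "v \<in> vertices P" "v \<noteq> None"
  have uniq: "directed_path E None x vs \<Longrightarrow> directed_path E None x ws \<Longrightarrow> vs = ws" for x vs ws
  proof (induction vs arbitrary: x ws rule: rev_induct)
    case (snoc y vs)
    have y: "y = x" using snoc.prems(1) by (simp add: directed_path_def)
    have "ws \<noteq> []" "last ws = x" using snoc.prems(2) by (auto simp: directed_path_def)
    then obtain ws' where ws: "ws = ws' @ [x]" by (metis append_butlast_last_id)
    have last: "(last us, x) \<in> E \<and> directed_path E None (last us) us"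
      if "directed_path E None x (us @ [x])" "us \<noteq> []" for us
      using that by (auto simp: directed_path_def successively_append_iff)
    have dv: "directed_path E None x (vs @ [x])" and dw: "directed_path E None x (ws' @ [x])"
      using snoc.prems unfolding y ws .
    show ?case
    proof (cases "x = None")
      case True
      have nil: "us = []" if "directed_path E None x (us @ [x])" for us
        using last[OF that] root True by blast
      show ?thesis unfolding y ws nil[OF dv] nil[OF dw] ..
    next
      case False
      have ne: "us \<noteq> []" if "directed_path E None x (us @ [x])" for us
        using that False by (auto simp: directed_path_def)
      note l1 = last[OF dv ne[OF dv]] and l2 = last[OF dw ne[OF dw]]
      have e: "last vs = last ws'" by (rule par[OF conjunct1[OF l1] conjunct1[OF l2]])
      have "vs = ws'" by (rule snoc.IH[OF conjunct2[OF l1] conjunct2[OF l2, folded e]])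
      then show ?thesis unfolding y ws by simp
    qed
  qed (simp add: directed_path_def)
  show "\<exists>!vs. directed_path E None v vs"
    using rtrancl_imp_directed_path[OF reach[OF v(1)]] uniq by blast
qed

section \<open>The tree of a preorder whose down-sets are chains\<close>

locale forest_preorder =
  fixes I :: "nat set" and R :: "(nat \<times> nat) set"
  assumes fin_I: "finite I" and field: "R \<subseteq> I \<times> I" and refl: "i \<in> I \<Longrightarrow> (i, i) \<in> R"
    and trans: "(i, j) \<in> R \<Longrightarrow> (j, k) \<in> R \<Longrightarrow> (i, k) \<in> R"
    and chain: "(i, k) \<in> R \<Longrightarrow> (j, k) \<in> R \<Longrightarrow> (i, j) \<in> R \<or> (j, i) \<in> R"
begin

definition cl :: "nat \<Rightarrow> nat set" where
  "cl i = {j. (i, j) \<in> R \<and> (j, i) \<in> R}"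

definition covers :: "nat \<Rightarrow> nat \<Rightarrow> bool" where
  "covers a b \<longleftrightarrow> (a, b) \<in> R \<and> (b, a) \<notin> R \<and> (\<forall>c. (a, c) \<in> R \<longrightarrow> (c, b) \<in> R \<longrightarrow> (c, a) \<in> R \<or> (b, c) \<in> R)"

definition tree_edges :: "(vertex \<times> vertex) set" where
  "tree_edges = {(Some (cl a), Some (cl b)) | a b. covers a b} \<union>
     {(None, Some (cl b)) | b. b \<in> I \<and> (\<forall>c. (c, b) \<in> R \<longrightarrow> (b, c) \<in> R)}"

text \<open>Strictly increasing along strict relations, hence a rank for \<open>is_rctI\<close>. It
  is positive on \<open>I\<close>, which leaves rank 0 for the vertex \<open>o\<close>.\<close>

definition height :: "nat \<Rightarrow> nat" where
  "height b = card {j. (j, b) \<in> R}"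

lemma in_I: "(i, j) \<in> R \<Longrightarrow> i \<in> I" "(i, j) \<in> R \<Longrightarrow> j \<in> I"
  using field by auto

lemma cl_eqD: "i \<in> I \<Longrightarrow> j \<in> I \<Longrightarrow> cl i = cl j \<Longrightarrow> (i, j) \<in> R \<and> (j, i) \<in> R"
  using refl[of j] by (auto simp: cl_def)

lemma cl_eqI:
  assumes "(i, j) \<in> R" "(j, i) \<in> R"
  shows "cl i = cl j"
  unfolding cl_def using trans[OF assms(1)] trans[OF assms(2)] trans[OF _ assms(1)] trans[OF _ assms(2)] by auto

lemma fin_below: "finite {j. (j, b) \<in> R}"
  by (rule finite_subset[OF _ fin_I]) (use in_I in auto)

lemma height_less:
  assumes "(a, b) \<in> R" "(b, a) \<notin> R"
  shows "height a < height b"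
  unfolding height_def
proof (rule psubset_card_mono[OF fin_below psubsetI])
  show "{j. (j, a) \<in> R} \<subseteq> {j. (j, b) \<in> R}" using trans[OF _ assms(1)] by auto
  have "b \<in> {j. (j, b) \<in> R}" using refl[OF in_I(2)[OF assms(1)]] by simp
  then show "{j. (j, a) \<in> R} \<noteq> {j. (j, b) \<in> R}" using assms(2) by auto
qed

lemma height_pos: "b \<in> I \<Longrightarrow> 0 < height b"
  unfolding height_def using refl[of b] fin_below[of b] by (auto simp: card_gt_0_iff)

lemma height_cl: "(i, j) \<in> R \<Longrightarrow> (j, i) \<in> R \<Longrightarrow> height i = height j"
  unfolding height_def using trans by (metis (no_types, lifting))

text \<open>By \<open>chain\<close>, the strict predecessors of \<open>b\<close> are pairwise
  comparable, so one of greatest height has all the others above it or in its class.\<close>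

lemma ex_cover:
  assumes "(c, b) \<in> R" "(b, c) \<notin> R"
  obtains a where "covers a b" "\<And>d. (d, b) \<in> R \<Longrightarrow> (b, d) \<notin> R \<Longrightarrow> (d, a) \<in> R"
proof -
  let ?q = "\<lambda>a. (a, b) \<in> R \<and> (b, a) \<notin> R"
  have "\<exists>a. ?q a \<and> (\<forall>d. ?q d \<longrightarrow> height d \<le> height a)"
  proof (rule ex_has_greatest_nat[of ?q c height "height b"])
    show "\<forall>y. ?q y \<longrightarrow> height y < height b" using height_less by blast
  qed (use assms in simp)
  then obtain a where a: "?q a" "\<And>d. ?q d \<Longrightarrow> height d \<le> height a" by blast
  have below: "(d, a) \<in> R" if d: "(d, b) \<in> R" "(b, d) \<notin> R" for d
  proof (rule ccontr)
    assume n: "(d, a) \<notin> R"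
    then have "(a, d) \<in> R" using chain[of a b d] a(1) d(1) by blast
    then have "height a < height d" using n by (rule height_less)
    then show False using a(2)[of d] d by simp
  qed
  have "covers a b" unfolding covers_def using a(1) below by blast
  then show ?thesis using below by (rule that)
qed

lemma edge_None: "(v, None) \<notin> tree_edges"
  by (simp add: tree_edges_def)

lemma edgeE:
  assumes "(v, w) \<in> tree_edges"
  obtains (cell) a b where "v = Some (cl a)" "w = Some (cl b)" "covers a b"
    | (root) b where "v = None" "w = Some (cl b)" "b \<in> I" "\<And>c. (c, b) \<in> R \<Longrightarrow> (b, c) \<in> R"
  using assms unfolding tree_edges_def by blast

lemma coversD:
  assumes "covers a b"
  shows "(a, b) \<in> R" "(b, a) \<notin> R" "(a, c) \<in> R \<Longrightarrow> (c, b) \<in> R \<Longrightarrow> (c, a) \<in> R \<or> (b, c) \<in> R" "a \<in> I" "b \<in> I"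
  using assms in_I unfolding covers_def by blast+

lemma cover_unique:
  assumes a: "covers a b" and a': "covers a' b'" and b: "(b, b') \<in> R" "(b', b) \<in> R"
  shows "cl a = cl a'"
proof -
  have 1: "(a', b) \<in> R" by (rule trans[OF coversD(1)[OF a'] b(2)])
  have 2: "(a, b') \<in> R" by (rule trans[OF coversD(1)[OF a] b(1)])
  have n1: "(b, a') \<notin> R" using trans[OF b(2)] coversD(2)[OF a'] by blast
  have n2: "(b', a) \<notin> R" using trans[OF b(1)] coversD(2)[OF a] by blast
  have "(a, a') \<in> R \<and> (a', a) \<in> R"
    using chain[OF coversD(1)[OF a] 1] coversD(3)[OF a _ 1] coversD(3)[OF a' _ 2] n1 n2 by blast
  then show ?thesis by (intro cl_eqI) auto
qed

lemma reach_cl: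
  assumes "(a, b) \<in> R"
  shows "(Some (cl a), Some (cl b)) \<in> tree_edges\<^sup>*"
  using assms
proof (induction "height b" arbitrary: b rule: less_induct)
  case less
  show ?case
  proof (cases "(b, a) \<in> R")
    case True
    then have "cl a = cl b" by (rule cl_eqI[OF less.prems])
    then show ?thesis by simp
  next
    case False
    obtain c where c: "covers c b" "\<And>d. (d, b) \<in> R \<Longrightarrow> (b, d) \<notin> R \<Longrightarrow> (d, c) \<in> R"
      by (rule ex_cover[OF less.prems False]) (rule that)
    have "(a, c) \<in> R" by (rule c(2)[OF less.prems False])
    then have "(Some (cl a), Some (cl c)) \<in> tree_edges\<^sup>*"
      by (rule less.hyps[OF height_less[OF coversD(1,2)[OF c(1)]]])
    moreover have "(Some (cl c), Some (cl b)) \<in> tree_edges" using c(1) unfolding tree_edges_def by blast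
    ultimately show ?thesis by (rule rtrancl_into_rtrancl)
  qed
qed

lemma reach_root:
  assumes "b \<in> I"
  shows "(None, Some (cl b)) \<in> tree_edges\<^sup>*"
  using assms
proof (induction "height b" arbitrary: b rule: less_induct)
  case less
  show ?case
  proof (cases "\<forall>c. (c, b) \<in> R \<longrightarrow> (b, c) \<in> R")
    case True
    then have "(None, Some (cl b)) \<in> tree_edges" using less.prems unfolding tree_edges_def by blast
    then show ?thesis by (rule r_into_rtrancl)
  next
    case False
    then obtain c where c: "(c, b) \<in> R" "(b, c) \<notin> R" by blast
    then have "(None, Some (cl c)) \<in> tree_edges\<^sup>*" by (intro less.hyps height_less in_I(1)[OF c(1)])
    then show ?thesis using reach_cl[OF c(1)] by (rule rtrancl_trans)
  qed
qed

lemma reach_clD: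
  assumes "(Some (cl a), w) \<in> tree_edges\<^sup>*" "a \<in> I"
  shows "\<exists>b. w = Some (cl b) \<and> (a, b) \<in> R"
  using assms(1)
proof (induction rule: rtrancl_induct)
  case base
  then show ?case using refl[OF assms(2)] by blast
next
  case (step v w)
  then obtain b where b: "v = Some (cl b)" "(a, b) \<in> R" by blast
  show ?case using step.hyps(2)
  proof (cases rule: edgeE)
    case (cell c d)
    have "(b, c) \<in> R" using cl_eqD[OF in_I(2)[OF b(2)] coversD(4)[OF cell(3)]] cell(1) b(1) by simp
    then have "(a, d) \<in> R" using trans[OF b(2)] trans[OF _ coversD(1)[OF cell(3)]] by blast
    then show ?thesis using cell(2) by blast
  next
    case (root c)
    then show ?thesis using b(1) by simp
  qed
qed

lemma cl_partition: "partition_on I (cl ` I)"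
proof (rule partition_onI)
  show "\<Union> (cl ` I) = I" using refl in_I by (auto simp: cl_def)
  show "{} \<notin> cl ` I" using refl by (auto simp: cl_def)
  fix A B assume "A \<in> cl ` I" "B \<in> cl ` I" "A \<noteq> B"
  then obtain a b where ab: "A = cl a" "B = cl b" "a \<in> I" "b \<in> I" by blast
  show "disjnt A B"
  proof (rule ccontr)
    assume "\<not> disjnt A B"
    then obtain x where x: "(a, x) \<in> R" "(x, a) \<in> R" "(b, x) \<in> R" "(x, b) \<in> R"
      using ab by (auto simp: disjnt_def cl_def)
    have "(a, b) \<in> R" "(b, a) \<in> R" using trans[OF x(1,4)] trans[OF x(3,2)] by simp_all
    then have "cl a = cl b" by (rule cl_eqI)
    then show False using \<open>A \<noteq> B\<close> ab by simp
  qed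
qed

lemma tree_is_rct: "is_rct I (cl ` I, tree_edges)"
proof (rule is_rctI[where rank = "\<lambda>v. case v of None \<Rightarrow> 0 | Some B \<Rightarrow> height (SOME b. b \<in> B)"])
  let ?r = "\<lambda>v. case v of None \<Rightarrow> 0 | Some B \<Rightarrow> height (SOME b. b \<in> B)"
  have r: "?r (Some (cl b)) = height b" if "b \<in> I" for b
  proof -
    have "b \<in> cl b" using refl[OF that] by (simp add: cl_def)
    then have "(SOME x. x \<in> cl b) \<in> cl b" by (rule someI)
    then show ?thesis using height_cl unfolding cl_def by simp
  qed
  show "partition_on I (cl ` I)" by (rule cl_partition)
  show "tree_edges \<subseteq> vertices (cl ` I) \<times> vertices (cl ` I)"
    using coversD(4,5) unfolding tree_edges_def vertices_def by blast
  show "?r v < ?r w" if "(v, w) \<in> tree_edges" for v w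
    using that
  proof (cases rule: edgeE)
    case (cell a b)
    then show ?thesis using height_less[OF coversD(1,2)[OF cell(3)]] r coversD(4,5)[OF cell(3)] by simp
  next
    case (root b)
    then show ?thesis using height_pos r by simp
  qed
  show "u = v" if "(u, w) \<in> tree_edges" "(v, w) \<in> tree_edges" for u v w
    using that(1)
  proof (cases rule: edgeE)
    case c1: (cell a b)
    show ?thesis using that(2)
    proof (cases rule: edgeE)
      case c2: (cell a' b')
      have "(b, b') \<in> R \<and> (b', b) \<in> R"
        by (rule cl_eqD[OF coversD(5)[OF c1(3)] coversD(5)[OF c2(3)]]) (use c1 c2 in simp)
      then have "cl a = cl a'" using cover_unique[OF c1(3) c2(3)] by blast
      then show ?thesis using c1 c2 by simp
    next
      case c2: (root b')
      have "(b, b') \<in> R \<and> (b', b) \<in> R"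
        by (rule cl_eqD[OF coversD(5)[OF c1(3)] c2(3)]) (use c1 c2 in simp)
      then have "(b, a) \<in> R"
        using c2(4) trans coversD(1)[OF c1(3)] by blast
      then show ?thesis using coversD(2)[OF c1(3)] by simp
    qed
  next
    case c1: (root b)
    show ?thesis using that(2)
    proof (cases rule: edgeE)
      case c2: (cell a' b')
      have "(b, b') \<in> R \<and> (b', b) \<in> R"
        by (rule cl_eqD[OF c1(3) coversD(5)[OF c2(3)]]) (use c1 c2 in simp)
      then have "(b', a') \<in> R"
        using c1(4) trans coversD(1)[OF c2(3)] by blast
      then show ?thesis using coversD(2)[OF c2(3)] by simp
    next
      case c2: (root b')
      then show ?thesis using c1 by simp
    qed
  qed
  show "(v, None) \<notin> tree_edges" for v by (rule edge_None)
  show "(None, v) \<in> tree_edges\<^sup>*" if "v \<in> vertices (cl ` I)" for v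
    using that reach_root unfolding vertices_def by auto
qed

lemma tree_rel_tree: "tree_rel (cl ` I, tree_edges) = R"
proof -
  have "(i, j) \<in> tree_rel (cl ` I, tree_edges) \<longleftrightarrow> (i, j) \<in> R" for i j
  proof
    assume "(i, j) \<in> R"
    moreover have "i \<in> cl i" "j \<in> cl j" using refl in_I[OF \<open>(i, j) \<in> R\<close>] by (auto simp: cl_def)
    ultimately show "(i, j) \<in> tree_rel (cl ` I, tree_edges)"
      using reach_cl in_I unfolding tree_rel_def by force
  next
    assume "(i, j) \<in> tree_rel (cl ` I, tree_edges)"
    then obtain a b where ab: "a \<in> I" "b \<in> I" "i \<in> cl a" "j \<in> cl b" "(Some (cl a), Some (cl b)) \<in> tree_edges\<^sup>*"
      unfolding tree_rel_def by auto
    from reach_clD[OF ab(5,1)] obtain c where c: "cl b = cl c" "(a, c) \<in> R" by auto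
    then have "(c, b) \<in> R" using cl_eqD[OF ab(2) in_I(2)[OF c(2)]] by simp
    moreover have "(i, a) \<in> R" "(b, j) \<in> R" using ab by (auto simp: cl_def)
    ultimately show "(i, j) \<in> R" using c(2) trans by blast
  qed
  then show ?thesis by auto
qed

end

section \<open>Good relations are forest preorders\<close>

context lottery_pref
begin

lemma root_cell_iff:
  assumes A: "root_cell R B A" and xy: "x \<in> B" "y \<in> B"
  shows "x \<in> A \<Longrightarrow> (x, y) \<in> R" and "x \<notin> A \<Longrightarrow> (x, y) \<in> R \<Longrightarrow> y \<notin> A"
proof -
  note e = root_cellD(4)[OF A]
  have "(x, y) \<in> Restr R B \<longleftrightarrow> (x, y) \<in> A \<times> B \<union> Restr R (B - A)" by (simp only: e)
  then show "x \<in> A \<Longrightarrow> (x, y) \<in> R" "x \<notin> A \<Longrightarrow> (x, y) \<in> R \<Longrightarrow> y \<notin> A" using xy by auto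
qed

text \<open>In a block the root cell is related to everything and nothing outside the cell is
  related to it. Both properties are thus immediate at the cell and inductive below it.\<close>

lemma good_trans_chain:
  assumes "good K S R"
  shows "\<forall>i j k. ((i, j) \<in> R \<longrightarrow> (j, k) \<in> R \<longrightarrow> (i, k) \<in> R) \<and>
    ((i, k) \<in> R \<longrightarrow> (j, k) \<in> R \<longrightarrow> (i, j) \<in> R \<or> (j, i) \<in> R)"
  using assms
proof (induction rule: good.induct)
  case (good S K \<P> R)
  note part = Sep_partition[OF good.hyps(2)]
  have blk: "y \<in> B" if h: "B \<in> \<P>" "x \<in> B" "(x, y) \<in> R \<or> (y, x) \<in> R" for B x y
  proof -
    obtain C where C: "C \<in> \<P>" "x \<in> C" "y \<in> C" using h(3) good.hyps(3) by blast
    then have "C = B" using partition_eq[OF part C(1) h(1) C(2) h(2)] by simp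
    then show ?thesis using C by simp
  qed
  have ex: "\<exists>B\<in>\<P>. x \<in> B \<and> y \<in> B" if "(x, y) \<in> R" for x y using that good.hyps(3) by blast
  show ?case
  proof (intro allI conjI impI)
    fix i j k assume h: "(i, j) \<in> R" "(j, k) \<in> R"
    obtain B where B: "B \<in> \<P>" "i \<in> B" "j \<in> B" using ex[OF h(1)] by blast
    have kB: "k \<in> B" using blk[OF B(1,3)] h(2) by blast
    from bspec[OF good.IH B(1)] obtain A where A: "root_cell R B A"
      and IH: "\<And>i j k. (i, j) \<in> Restr R (B - A) \<Longrightarrow> (j, k) \<in> Restr R (B - A) \<Longrightarrow> (i, k) \<in> Restr R (B - A)"
      by blast
    show "(i, k) \<in> R"
    proof (cases "i \<in> A")
      case True
      then show ?thesis by (rule root_cell_iff(1)[OF A B(2) kB])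
    next
      case False
      have jA: "j \<notin> A" by (rule root_cell_iff(2)[OF A B(2,3) False h(1)])
      have kA: "k \<notin> A" by (rule root_cell_iff(2)[OF A B(3) kB jA h(2)])
      have "(i, k) \<in> Restr R (B - A)" by (rule IH) (use False jA kA B kB h in auto)
      then show ?thesis by simp
    qed
  next
    fix i j k assume h: "(i, k) \<in> R" "(j, k) \<in> R"
    obtain B where B: "B \<in> \<P>" "i \<in> B" "k \<in> B" using ex[OF h(1)] by blast
    have jB: "j \<in> B" using blk[OF B(1,3)] h(2) by blast
    from bspec[OF good.IH B(1)] obtain A where A: "root_cell R B A"
      and IH: "\<And>i j k. (i, k) \<in> Restr R (B - A) \<Longrightarrow> (j, k) \<in> Restr R (B - A) \<Longrightarrow>
        (i, j) \<in> Restr R (B - A) \<or> (j, i) \<in> Restr R (B - A)"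
      by blast
    show "(i, j) \<in> R \<or> (j, i) \<in> R"
    proof (cases "i \<in> A \<or> j \<in> A")
      case True
      then show ?thesis using root_cell_iff(1)[OF A B(2) jB] root_cell_iff(1)[OF A jB B(2)] by blast
    next
      case False
      have kA: "k \<notin> A" by (rule root_cell_iff(2)[OF A B(2,3) _ h(1)]) (use False in simp)
      have "(i, j) \<in> Restr R (B - A) \<or> (j, i) \<in> Restr R (B - A)"
        by (rule IH[of i k j]) (use False kA B jB h in auto)
      then show ?thesis by auto
    qed
  qed
qed

lemma good_forest_preorder:
  assumes "good K I R"
  shows "forest_preorder I R"
proof
  show "finite I" by (rule finite_I)
  show "R \<subseteq> I \<times> I" by (rule good_field[OF assms])
  show "(i, i) \<in> R" if "i \<in> I" for i using good_refl[OF assms] that by (rule bspec)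
  show "(i, j) \<in> R \<Longrightarrow> (j, k) \<in> R \<Longrightarrow> (i, k) \<in> R" for i j k
    by (rule good_trans_chain[OF assms, THEN spec, THEN spec, THEN spec, THEN conjunct1, THEN mp, THEN mp])
  show "(i, k) \<in> R \<Longrightarrow> (j, k) \<in> R \<Longrightarrow> (i, j) \<in> R \<or> (j, i) \<in> R" for i j k
    using good_trans_chain[OF assms, THEN spec[of _ i], THEN spec[of _ j], THEN spec[of _ k], THEN conjunct2] by simp
qed

end

section \<open>Dimensions of subtrees and of ancestors\<close>

context rct
begin

definition cell :: "vertex \<Rightarrow> nat set" where
  "cell v = (case v of None \<Rightarrow> {} | Some A \<Rightarrow> A)"

text \<open>At \<open>o\<close> this is all of \<open>I\<close> and \<open>cell\<close> is empty, so
  that the root can be treated like any other vertex.\<close>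

definition below :: "vertex \<Rightarrow> nat set" where
  "below v = subtree_dims T v - cell v"

abbreviation sub :: "nat set \<Rightarrow> nat set" where "sub A \<equiv> subtree_dims T (Some A)"

lemma cell_simps [simp]: "cell None = {}" "cell (Some A) = A"
  by (simp_all add: cell_def)

lemma subtree_below: "subtree_dims T v = cell v \<union> below v"
  by (auto simp: below_def subtree_dims_def cell_def split: option.splits)

lemma child_iff: "B \<in> children T v \<longleftrightarrow> (v, Some B) \<in> E"
  by (simp add: children_def)

lemma child_cell: "(v, Some B) \<in> E \<Longrightarrow> B \<in> P"
  using E_vertices by (auto simp: vertices_def)

lemma below_iff: "j \<in> below v \<longleftrightarrow> (\<exists>C\<in>P. j \<in> C \<and> (v, Some C) \<in> E\<^sup>+)"
proof
  assume "j \<in> below v"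
  then obtain C where C: "j \<in> C" "(v, Some C) \<in> E\<^sup>+"
    by (auto simp: below_def subtree_dims_def descendants_def cell_def split: option.splits)
  then have "C \<in> P" by (auto elim: target_cell)
  then show "\<exists>C\<in>P. j \<in> C \<and> (v, Some C) \<in> E\<^sup>+" using C by blast
next
  assume "\<exists>C\<in>P. j \<in> C \<and> (v, Some C) \<in> E\<^sup>+"
  then obtain C where C: "C \<in> P" "j \<in> C" "(v, Some C) \<in> E\<^sup>+" by blast
  have "j \<notin> cell v"
  proof
    assume j: "j \<in> cell v"
    then have "v \<noteq> None" by (cases v) auto
    then obtain A where A: "v = Some A" "A \<in> P" using source_cell[OF C(3)] by blast
    then have "A = C" using j C partition_eq[OF partP A(2) C(1), of j] by simp
    then show False using acyc A C by simp
  qed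
  then show "j \<in> below v" using C by (auto simp: below_def subtree_dims_def descendants_def)
qed

lemma sub_iff:
  assumes A: "A \<in> P"
  shows "j \<in> sub A \<longleftrightarrow> (\<exists>C\<in>P. j \<in> C \<and> (Some A, Some C) \<in> E\<^sup>*)"
  unfolding subtree_below Un_iff below_iff cell_simps rtrancl_eq_or_trancl using A by auto

lemma sub_iff_rel:
  assumes A: "A \<in> P" "i \<in> A"
  shows "j \<in> sub A \<longleftrightarrow> (i, j) \<in> tree_rel T"
proof
  assume "j \<in> sub A"
  then obtain C where "C \<in> P" "j \<in> C" "(Some A, Some C) \<in> E\<^sup>*" using sub_iff[OF A(1)] by blast
  then show "(i, j) \<in> tree_rel T" using A unfolding tree_rel_def by blast
next
  assume "(i, j) \<in> tree_rel T"
  then obtain A' C where C: "A' \<in> P" "i \<in> A'" "C \<in> P" "j \<in> C" "(Some A', Some C) \<in> E\<^sup>*"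
    by (elim tree_relE)
  then have "A' = A" using partition_eq[OF partP C(1) A(1) C(2) A(2)] by simp
  then show "j \<in> sub A" using C sub_iff[OF A(1)] by blast
qed

lemma anc_iff: "j \<in> anc_dims T v \<longleftrightarrow> (\<exists>C\<in>P. j \<in> C \<and> (Some C, v) \<in> E\<^sup>+)"
  unfolding anc_dims_def ancestors_def using source_cell by blast

lemma cell_sub: "A \<subseteq> sub A"
  by (auto simp: subtree_dims_def)

lemma anc_child:
  assumes "(v, Some B) \<in> E"
  shows "anc_dims T (Some B) = anc_dims T v \<union> cell v"
proof (intro equalityI subsetI)
  fix j assume "j \<in> anc_dims T (Some B)"
  then obtain C where C: "C \<in> P" "j \<in> C" "(Some C, Some B) \<in> E\<^sup>+" using anc_iff by blast
  then obtain u where u: "(Some C, u) \<in> E\<^sup>*" "(u, Some B) \<in> E" by (meson tranclD2)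
  then have "u = v" using unique_parent assms by blast
  then show "j \<in> anc_dims T v \<union> cell v"
    using u(1) C anc_iff[of j v] by (auto simp: rtrancl_eq_or_trancl)
next
  fix j assume "j \<in> anc_dims T v \<union> cell v"
  then consider C where "C \<in> P" "j \<in> C" "(Some C, v) \<in> E\<^sup>+" | "j \<in> cell v" using anc_iff by blast
  then show "j \<in> anc_dims T (Some B)"
  proof cases
    case 1
    then have "(Some C, Some B) \<in> E\<^sup>+" using assms by (meson trancl_into_trancl)
    then show ?thesis using 1 anc_iff by blast
  next
    case 2
    then have "v \<noteq> None" by (cases v) auto
    then obtain A where A: "v = Some A" "A \<in> P" using source_cell[OF r_into_trancl[OF assms]] by blast
    then show ?thesis using 2 assms anc_iff[of j "Some B"] by auto
  qed
qed

lemma ancestors_chain: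
  assumes "(u, x) \<in> E\<^sup>*" "(w, x) \<in> E\<^sup>*"
  shows "(u, w) \<in> E\<^sup>* \<or> (w, u) \<in> E\<^sup>*"
  using assms
proof (induction arbitrary: w rule: rtrancl_induct)
  case base
  then show ?case by simp
next
  case (step y x)
  from step.prems show ?case
  proof (cases rule: rtranclE)
    case base
    then have "(u, w) \<in> E\<^sup>*" using rtrancl_into_rtrancl[OF step.hyps] by simp
    then show ?thesis by simp
  next
    case (step y')
    then have "y' = y" using unique_parent \<open>(y, x) \<in> E\<close> by blast
    then show ?thesis using step step.IH by blast
  qed
qed

lemma below_children: "below v = (\<Union>B\<in>children T v. sub B)"
proof (intro equalityI subsetI)
  fix j assume "j \<in> below v"
  then obtain C where C: "C \<in> P" "j \<in> C" "(v, Some C) \<in> E\<^sup>+" using below_iff by blast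
  obtain u where u: "(v, u) \<in> E" "(u, Some C) \<in> E\<^sup>*" using tranclD[OF C(3)] by blast
  obtain B where B: "u = Some B" "B \<in> P" using target_cell[OF r_into_trancl[OF u(1)]] by blast
  have "j \<in> sub B" using sub_iff[OF B(2)] C u B by blast
  then show "j \<in> (\<Union>B\<in>children T v. sub B)" using u(1) B child_iff by blast
next
  fix j assume "j \<in> (\<Union>B\<in>children T v. sub B)"
  then obtain B where B: "(v, Some B) \<in> E" "j \<in> sub B" using child_iff by blast
  then obtain C where C: "C \<in> P" "j \<in> C" "(Some B, Some C) \<in> E\<^sup>*" using sub_iff[OF child_cell[OF B(1)]] by blast
  have "(v, Some C) \<in> E\<^sup>+" using rtrancl_into_trancl2[OF B(1) C(3)] .
  then show "j \<in> below v" using C below_iff by blast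
qed

lemma siblings_disjoint:
  assumes B: "(v, Some B) \<in> E" "(v, Some B') \<in> E" and j: "j \<in> sub B" "j \<in> sub B'"
  shows "B = B'"
proof -
  have no: "X = Y" if X: "(v, Some X) \<in> E" "(v, Some Y) \<in> E" "(Some X, Some Y) \<in> E\<^sup>*" for X Y
  proof (rule ccontr)
    assume "X \<noteq> Y"
    then have "(Some X, Some Y) \<in> E\<^sup>+" using X(3) by (simp add: rtrancl_eq_or_trancl)
    then obtain u where u: "(Some X, u) \<in> E\<^sup>*" "(u, Some Y) \<in> E" by (meson tranclD2)
    then have "u = v" using unique_parent X(2) by blast
    then have "(v, v) \<in> E\<^sup>+" using rtrancl_into_trancl2[OF X(1) u(1)] by simp
    then show False using acyc by simp
  qed
  obtain C where C: "C \<in> P" "j \<in> C" "(Some B, Some C) \<in> E\<^sup>*" using sub_iff[OF child_cell[OF B(1)]] j(1) by blast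
  obtain C' where C': "C' \<in> P" "j \<in> C'" "(Some B', Some C') \<in> E\<^sup>*" using sub_iff[OF child_cell[OF B(2)]] j(2) by blast
  have "C = C'" using partition_eq[OF partP C(1) C'(1) C(2) C'(2)] .
  then have "(Some B, Some B') \<in> E\<^sup>* \<or> (Some B', Some B) \<in> E\<^sup>*"
    using ancestors_chain[OF C(3)] C'(3) by blast
  then show ?thesis using no[OF B] no[OF B(2,1)] by blast
qed

lemma below_partition: "partition_on (below v) (sub ` children T v)"
proof (rule partition_onI)
  show "\<Union> (sub ` children T v) = below v" using below_children by simp
  have "sub B \<noteq> {}" if "(v, Some B) \<in> E" for B
    using cell_ne[OF child_cell[OF that]] cell_sub by blast
  then show "{} \<notin> sub ` children T v" using child_iff by (metis imageE)
  fix X Y assume "X \<in> sub ` children T v" "Y \<in> sub ` children T v" "X \<noteq> Y"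
  then obtain B B' where B: "X = sub B" "Y = sub B'" "(v, Some B) \<in> E" "(v, Some B') \<in> E"
    using child_iff by blast
  show "disjnt X Y"
  proof (rule ccontr)
    assume "\<not> disjnt X Y"
    then obtain j where "j \<in> sub B" "j \<in> sub B'" using B by (auto simp: disjnt_def)
    then have "B = B'" by (rule siblings_disjoint[OF B(3,4)])
    then show False using B \<open>X \<noteq> Y\<close> by simp
  qed
qed

lemma below_None: "below None = I"
proof (intro equalityI subsetI)
  fix j assume "j \<in> below None"
  then show "j \<in> I" using below_iff cell_in_I by blast
next
  fix j assume "j \<in> I"
  then obtain C where C: "C \<in> P" "j \<in> C" using partition_ex[OF partP] by blast
  then have "(None, Some C) \<in> E\<^sup>*" by (intro from_root) (simp add: vertices_def)
  then have "(None, Some C) \<in> E\<^sup>+" by (simp add: rtrancl_eq_or_trancl)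
  then show "j \<in> below None" using C below_iff by blast
qed

lemma below_in_I: "below v \<subseteq> I"
  using below_iff cell_in_I by blast

lemma sub_in_I: "A \<in> P \<Longrightarrow> sub A \<subseteq> I"
  using sub_iff cell_in_I by blast

lemma sub_root: "subtree_dims T None = I"
  using subtree_below[of None] below_None by simp

lemma anc_None: "anc_dims T None = {}"
  using anc_iff to_root by (metis acyc equals0I option.distinct(1) trancl_into_rtrancl)

lemma anc_in_I: "anc_dims T v \<subseteq> I"
  using anc_iff cell_in_I by blast

lemma anc_disjoint: "A \<in> P \<Longrightarrow> anc_dims T (Some A) \<inter> sub A = {}"
proof (rule ccontr)
  assume A: "A \<in> P" and "anc_dims T (Some A) \<inter> sub A \<noteq> {}"
  then obtain j where j: "j \<in> anc_dims T (Some A)" "j \<in> sub A" by blast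
  obtain C where C: "C \<in> P" "j \<in> C" "(Some C, Some A) \<in> E\<^sup>+" using anc_iff j(1) by blast
  obtain D where D: "D \<in> P" "j \<in> D" "(Some A, Some D) \<in> E\<^sup>*" using sub_iff[OF A] j(2) by blast
  have "C = D" using partition_eq[OF partP C(1) D(1) C(2) D(2)] .
  then have "(Some C, Some C) \<in> E\<^sup>+" using trancl_rtrancl_trancl[OF C(3)] D(3) by simp
  then show False using acyc by simp
qed

lemma parent_ex:
  assumes "A \<in> P"
  obtains v where "v \<in> vertices P" "(v, Some A) \<in> E"
proof -
  have "(None, Some A) \<in> E\<^sup>*" using assms by (intro from_root) (simp add: vertices_def)
  then obtain v where "(v, Some A) \<in> E" by (auto elim: rtranclE)
  then show ?thesis using that E_vertices by blast
qed

lemma tree_rel_trans: "(i, j) \<in> tree_rel T \<Longrightarrow> (j, k) \<in> tree_rel T \<Longrightarrow> (i, k) \<in> tree_rel T"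
proof (elim tree_relE)
  fix A B B' C assume h: "A \<in> P" "B \<in> P" "i \<in> A" "j \<in> B" "(Some A, Some B) \<in> E\<^sup>*"
    "B' \<in> P" "C \<in> P" "j \<in> B'" "k \<in> C" "(Some B', Some C) \<in> E\<^sup>*"
  then have "B = B'" using partition_eq[OF partP h(2,6,4,8)] by simp
  then show ?thesis using h tree_rel_iff[OF h(1,7,3,9)] by (meson rtrancl_trans)
qed

lemma sub_closed:
  assumes "B \<in> P" "i \<in> sub B" "(i, j) \<in> tree_rel T"
  shows "j \<in> sub B"
proof -
  obtain b where b: "b \<in> B" using cell_ne[OF assms(1)] by blast
  show ?thesis using sub_iff_rel[OF assms(1) b] tree_rel_trans assms(2,3) by blast
qed

lemma below_sub: "A \<in> P \<Longrightarrow> below (Some A) = sub A - A"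
  by (simp add: below_def)

lemma vertex_induct [consumes 1, case_names root child]:
  assumes "v \<in> vertices P" "Q None"
    and "\<And>v B. v \<in> vertices P \<Longrightarrow> (v, Some B) \<in> E \<Longrightarrow> Q v \<Longrightarrow> Q (Some B)"
  shows "Q v"
  using from_root[OF assms(1)]
proof (induction rule: rtrancl_induct)
  case base
  show ?case by (rule assms(2))
next
  case (step u w)
  have u: "u \<in> vertices P" using step.hyps(2) E_vertices by blast
  obtain B where B: "w = Some B" using target_cell[OF r_into_trancl[OF step.hyps(2)]] by blast
  show ?case using assms(3)[OF u] step B by blast
qed

end

section \<open>Conditions on a tree, vertex by vertex\<close>

locale rct_pref = lottery_pref I lo hi W + rct I T
  for I lo hi W T
begin

text \<open>What a representation imposes at each single vertex. It is the middle term between the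
  existence of aggregators and \<open>good\<close> for the preorder of the tree.\<close>

definition local_conditions :: bool where
  "local_conditions \<longleftrightarrow> (\<forall>A\<in>P. Util A (sub A)) \<and>
     (\<forall>v\<in>vertices P. Sep (anc_dims T v \<union> cell v) (below v) (sub ` children T v))"

lemma sub_root_cell:
  assumes "Util B (sub B)" and B: "B \<in> P"
  shows "root_cell (tree_rel T) (sub B) B"
  unfolding root_cell_def
proof (intro conjI)
  show "B \<noteq> {}" "B \<subseteq> sub B" using cell_ne[OF B] cell_sub by simp_all
  show "Util B (sub B)" by (rule assms(1))
  show "Restr (tree_rel T) (sub B) = B \<times> sub B \<union> Restr (tree_rel T) (sub B - B)"
  proof (intro equalityI subsetI)
    fix x assume x: "x \<in> Restr (tree_rel T) (sub B)"
    obtain i j where ij: "x = (i, j)" by (cases x)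
    then have h: "(i, j) \<in> tree_rel T" "i \<in> sub B" "j \<in> sub B" using x by auto
    show "x \<in> B \<times> sub B \<union> Restr (tree_rel T) (sub B - B)"
    proof (cases "i \<in> B")
      case True
      then show ?thesis using h ij by simp
    next
      case False
      have "j \<notin> B"
      proof
        assume j: "j \<in> B"
        then have "(j, i) \<in> tree_rel T" using sub_iff_rel[OF B j] h by simp
        then show False using cell_eq[OF B j] h(1) False by blast
      qed
      then show ?thesis using h ij False by simp
    qed
  next
    fix x assume x: "x \<in> B \<times> sub B \<union> Restr (tree_rel T) (sub B - B)"
    obtain i j where ij: "x = (i, j)" by (cases x)
    show "x \<in> Restr (tree_rel T) (sub B)"
      using x ij sub_iff_rel[OF B, of i j] cell_sub[of B] by auto
  qed
qed

lemma local_conditions_good: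
  assumes loc: local_conditions
  shows "v \<in> vertices P \<Longrightarrow> good (anc_dims T v \<union> cell v) (below v) (Restr (tree_rel T) (below v))"
proof (induction v rule: wf_induct_rule[OF is_rct_wf[OF rct fin_I]])
  case (1 v)
  have S: "Sep (anc_dims T v \<union> cell v) (below v) (sub ` children T v)"
    using loc 1(2) unfolding local_conditions_def by blast
  show ?case
  proof (rule good.good[OF below_in_I S])
    show "Restr (tree_rel T) (below v) \<subseteq> (\<Union>B\<in>sub ` children T v. B \<times> B)"
    proof
      fix x assume x: "x \<in> Restr (tree_rel T) (below v)"
      obtain i j where ij: "x = (i, j)" by (cases x)
      have "i \<in> below v" using x ij by simp
      then obtain B where B: "(v, Some B) \<in> E" "i \<in> sub B" unfolding below_children using child_iff by blast
      then have "j \<in> sub B" using sub_closed[OF child_cell[OF B(1)] B(2)] x ij by simp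
      then show "x \<in> (\<Union>B\<in>sub ` children T v. B \<times> B)" using B ij child_iff by blast
    qed
    show "\<forall>X\<in>sub ` children T v. \<exists>A. root_cell (Restr (tree_rel T) (below v)) X A \<and>
      good (anc_dims T v \<union> cell v \<union> A) (X - A) (Restr (Restr (tree_rel T) (below v)) (X - A))"
    proof
      fix X assume "X \<in> sub ` children T v"
      then obtain B where B: "(v, Some B) \<in> E" "X = sub B" using child_iff by blast
      have BP: "B \<in> P" by (rule child_cell[OF B(1)])
      have Xb: "X \<subseteq> below v" unfolding below_children B(2) using B(1) child_iff by blast
      have U: "Util B (sub B)" using loc BP unfolding local_conditions_def by blast
      have "root_cell (Restr (tree_rel T) (below v)) X B"
        using sub_root_cell[OF U BP] root_cell_Restr[OF Xb] B(2) by simp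
      moreover have "good (anc_dims T (Some B) \<union> cell (Some B)) (below (Some B)) (Restr (tree_rel T) (below (Some B)))"
        by (rule 1(1)) (use B BP in \<open>auto simp: vertices_def\<close>)
      then have "good (anc_dims T v \<union> cell v \<union> B) (X - B) (Restr (tree_rel T) (X - B))"
        unfolding anc_child[OF B(1)] cell_simps below_sub[OF BP] B(2) .
      moreover have "X - B \<subseteq> below v" using Xb by blast
      ultimately show "\<exists>A. root_cell (Restr (tree_rel T) (below v)) X A \<and>
        good (anc_dims T v \<union> cell v \<union> A) (X - A) (Restr (Restr (tree_rel T) (below v)) (X - A))"
        by (intro exI[of _ B] conjI) (simp_all only: Restr_Restr)
    qed
  qed
qed

text \<open>The partition and the root cells behind \<open>good\<close> are not part of its
  arguments. They are forced: a root cell consists of the topmost dimensions of its block, so it is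
  a child of \<open>v\<close> and the block is the subtree of that child.\<close>

lemma good_step:
  assumes g: "good K (below v) (Restr (tree_rel T) (below v))"
  shows "Sep K (below v) (sub ` children T v)"
    and "(v, Some B) \<in> E \<Longrightarrow> Util B (sub B) \<and>
      good (K \<union> B) (below (Some B)) (Restr (tree_rel T) (below (Some B)))"
proof -
  let ?S = "below v" and ?R = "Restr (tree_rel T) (below v)"
  obtain \<R> where R: "Sep K ?S \<R>" "?R \<subseteq> (\<Union>X\<in>\<R>. X \<times> X)"
    "\<forall>X\<in>\<R>. \<exists>A. root_cell ?R X A \<and> good (K \<union> A) (X - A) (Restr ?R (X - A))"
    using g by (rule good.cases) blast
  note part = Sep_partition[OF R(1)]
  have key: "\<exists>B. (v, Some B) \<in> E \<and> X = sub B \<and> A = B"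
    if X: "X \<in> \<R>" and A: "root_cell ?R X A" for X A
  proof -
    note hA = root_cellD[OF A]
    have XS: "X \<subseteq> ?S" by (rule partition_subset[OF part X])
    have same: "y \<in> X" if h: "(x, y) \<in> ?R \<or> (y, x) \<in> ?R" "x \<in> X" for x y
    proof -
      obtain Y where Y: "Y \<in> \<R>" "x \<in> Y" "y \<in> Y" using h(1) R(2) by blast
      then show ?thesis using partition_eq[OF part Y(1) X Y(2) h(2)] by simp
    qed
    \<comment> \<open>No dimension outside \<open>A\<close> lies above \<open>j\<close>, so the
      child cell above \<open>j\<close> meets \<open>A\<close>; then \<open>j\<close> lies above
      that cell in turn and belongs to it.\<close>
    have top: "\<exists>B. (v, Some B) \<in> E \<and> j \<in> B" if j: "j \<in> A" for j
    proof -
      have jS: "j \<in> ?S" using j hA(2) XS by blast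
      then obtain B where B: "(v, Some B) \<in> E" "j \<in> sub B" unfolding below_children using child_iff by blast
      note BP = child_cell[OF B(1)]
      obtain b where b: "b \<in> B" using cell_ne[OF BP] by blast
      have bj: "(b, j) \<in> tree_rel T" using sub_iff_rel[OF BP b] B(2) by simp
      have bS: "b \<in> ?S" unfolding below_children using B(1) b cell_sub child_iff by blast
      then have bR: "(b, j) \<in> ?R" using bj jS by simp
      have jX: "j \<in> X" using j hA(2) by blast
      have bX: "b \<in> X" using same bR jX by blast
      have bA: "b \<in> A" using root_cell_iff(2)[OF A bX jX _ bR] j by blast
      have "(j, b) \<in> ?R" by (rule root_cell_iff(1)[OF A jX bX j])
      then have "j \<in> B" using cell_eq[OF BP b] bj by blast
      then show ?thesis using B(1) by blast
    qed
    obtain j where j: "j \<in> A" using hA(1) by blast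
    obtain B where B: "(v, Some B) \<in> E" "j \<in> B" using top[OF j] by blast
    note BP = child_cell[OF B(1)]
    have jX: "j \<in> X" using j hA(2) by blast
    have "X = sub B"
    proof (intro equalityI subsetI)
      fix x assume "x \<in> X"
      then have "(j, x) \<in> ?R" by (rule root_cell_iff(1)[OF A jX _ j])
      then show "x \<in> sub B" using sub_iff_rel[OF BP B(2)] by simp
    next
      fix x assume x: "x \<in> sub B"
      then have "(j, x) \<in> tree_rel T" using sub_iff_rel[OF BP B(2)] by simp
      moreover have "x \<in> ?S" unfolding below_children using B(1) x child_iff by blast
      ultimately have "(j, x) \<in> ?R" using jX XS by blast
      then show "x \<in> X" using same jX by blast
    qed
    moreover have "A = B"
    proof (intro equalityI subsetI)
      fix x assume x: "x \<in> A"
      then have xX: "x \<in> X" using hA(2) by blast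
      have "(j, x) \<in> ?R" "(x, j) \<in> ?R"
        by (rule root_cell_iff(1)[OF A jX xX j], rule root_cell_iff(1)[OF A xX jX x])
      then show "x \<in> B" using cell_eq[OF BP B(2)] by blast
    next
      fix x assume x: "x \<in> B"
      then have "(j, x) \<in> tree_rel T" "(x, j) \<in> tree_rel T" using cell_eq[OF BP B(2)] by blast+
      moreover have xX: "x \<in> X" using \<open>X = sub B\<close> x cell_sub by blast
      ultimately have "(x, j) \<in> ?R" using jX XS by blast
      then show "x \<in> A" using root_cell_iff(2)[OF A xX jX] j by blast
    qed
    ultimately show ?thesis using B(1) by blast
  qed
  have ex: "\<exists>X\<in>\<R>. X = sub B \<and> root_cell ?R X B \<and> good (K \<union> B) (X - B) (Restr ?R (X - B))"
    if B: "(v, Some B) \<in> E" for B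
  proof -
    obtain b where b: "b \<in> B" using cell_ne[OF child_cell[OF B]] by blast
    have bs: "b \<in> sub B" using b cell_sub by blast
    then have "b \<in> ?S" unfolding below_children using B child_iff by blast
    then obtain X where X: "X \<in> \<R>" "b \<in> X" using partition_ex[OF part] by blast
    obtain A where A: "root_cell ?R X A" "good (K \<union> A) (X - A) (Restr ?R (X - A))" using bspec[OF R(3) X(1)] by blast
    obtain B' where B': "(v, Some B') \<in> E" "X = sub B'" "A = B'" using key[OF X(1) A(1)] by blast
    have "b \<in> sub B'" using X(2) B'(2) by simp
    then have "B = B'" by (rule siblings_disjoint[OF B B'(1) bs])
    then show ?thesis using X A B' by blast
  qed
  have "\<R> = sub ` children T v"
  proof (intro equalityI subsetI)
    fix X assume X: "X \<in> \<R>"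
    obtain A where "root_cell ?R X A" using bspec[OF R(3) X] by blast
    then obtain B where "(v, Some B) \<in> E" "X = sub B" using key[OF X] by blast
    then show "X \<in> sub ` children T v" using child_iff by blast
  next
    fix X assume "X \<in> sub ` children T v"
    then obtain B where B: "(v, Some B) \<in> E" "X = sub B" using child_iff by blast
    then show "X \<in> \<R>" using ex[OF B(1)] by blast
  qed
  then show "Sep K ?S (sub ` children T v)" using R(1) by simp
  show "Util B (sub B) \<and> good (K \<union> B) (below (Some B)) (Restr (tree_rel T) (below (Some B)))"
    if B: "(v, Some B) \<in> E"
  proof -
    have X: "root_cell ?R (sub B) B" "good (K \<union> B) (sub B - B) (Restr ?R (sub B - B))"
      using ex[OF B] by blast+
    have "sub B \<subseteq> ?S" unfolding below_children using B child_iff by blast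
    then have "sub B - B \<subseteq> ?S" by blast
    then show ?thesis
      using root_cellD(3)[OF X(1)] X(2) unfolding below_sub[OF child_cell[OF B]] by (simp only: Restr_Restr)
  qed
qed

lemma good_local_conditions:
  assumes g: "good {} I (tree_rel T)"
  shows local_conditions
proof -
  have all: "good (anc_dims T v \<union> cell v) (below v) (Restr (tree_rel T) (below v))" if "v \<in> vertices P" for v
    using that
  proof (induction rule: vertex_induct)
    case root
    have "Restr (tree_rel T) I = tree_rel T" using tree_rel_sub by blast
    then show ?case using g by (simp add: anc_None below_None)
  next
    case (child v B)
    show ?case using conjunct2[OF good_step(2)[OF child(3,2)]] unfolding anc_child[OF child(2)] cell_simps .
  qed
  show ?thesis
    unfolding local_conditions_def
  proof (intro conjI ballI)
    show "Sep (anc_dims T v \<union> cell v) (below v) (sub ` children T v)" if "v \<in> vertices P" for v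
      by (rule good_step(1)[OF all[OF that]])
    fix A assume "A \<in> P"
    then obtain v where v: "v \<in> vertices P" "(v, Some A) \<in> E" by (rule parent_ex)
    then show "Util A (sub A)" using good_step(2)[OF all] by blast
  qed
qed

lemma local_conditions_iff: "local_conditions \<longleftrightarrow> good {} I (tree_rel T)"
proof
  assume local_conditions
  from local_conditions_good[OF this, of None]
  have "good {} I (Restr (tree_rel T) I)" by (simp add: vertices_def anc_None below_None)
  moreover have "Restr (tree_rel T) I = tree_rel T" using tree_rel_sub by blast
  ultimately show "good {} I (tree_rel T)" by simp
qed (rule good_local_conditions)

lemma anc_indep:
  assumes loc: local_conditions and A: "A \<in> P"
  shows "indep (sub A) (anc_dims T (Some A))"
proof -
  obtain v where v: "v \<in> vertices P" "(v, Some A) \<in> E" using A by (rule parent_ex)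
  have "Sep (anc_dims T v \<union> cell v) (below v) (sub ` children T v)"
    using loc v(1) unfolding local_conditions_def by blast
  moreover have "sub A \<in> sub ` children T v" using v(2) child_iff by blast
  ultimately show ?thesis unfolding anc_child[OF v(2)] by (rule Sep_indep)
qed

end

section \<open>SMEU representations in terms of full lotteries\<close>

lemma sect_marginal:
  assumes "marginal S p = marginal S q"
  shows "sect S z p = sect S z q"
proof -
  have "override_on z (restrict f S) S = override_on z f S" for f
    by (auto simp: fun_eq_iff override_on_apply)
  then have "sect S z r = map_pmf (\<lambda>f. override_on z f S) (marginal S r)" for r
    by (simp add: sect_def marginal_def map_pmf_comp)
  then show ?thesis using assms by simp
qed

lemma marginal_sub:
  assumes "marginal S p = marginal S q" "C \<subseteq> S"
  shows "marginal C p = marginal C q"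
proof -
  have "marginal C r = marginal C (marginal S r)" for r
    using assms(2) by (simp add: marginal_def map_pmf_comp restrict_restrict Int_absorb1)
  then show ?thesis using assms(1) by metis
qed

lemma marginal_sect: "C \<subseteq> S \<Longrightarrow> marginal C (sect S z p) = marginal C p"
  unfolding marginal_def sect_def map_pmf_comp
  by (rule map_pmf_cong) (auto simp: fun_eq_iff restrict_def override_on_apply)

text \<open>The definitions take the product with the sure context in either order; both orders give
  the same section.\<close>

lemma prod_lottery_sect:
  assumes S: "S \<subseteq> I" and z: "z \<in> PiE I X" "\<forall>i\<in>I - S. z' i = z i" and p: "marginal S p' = marginal S p"
  shows "prod_lottery S p' (I - S) (return_pmf z') = sect S z p"
    and "prod_lottery (I - S) (return_pmf z') S p' = sect S z p"
proof -
  have u: "z i = undefined" if "i \<notin> I" for i using z(1) that by (simp add: PiE_iff extensional_def)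
  have 1: "merge S (I - S) (f, z') = override_on z f S" for f
  proof
    fix i show "merge S (I - S) (f, z') i = override_on z f S i"
      using z(2) u[of i] S by (auto simp: merge_def override_on_apply)
  qed
  have 2: "merge (I - S) S (z', f) = override_on z f S" for f
  proof
    fix i show "merge (I - S) S (z', f) i = override_on z f S i"
      using z(2) u[of i] S by (auto simp: merge_def override_on_apply)
  qed
  have "prod_lottery S p' (I - S) (return_pmf z') = sect S z p'"
    by (simp add: prod_lottery_def pair_return_pmf2 map_pmf_comp 1 sect_def)
  moreover have "prod_lottery (I - S) (return_pmf z') S p' = sect S z p'"
    by (simp add: prod_lottery_def pair_return_pmf1 map_pmf_comp 2 sect_def)
  ultimately show "prod_lottery S p' (I - S) (return_pmf z') = sect S z p"
    "prod_lottery (I - S) (return_pmf z') S p' = sect S z p"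
    using sect_marginal[OF p] by simp_all
qed

lemma restrict_in_PiE: "y \<in> PiE I X \<Longrightarrow> S \<subseteq> I \<Longrightarrow> restrict y S \<in> PiE S X"
  by (auto simp: PiE_iff)

lemma override_in_PiE: "b \<in> PiE I X \<Longrightarrow> y \<in> PiE S X \<Longrightarrow> S \<subseteq> I \<Longrightarrow> override_on b y S \<in> PiE I X"
  by (auto simp: PiE_iff override_on_def extensional_def)

lemma restrict_override: "y \<in> PiE S X \<Longrightarrow> restrict (override_on b y S) S = y"
  by (rule ext) (auto simp: override_on_def PiE_iff extensional_def)

lemma marginal_in_lotteries:
  assumes p: "p \<in> lotteries (PiE I X)" and S: "S \<subseteq> I"
  shows "marginal S p \<in> lotteries (PiE S X)"
proof -
  have "restrict f S \<in> PiE S X" if "f \<in> set_pmf p" for f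
    using restrict_in_PiE[OF lotteriesD(2)[OF p that] S] .
  then show ?thesis using lotteriesD(1)[OF p] unfolding lotteries_def marginal_def by (simp add: image_subset_iff)
qed

lemma lottery_extension:
  assumes "b \<in> PiE I X" "p \<in> lotteries (PiE S X)" "S \<subseteq> I"
  obtains q where "q \<in> lotteries (PiE I X)" "marginal S q = p"
proof
  let ?q = "map_pmf (\<lambda>f. override_on b f S) p"
  show "?q \<in> lotteries (PiE I X)"   proof -
    have "override_on b f S \<in> PiE I X" if "f \<in> set_pmf p" for f
      by (rule override_in_PiE[OF assms(1) lotteriesD(2)[OF assms(2) that] assms(3)])
    then show ?thesis using lotteriesD(1)[OF assms(2)] unfolding lotteries_def by (simp add: image_subset_iff)
  qed
  have "marginal S ?q = map_pmf (\<lambda>f. f) p"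
    unfolding marginal_def map_pmf_comp
    by (rule map_pmf_cong[OF refl]) (rule restrict_override[OF lotteriesD(2)[OF assms(2)]])
  then show "marginal S ?q = p" by simp
qed

lemma marginal_self: "p \<in> lotteries (PiE S X) \<Longrightarrow> marginal S p = p"
proof -
  assume p: "p \<in> lotteries (PiE S X)"
  have "marginal S p = map_pmf (\<lambda>f. f) p"
    unfolding marginal_def
    by (rule map_pmf_cong) (use p in \<open>auto simp: lotteries_def PiE_iff extensional_def restrict_def fun_eq_iff\<close>)
  then show ?thesis by simp
qed

lemma marginal_idem: "marginal S (marginal S p) = marginal S p"
  by (simp add: marginal_def map_pmf_comp)

text \<open>The clauses of \<open>smeu_rep\<close> at one vertex, with \<open>z\<close> and the
  lotteries ranging over full points. Strict monotonicity is spelled out on the coordinates in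
  \<open>S\<close>, since full points may also differ elsewhere.\<close>

definition rep_at where
  "rep_at Z pref T uo u v z \<longleftrightarrow> (let S = subtree_dims T v; U = vertex_utility T uo u v (restrict z (anc_dims T v)) in
     (\<forall>p\<in>lotteries Z. \<forall>q\<in>lotteries Z. pref (sect S z p) (sect S z q) \<longleftrightarrow> U (sect S z p) \<ge> U (sect S z q)) \<and>
     continuous_on Z (\<lambda>y. U (return_pmf (override_on z y S))) \<and>
     (\<forall>y\<in>Z. \<forall>y'\<in>Z. (\<forall>i\<in>S. y i \<le> y' i) \<longrightarrow> (\<exists>i\<in>S. y i < y' i) \<longrightarrow>
        U (return_pmf (override_on z y S)) < U (return_pmf (override_on z y' S))))"

lemma continuous_on_coordinate: "continuous_on A (\<lambda>y :: point. y i)"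
  by (rule continuous_on_subset[OF continuous_on_product_coordinates]) simp

text \<open>Points over a set of dimensions extend to full points by means of \<open>b\<close>, and
  full points restrict; neither operation affects a section, so quantifying over one kind amounts to
  quantifying over the other.\<close>

lemma smeu_rep_iff:
  fixes X :: "nat \<Rightarrow> real set"
  assumes b: "b \<in> PiE I X" and fin: "finite I"
  shows "smeu_rep I X pref T uo u \<longleftrightarrow> is_rct I T \<and>
    (\<forall>v\<in>vertices (fst T). \<forall>z\<in>PiE I X. rep_at (PiE I X) pref T uo u v z)"
proof (cases "is_rct I T")
  case False
  then show ?thesis by (simp add: smeu_rep_def)
next
  case True
  interpret rct I T by unfold_locales (fact True fin)+
  let ?Z = "PiE I X"
  let ?C = "\<lambda>v z. let S = subtree_dims T v; x = restrict z (anc_dims T v) in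
      (\<forall>p\<in>lotteries (PiE S X). \<forall>q\<in>lotteries (PiE S X).
         cond_pref I pref S z p q \<longleftrightarrow>
           vertex_utility T uo u v x (prod_lottery (I - S) (return_pmf z) S p)
           \<ge> vertex_utility T uo u v x (prod_lottery (I - S) (return_pmf z) S q)) \<and>
      continuous_on (PiE S X) (\<lambda>y. vertex_utility T uo u v x (return_pmf (merge (I - S) S (z, y)))) \<and>
      strict_mono_on (PiE S X) (\<lambda>y. vertex_utility T uo u v x (return_pmf (merge (I - S) S (z, y))))"
  have SI: "subtree_dims T v \<subseteq> I" if "v \<in> vertices P" for v
    using that sub_in_I sub_root by (auto simp: vertices_def)
  have aI: "anc_dims T v \<subseteq> I - subtree_dims T v" if "v \<in> vertices P" for v
    using that anc_None anc_disjoint anc_in_I[of v] by (auto simp: vertices_def)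
  \<comment> \<open>\<open>z'\<close> has only to agree with \<open>z\<close> on
    \<open>I - S\<close>, so the equivalence covers restrictions of full points as well as
    extensions of partial ones.\<close>
  have key: "rep_at ?Z pref T uo u v z \<longleftrightarrow> ?C v z'"
    if v: "v \<in> vertices P" and z: "z \<in> ?Z" "\<And>i. i \<in> I - subtree_dims T v \<Longrightarrow> z' i = z i" for v z z'
  proof -
    let ?S = "subtree_dims T v"
    let ?U = "vertex_utility T uo u v (restrict z (anc_dims T v))"
    have S: "?S \<subseteq> I" by (rule SI[OF v])
    have x: "restrict z' (anc_dims T v) = restrict z (anc_dims T v)"
      using aI[OF v] z(2) by (auto simp: restrict_def fun_eq_iff)
    have z2: "\<forall>i\<in>I - ?S. z' i = z i" using z(2) by blast
    note PL = prod_lottery_sect[OF S z(1) z2]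
    have m: "merge (I - ?S) ?S (z', y') = override_on z y ?S" if "\<And>i. i \<in> ?S \<Longrightarrow> y' i = y i" for y y'
    proof
      fix i show "merge (I - ?S) ?S (z', y') i = override_on z y ?S i"
        using z(2)[of i] that[of i] S z(1) by (auto simp: merge_def override_on_apply PiE_iff extensional_def)
    qed
    have pref: "(\<forall>p\<in>lotteries ?Z. \<forall>q\<in>lotteries ?Z. pref (sect ?S z p) (sect ?S z q) \<longleftrightarrow> ?U (sect ?S z p) \<ge> ?U (sect ?S z q))
      \<longleftrightarrow> (\<forall>p\<in>lotteries (PiE ?S X). \<forall>q\<in>lotteries (PiE ?S X).
         cond_pref I pref ?S z' p q \<longleftrightarrow> ?U (prod_lottery (I - ?S) (return_pmf z') ?S p)
           \<ge> ?U (prod_lottery (I - ?S) (return_pmf z') ?S q))" (is "?l \<longleftrightarrow> ?r")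
    proof
      assume l: ?l
      show ?r
      proof (intro ballI)
        fix p q assume p: "p \<in> lotteries (PiE ?S X)" and q: "q \<in> lotteries (PiE ?S X)"
        obtain p' where p': "p' \<in> lotteries ?Z" "marginal ?S p' = p" by (rule lottery_extension[OF b p S])
        obtain q' where q': "q' \<in> lotteries ?Z" "marginal ?S q' = q" by (rule lottery_extension[OF b q S])
        have e: "marginal ?S p = marginal ?S p'" "marginal ?S q = marginal ?S q'"
          using p'(2) q'(2) marginal_self[OF p] marginal_self[OF q] by simp_all
        show "cond_pref I pref ?S z' p q \<longleftrightarrow> ?U (prod_lottery (I - ?S) (return_pmf z') ?S p)
           \<ge> ?U (prod_lottery (I - ?S) (return_pmf z') ?S q)"
          unfolding cond_pref_def PL(1)[OF e(1)] PL(1)[OF e(2)] PL(2)[OF e(1)] PL(2)[OF e(2)]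
          using bspec[OF bspec[OF l p'(1)] q'(1)] .
      qed
    next
      assume r: ?r
      show ?l
      proof (intro ballI)
        fix p q assume p: "p \<in> lotteries ?Z" and q: "q \<in> lotteries ?Z"
        note i = marginal_idem[of ?S p] marginal_idem[of ?S q]
        show "pref (sect ?S z p) (sect ?S z q) \<longleftrightarrow> ?U (sect ?S z p) \<ge> ?U (sect ?S z q)"
          using bspec[OF bspec[OF r marginal_in_lotteries[OF p S]] marginal_in_lotteries[OF q S]]
          unfolding cond_pref_def PL(1)[OF i(1)] PL(1)[OF i(2)] PL(2)[OF i(1)] PL(2)[OF i(2)] .
      qed
    qed
    have cont: "continuous_on ?Z (\<lambda>y. ?U (return_pmf (override_on z y ?S))) \<longleftrightarrow>
      continuous_on (PiE ?S X) (\<lambda>y. ?U (return_pmf (merge (I - ?S) ?S (z', y))))" (is "?l \<longleftrightarrow> ?r")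
    proof
      assume l: ?l
      have "continuous_on (PiE ?S X) (\<lambda>y. override_on b y ?S)"
      proof (rule continuous_on_coordinatewise_then_product)
        fix i show "continuous_on (PiE ?S X) (\<lambda>y. override_on b y ?S i)"
          by (cases "i \<in> ?S") (auto intro: continuous_on_coordinate)
      qed
      then have "continuous_on (PiE ?S X) (\<lambda>y. ?U (return_pmf (override_on z (override_on b y ?S) ?S)))"
        by (rule continuous_on_compose2[OF l]) (unfold image_subset_iff, intro ballI override_in_PiE[OF b _ S])
      moreover have "merge (I - ?S) ?S (z', y) = override_on z (override_on b y ?S) ?S" for y
        by (rule m) simp
      ultimately show ?r by simp
    next
      assume r: ?r
      have "continuous_on ?Z (\<lambda>y. restrict y ?S)"
      proof (rule continuous_on_coordinatewise_then_product)
        fix i show "continuous_on ?Z (\<lambda>y. restrict y ?S i)"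
          by (cases "i \<in> ?S") (auto intro: continuous_on_coordinate)
      qed
      then have "continuous_on ?Z (\<lambda>y. ?U (return_pmf (merge (I - ?S) ?S (z', restrict y ?S))))"
        by (rule continuous_on_compose2[OF r]) (unfold image_subset_iff, intro ballI restrict_in_PiE[OF _ S])
      moreover have "merge (I - ?S) ?S (z', restrict y ?S) = override_on z y ?S" for y
        by (rule m) simp
      ultimately show ?l by simp
    qed
    have mono: "(\<forall>y\<in>?Z. \<forall>y'\<in>?Z. (\<forall>i\<in>?S. y i \<le> y' i) \<longrightarrow> (\<exists>i\<in>?S. y i < y' i) \<longrightarrow>
        ?U (return_pmf (override_on z y ?S)) < ?U (return_pmf (override_on z y' ?S))) \<longleftrightarrow>
      strict_mono_on (PiE ?S X) (\<lambda>y. ?U (return_pmf (merge (I - ?S) ?S (z', y))))" (is "?l \<longleftrightarrow> ?r")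
    proof
      assume l: ?l
      show ?r
      proof (rule strict_mono_onI)
        fix y y' assume y: "y \<in> PiE ?S X" "y' \<in> PiE ?S X" "y < y'"
        let ?y = "override_on b y ?S" and ?y' = "override_on b y' ?S"
        have yZ: "?y \<in> ?Z" "?y' \<in> ?Z" using override_in_PiE[OF b _ S] y by simp_all
        have le: "\<forall>i\<in>?S. ?y i \<le> ?y' i" using y(3) by (auto simp: less_fun_def le_fun_def)
        have "\<exists>i\<in>?S. ?y i < ?y' i"
        proof -
          obtain i where i: "y i < y' i" using y(3) by (auto simp: less_fun_def le_fun_def not_le)
          then have "i \<in> ?S" using y(1,2) by (cases "i \<in> ?S") (auto simp: PiE_iff extensional_def)
          then show ?thesis using i by auto
        qed
        then have "?U (return_pmf (override_on z ?y ?S)) < ?U (return_pmf (override_on z ?y' ?S))"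
          using bspec[OF bspec[OF l yZ(1)] yZ(2)] le by blast
        moreover have "merge (I - ?S) ?S (z', y) = override_on z ?y ?S" by (rule m) simp
        moreover have "merge (I - ?S) ?S (z', y') = override_on z ?y' ?S" by (rule m) simp
        ultimately show "?U (return_pmf (merge (I - ?S) ?S (z', y))) < ?U (return_pmf (merge (I - ?S) ?S (z', y')))"
          by simp
      qed
    next
      assume r: ?r
      show ?l
      proof (intro ballI impI)
        fix y y' assume y: "y \<in> ?Z" "y' \<in> ?Z" and le: "\<forall>i\<in>?S. y i \<le> y' i" and lt: "\<exists>i\<in>?S. y i < y' i"
        let ?y = "restrict y ?S" and ?y' = "restrict y' ?S"
        have "?y \<le> ?y'" using le by (auto simp: le_fun_def)
        moreover have "\<not> ?y' \<le> ?y" using lt by (auto simp: le_fun_def not_le)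
        ultimately have "?y < ?y'" by (simp add: less_fun_def)
        then have "?U (return_pmf (merge (I - ?S) ?S (z', ?y))) < ?U (return_pmf (merge (I - ?S) ?S (z', ?y')))"
          using strict_mono_onD[OF r] restrict_in_PiE[OF _ S] y by blast
        moreover have "merge (I - ?S) ?S (z', ?y) = override_on z y ?S" by (rule m) simp
        moreover have "merge (I - ?S) ?S (z', ?y') = override_on z y' ?S" by (rule m) simp
        ultimately show "?U (return_pmf (override_on z y ?S)) < ?U (return_pmf (override_on z y' ?S))" by simp
      qed
    qed
    show ?thesis unfolding rep_at_def Let_def x pref cont mono ..
  qed
  have "smeu_rep I X pref T uo u \<longleftrightarrow>
    (\<forall>v\<in>vertices P. \<forall>z\<in>PiE (I - subtree_dims T v) X. ?C v z)" (is "_ \<longleftrightarrow> ?m")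
  proof -
    have e: "restrict z (anc_dims T v) \<in> PiE (anc_dims T v) X"
      if "v \<in> vertices P" "z \<in> PiE (I - subtree_dims T v) X" for v z
      using restrict_in_PiE[OF that(2) aI[OF that(1)]] .
    show ?thesis
    proof
      assume s: "smeu_rep I X pref T uo u"
      show ?m
      proof (intro ballI)
        fix v z assume vz: "v \<in> vertices P" "z \<in> PiE (I - subtree_dims T v) X"
        have "\<forall>v\<in>vertices P. let S = subtree_dims T v in
          \<forall>x\<in>PiE (anc_dims T v) X. \<forall>z\<in>PiE (I - S) X. restrict z (anc_dims T v) = x \<longrightarrow>
          (\<forall>p\<in>lotteries (PiE S X). \<forall>q\<in>lotteries (PiE S X).
             cond_pref I pref S z p q \<longleftrightarrow>
               vertex_utility T uo u v x (prod_lottery (I - S) (return_pmf z) S p)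
               \<ge> vertex_utility T uo u v x (prod_lottery (I - S) (return_pmf z) S q)) \<and>
          continuous_on (PiE S X)
            (\<lambda>y. vertex_utility T uo u v x (return_pmf (merge (I - S) S (z, y)))) \<and>
          strict_mono_on (PiE S X)
            (\<lambda>y. vertex_utility T uo u v x (return_pmf (merge (I - S) S (z, y))))"
          using s[unfolded smeu_rep_def] by (rule conjunct2)
        note h = bspec[OF this vz(1), unfolded Let_def]
        show "?C v z" unfolding Let_def by (rule mp[OF bspec[OF bspec[OF h e[OF vz]] vz(2)] refl])
      qed
    next
      assume m: ?m
      show "smeu_rep I X pref T uo u"
        unfolding smeu_rep_def Let_def
      proof (rule conjI[OF True], intro ballI impI)
        fix v x z assume h: "v \<in> vertices P" "z \<in> PiE (I - subtree_dims T v) X" and x: "restrict z (anc_dims T v) = x"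
        show "(\<forall>p\<in>lotteries (PiE (subtree_dims T v) X). \<forall>q\<in>lotteries (PiE (subtree_dims T v) X).
             cond_pref I pref (subtree_dims T v) z p q \<longleftrightarrow>
               vertex_utility T uo u v x (prod_lottery (I - subtree_dims T v) (return_pmf z) (subtree_dims T v) p)
               \<ge> vertex_utility T uo u v x (prod_lottery (I - subtree_dims T v) (return_pmf z) (subtree_dims T v) q)) \<and>
          continuous_on (PiE (subtree_dims T v) X)
            (\<lambda>y. vertex_utility T uo u v x (return_pmf (merge (I - subtree_dims T v) (subtree_dims T v) (z, y)))) \<and>
          strict_mono_on (PiE (subtree_dims T v) X)
            (\<lambda>y. vertex_utility T uo u v x (return_pmf (merge (I - subtree_dims T v) (subtree_dims T v) (z, y))))"
          using bspec[OF bspec[OF m h(1)] h(2)] unfolding Let_def x .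
      qed
    qed
  qed
  also have "\<dots> \<longleftrightarrow> (\<forall>v\<in>vertices P. \<forall>z\<in>?Z. rep_at ?Z pref T uo u v z)"
  proof (rule ball_cong[OF refl])
    fix v assume v: "v \<in> vertices P"
    have S: "I - subtree_dims T v \<subseteq> I" by blast
    show "(\<forall>z\<in>PiE (I - subtree_dims T v) X. ?C v z) \<longleftrightarrow> (\<forall>z\<in>?Z. rep_at ?Z pref T uo u v z)"
    proof (intro iffI ballI)
      fix z assume l: "\<forall>z\<in>PiE (I - subtree_dims T v) X. ?C v z" and z: "z \<in> ?Z"
      have "rep_at ?Z pref T uo u v z \<longleftrightarrow> ?C v (restrict z (I - subtree_dims T v))"
        by (rule key[OF v z]) simp
      then show "rep_at ?Z pref T uo u v z" by (rule iffD2) (rule bspec[OF l restrict_in_PiE[OF z S]])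
    next
      fix z' assume r: "\<forall>z\<in>?Z. rep_at ?Z pref T uo u v z" and z': "z' \<in> PiE (I - subtree_dims T v) X"
      let ?z = "override_on b z' (I - subtree_dims T v)"
      have z: "?z \<in> ?Z" by (rule override_in_PiE[OF b z' S])
      have "rep_at ?Z pref T uo u v ?z \<longleftrightarrow> ?C v z'" by (rule key[OF v z]) simp
      then show "?C v z'" by (rule iffD1) (rule bspec[OF r z])
    qed
  qed
  finally have "smeu_rep I X pref T uo u \<longleftrightarrow> (\<forall>v\<in>vertices P. \<forall>z\<in>?Z. rep_at ?Z pref T uo u v z)" .
  then show ?thesis unfolding eqTrueI[OF True] simp_thms .
qed

section \<open>Recursive utilities\<close>

text \<open>On the supports, \<open>F\<close> factors through \<open>a\<close> and \<open>G\<close>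
  through \<open>b\<close>, by one and the same function \<open>k\<close>, because the two images
  coincide.\<close>

lemma expectation_transfer:
  fixes F G :: "_ \<Rightarrow> real"
  assumes m: "map_pmf a p = map_pmf b q"
    and FG: "\<And>g g'. g \<in> set_pmf p \<Longrightarrow> g' \<in> set_pmf q \<Longrightarrow> a g = b g' \<Longrightarrow> F g = G g'"
  shows "measure_pmf.expectation p F = measure_pmf.expectation q G"
proof -
  define k where "k y = (SOME v. \<exists>g'\<in>set_pmf q. b g' = y \<and> v = G g')" for y
  have s: "a ` set_pmf p = b ` set_pmf q" using arg_cong[OF m, of set_pmf] by simp
  have F: "F g = k (a g)" if g: "g \<in> set_pmf p" for g
  proof -
    obtain g' where "g' \<in> set_pmf q" "b g' = a g" using s g by (metis imageE imageI)
    then have "\<exists>v. \<exists>g'\<in>set_pmf q. b g' = a g \<and> v = G g'" by blast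
    from someI_ex[OF this] obtain g'' where "g'' \<in> set_pmf q" "b g'' = a g" "k (a g) = G g''"
      unfolding k_def by blast
    then show ?thesis using FG[OF g] by simp
  qed
  have G: "G g' = k (b g')" if g': "g' \<in> set_pmf q" for g'
  proof -
    obtain g where "g \<in> set_pmf p" "a g = b g'" using s g' by (metis imageE imageI)
    then show ?thesis using F FG[OF _ g'] by metis
  qed
  have "measure_pmf.expectation p F = measure_pmf.expectation (map_pmf a p) k"
    by (simp add: F cong: expectation_cong)
  also have "\<dots> = measure_pmf.expectation (map_pmf b q) k" by (simp only: m)
  also have "\<dots> = measure_pmf.expectation q G"
    by (simp add: G cong: expectation_cong)
  finally show ?thesis .
qed

lemma pmf_ex: "\<exists>f. f \<in> set_pmf p"
  using set_pmf_not_empty[of p] by auto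

lemma restrict_eq_cyl: "{h. restrict h M = restrict f M} = cyl M f"
  by (auto simp: cyl_def restrict_def fun_eq_iff)

lemma cond_cyl_Un:
  assumes "f \<in> set_pmf p" "g \<in> set_pmf p" "g \<in> cyl M f"
  shows "cond_pmf (cond_pmf p (cyl M f)) (cyl A g) = cond_pmf p (cyl (M \<union> A) g)"
proof -
  have "cyl M f \<inter> cyl A g = cyl (M \<union> A) g" using assms(3) by (auto simp: cyl_def)
  moreover have "set_pmf p \<inter> cyl M f \<inter> cyl A g \<noteq> {}" using assms(2,3) self_in_cyl by blast
  ultimately show ?thesis by (simp add: cond_cond_pmf)
qed

lemma marginal_cond:
  assumes A: "A \<subseteq> S" and m: "marginal S p = marginal S q" and g: "g \<in> set_pmf p" "g' \<in> set_pmf q"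
    and e: "\<And>i. i \<in> A \<Longrightarrow> g i = g' i"
  shows "marginal S (cond_pmf p (cyl A g)) = marginal S (cond_pmf q (cyl A g'))"
proof -
  have v: "(\<lambda>f. restrict f S) -` cyl A h = cyl A h" for h using A by (auto simp: cyl_def)
  have mc: "marginal S (cond_pmf r (cyl A h)) = cond_pmf (marginal S r) (cyl A h)" if "h \<in> set_pmf r" for r h
    unfolding marginal_def using that self_in_cyl by (subst cond_map_pmf) (auto simp: v)
  have c: "cyl A g = cyl A g'" using e by (auto simp: cyl_def)
  show ?thesis by (subst mc[OF g(1)], subst mc[OF g(2)]) (simp only: m c)
qed

lemma set_sect: "set_pmf (sect S z p) = (\<lambda>f. override_on z f S) ` set_pmf p"
  by (simp add: sect_def)

lemma sect_cond:
  assumes "A \<subseteq> S" "h \<in> set_pmf p"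
  shows "sect S z (cond_pmf p (cyl A h)) = cond_pmf (sect S z p) (cyl A (override_on z h S))"
proof -
  have "(\<lambda>f. override_on z f S) -` cyl A (override_on z h S) = cyl A h"
    using assms(1) by (auto simp: cyl_def override_on_apply)
  then show ?thesis unfolding sect_def
    by (subst cond_map_pmf) (use assms(2) self_in_cyl in auto)
qed

lemma cond_sect_self:
  assumes "M \<inter> S = {}" "f \<in> set_pmf (sect S z p)"
  shows "cond_pmf (sect S z p) (cyl M f) = sect S z p"
proof (rule cond_pmf_eq_self, rule subsetI)
  fix g assume "g \<in> set_pmf (sect S z p)"
  then show "g \<in> cyl M f" using assms by (auto simp: cyl_def set_sect override_on_apply)
qed

lemma sect_off: "f \<in> set_pmf (sect S z p) \<Longrightarrow> i \<notin> S \<Longrightarrow> f i = z i"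
  by (auto simp: set_sect override_on_apply)

context rct
begin

abbreviation anc :: "nat set \<Rightarrow> nat set" where "anc A \<equiv> anc_dims T (Some A)"

text \<open>The context is passed as a full point, of which only the coordinates of the ancestors
  are read. A child can then be evaluated at the very point drawn for its parent.\<close>

definition Nu :: "aggregators \<Rightarrow> nat set \<Rightarrow> point \<Rightarrow> point pmf \<Rightarrow> real" where
  "Nu u A f p = utility T u p A (restrict f (anc A))"

lemma child_iff': "B \<in> children T (Some A) \<longleftrightarrow> (Some A, Some B) \<in> E"
  by (rule child_iff)

lemma anc_child': "(Some A, Some B) \<in> E \<Longrightarrow> anc B = anc A \<union> A"
  using anc_child[of "Some A" B] by simp

lemma sub_child: "(Some A, Some B) \<in> E \<Longrightarrow> sub B \<subseteq> sub A - A"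
  using below_children[of "Some A"] below_sub[of A] child_iff[of B "Some A"] E_vertices
  by (fastforce simp: vertices_def)

lemma cell_wf: "wf {(B, A). (Some A, Some B) \<in> E}"
  using wf_inv_image[OF is_rct_wf[OF rct fin_I], of Some] by (simp add: inv_image_def)

lemma utility_step:
  assumes f: "f \<in> set_pmf p"
  shows "Nu u A f p = measure_pmf.expectation (cond_pmf p (cyl (anc A) f))
    (\<lambda>g. u A (restrict f (anc A)) (restrict g A) (\<lambda>B\<in>children T (Some A). Nu u B g p))"
proof -
  have "restrict f (anc A) \<in> set_pmf (marginal (anc A) p)" using f by (auto simp: marginal_def)
  then have "Nu u A f p = measure_pmf.expectation (cond_pmf p (cyl (anc A) f))
    (\<lambda>g. u A (restrict f (anc A)) (restrict g A)
       (\<lambda>B\<in>children T (Some A). utility T u p B (merge (anc A) A (restrict f (anc A), restrict g A))))"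
    unfolding Nu_def by (subst utility_rec[OF rct fin_I]) (simp add: cond_marginal_def marginal_def restrict_eq_cyl)
  also have "\<dots> = measure_pmf.expectation (cond_pmf p (cyl (anc A) f))
    (\<lambda>g. u A (restrict f (anc A)) (restrict g A) (\<lambda>B\<in>children T (Some A). Nu u B g p))"
  proof (rule expectation_cong)
    fix g assume "g \<in> set_pmf (cond_pmf p (cyl (anc A) f))"
    then have g: "g \<in> cyl (anc A) f" using f by simp
    have m: "merge (anc A) A (restrict f (anc A), restrict g A) = restrict g (anc B)"
      if B: "(Some A, Some B) \<in> E" for B
      unfolding anc_child'[OF B] using g by (auto simp: cyl_def merge_def restrict_def fun_eq_iff)
    have "(\<lambda>B\<in>children T (Some A). utility T u p B (merge (anc A) A (restrict f (anc A), restrict g A)))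
        = (\<lambda>B\<in>children T (Some A). Nu u B g p)"
      by (rule restrict_ext) (simp only: child_iff' m Nu_def)
    then show "u A (restrict f (anc A)) (restrict g A)
       (\<lambda>B\<in>children T (Some A). utility T u p B (merge (anc A) A (restrict f (anc A), restrict g A))) =
      u A (restrict f (anc A)) (restrict g A) (\<lambda>B\<in>children T (Some A). Nu u B g p)" by simp
  qed
  finally show ?thesis .
qed

text \<open>The utility of a cell sees the lottery only through the conditional marginal on its
  subtree. Equal marginals stay equal after further conditioning on \<open>A\<close>, which carries
  the claim down to the children.\<close>

lemma Nu_cong:
  assumes "f \<in> set_pmf p" "f' \<in> set_pmf q" "\<And>i. i \<in> anc A \<Longrightarrow> f i = f' i"
    and "marginal (sub A) (cond_pmf p (cyl (anc A) f)) = marginal (sub A) (cond_pmf q (cyl (anc A) f'))"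
  shows "Nu u A f p = Nu u A f' q"
  using assms
proof (induction A arbitrary: f f' rule: wf_induct_rule[OF cell_wf])
  case (1 A)
  let ?p = "cond_pmf p (cyl (anc A) f)" and ?q = "cond_pmf q (cyl (anc A) f')"
  have rf: "restrict f (anc A) = restrict f' (anc A)" by (rule restrict_ext) (rule 1(4))
  show ?case
    unfolding utility_step[OF 1(2)] utility_step[OF 1(3)] rf
  proof (rule expectation_transfer)
    show "map_pmf (\<lambda>g. restrict g A) ?p = map_pmf (\<lambda>g. restrict g A) ?q"
      using marginal_sub[OF 1(5) cell_sub] by (simp add: marginal_def)
    fix g g' assume g: "g \<in> set_pmf ?p" "g' \<in> set_pmf ?q" and e: "restrict g A = restrict g' A"
    have gp: "g \<in> set_pmf p" "g \<in> cyl (anc A) f" and gq: "g' \<in> set_pmf q" "g' \<in> cyl (anc A) f'"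
      using g 1(2,3) by auto
    have eA: "g i = g' i" if "i \<in> A" for i using fun_cong[OF e, of i] that by simp
    have nB: "Nu u B g p = Nu u B g' q" if B: "(Some A, Some B) \<in> E" for B
    proof (rule 1(1))
      show "(B, A) \<in> {(B, A). (Some A, Some B) \<in> E}" using B by simp
      show "g \<in> set_pmf p" "g' \<in> set_pmf q" by (fact gp gq)+
      show "g i = g' i" if "i \<in> anc B" for i
        using that gp(2) gq(2) eA 1(4) unfolding anc_child'[OF B] by (auto simp: cyl_def)
      have "marginal (sub A) (cond_pmf ?p (cyl A g)) = marginal (sub A) (cond_pmf ?q (cyl A g'))"
        by (rule marginal_cond[OF cell_sub 1(5) g eA])
      then have "marginal (sub A) (cond_pmf p (cyl (anc B) g)) = marginal (sub A) (cond_pmf q (cyl (anc B) g'))"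
        by (simp only: cond_cyl_Un[OF 1(2) gp] cond_cyl_Un[OF 1(3) gq] anc_child'[OF B])
      then show "marginal (sub B) (cond_pmf p (cyl (anc B) g)) = marginal (sub B) (cond_pmf q (cyl (anc B) g'))"
        by (rule marginal_sub) (use sub_child[OF B] in blast)
    qed
    have "(\<lambda>B\<in>children T (Some A). Nu u B g p) = (\<lambda>B\<in>children T (Some A). Nu u B g' q)"
      by (rule restrict_ext) (simp only: child_iff' nB)
    then show "u A (restrict f' (anc A)) (restrict g A) (\<lambda>B\<in>children T (Some A). Nu u B g p) =
      u A (restrict f' (anc A)) (restrict g' A) (\<lambda>B\<in>children T (Some A). Nu u B g' q)"
      by (simp only: e)
  qed
qed

lemma utility_sect:
  assumes "anc A \<inter> C = {}" "f \<in> set_pmf (sect C z p)"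
  shows "utility T u (sect C z p) A (restrict z (anc A)) = Nu u A f (sect C z p)"
proof -
  have "restrict z (anc A) = restrict f (anc A)"
  proof (rule restrict_ext)
    fix i assume "i \<in> anc A"
    then have "i \<notin> C" using assms(1) by blast
    then show "z i = f i" using sect_off[OF assms(2)] by simp
  qed
  then show ?thesis by (simp add: Nu_def)
qed

lemma utility_sect_cong:
  assumes C: "anc A \<inter> C = {}" "anc A \<inter> C' = {}" and z: "\<And>i. i \<in> anc A \<Longrightarrow> z i = z' i"
    and m: "marginal (sub A) (sect C z p) = marginal (sub A) (sect C' z' q)"
  shows "utility T u (sect C z p) A (restrict z (anc A)) = utility T u (sect C' z' q) A (restrict z' (anc A))"
proof -
  obtain f where f: "f \<in> set_pmf (sect C z p)" using pmf_ex[of "(sect C z p)"] by blast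
  obtain f' where f': "f' \<in> set_pmf (sect C' z' q)" using pmf_ex[of "(sect C' z' q)"] by blast
  have "f i = f' i" if "i \<in> anc A" for i
  proof -
    have "i \<notin> C" "i \<notin> C'" using that C by blast+
    then show ?thesis using sect_off[OF f] sect_off[OF f'] z[OF that] by simp
  qed
  then have "Nu u A f (sect C z p) = Nu u A f' (sect C' z' q)"
    by (rule Nu_cong[OF f f']) (simp_all only: cond_sect_self[OF C(1) f] cond_sect_self[OF C(2) f'] m)
  then show ?thesis by (simp only: utility_sect[OF C(1) f] utility_sect[OF C(2) f'])
qed

end

section \<open>From a representation to the conditions on its tree\<close>

context rct_pref
begin

abbreviation dims :: "vertex \<Rightarrow> nat set" where "dims v \<equiv> subtree_dims T v"

lemma anc_sub: "A \<in> P \<Longrightarrow> anc A \<inter> sub A = {}"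
  by (rule anc_disjoint)

lemma rep_at_order:
  assumes pref: "\<And>p q. p \<in> L \<Longrightarrow> q \<in> L \<Longrightarrow> pref p q \<longleftrightarrow> W q \<le> W p"
    and rep: "rep_at Z pref T uo u v z" and z: "z \<in> Z" "p \<in> L" "q \<in> L"
  shows "W (sect (dims v) z p) \<le> W (sect (dims v) z q) \<longleftrightarrow>
    vertex_utility T uo u v (restrict z (anc_dims T v)) (sect (dims v) z p) \<le>
    vertex_utility T uo u v (restrict z (anc_dims T v)) (sect (dims v) z q)"
proof -
  have "pref (sect (dims v) z q) (sect (dims v) z p) \<longleftrightarrow>
    vertex_utility T uo u v (restrict z (anc_dims T v)) (sect (dims v) z p) \<le>
    vertex_utility T uo u v (restrict z (anc_dims T v)) (sect (dims v) z q)"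
    using rep[unfolded rep_at_def Let_def, THEN conjunct1, THEN bspec[OF _ z(3)], THEN bspec[OF _ z(2)]] .
  then show ?thesis using pref[OF sect_in_L[OF z(1,3)] sect_in_L[OF z(1,2)], of "dims v" "dims v"] by blast
qed

lemma rep_repr:
  assumes pref: "\<And>p q. p \<in> L \<Longrightarrow> q \<in> L \<Longrightarrow> pref p q \<longleftrightarrow> W q \<le> W p"
    and rep: "rep_at Z pref T uo u (Some A) z" and z: "z \<in> Z"
  shows "repr (sub A) z (\<lambda>p. utility T u (sect (sub A) z p) A (restrict z (anc A)))"
  unfolding repr_def
proof (intro conjI ballI)
  fix p q assume p: "p \<in> L" and q: "q \<in> L"
  have "W (sect (sub A) z p) \<le> W (sect (sub A) z q) \<longleftrightarrow>
    vertex_utility T uo u (Some A) (restrict z (anc A)) (sect (sub A) z p) \<le>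
    vertex_utility T uo u (Some A) (restrict z (anc A)) (sect (sub A) z q)"
    by (rule rep_at_order[OF pref rep z p q])
  then show "utility T u (sect (sub A) z p) A (restrict z (anc A)) \<le> utility T u (sect (sub A) z q) A (restrict z (anc A))
      \<longleftrightarrow> W (sect (sub A) z p) \<le> W (sect (sub A) z q)"
    unfolding vertex_utility_def option.case by (rule sym)
next
  have "continuous_on Z (\<lambda>y. vertex_utility T uo u (Some A) (restrict z (anc A)) (return_pmf (override_on z y (sub A))))"
    using rep unfolding rep_at_def Let_def by (elim conjE)
  then show "continuous_on Z (\<lambda>y. utility T u (sect (sub A) z (return_pmf y)) A (restrict z (anc A)))"
    unfolding vertex_utility_def option.case sect_return .
qed

text \<open>Conditioning on the coordinates in \<open>A\<close> makes the integrand of the recursion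
  constant, and it leaves the children alone because they condition on \<open>A\<close>
  anyway.\<close>

lemma utility_condaff:
  assumes A: "A \<in> P"
  shows "condaff L A (\<lambda>p. utility T u (sect (sub A) z p) A (restrict z (anc A)))"
  unfolding condaff_def
proof
  fix p assume p: "p \<in> L"
  let ?S = "sub A" and ?M = "anc A"
  let ?p = "sect ?S z p"
  let ?\<Phi> = "\<lambda>g. u A (restrict z ?M) (restrict g A) (\<lambda>B\<in>children T (Some A). Nu u B g ?p)"
  note dis = anc_sub[OF A]
  obtain f where f: "f \<in> set_pmf ?p" using pmf_ex[of "?p"] by blast
  have rz: "restrict g ?M = restrict z ?M" if "g \<in> set_pmf (sect ?S z r)" for g r
  proof (rule restrict_ext)
    fix i assume "i \<in> ?M"
    then have "i \<notin> ?S" using dis by blast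
    then show "g i = z i" using sect_off[OF that] by simp
  qed
  have "utility T u ?p A (restrict z ?M) = measure_pmf.expectation ?p ?\<Phi>"
    unfolding utility_sect[OF dis f] utility_step[OF f] cond_sect_self[OF dis f] rz[OF f] ..
  also have "\<dots> = measure_pmf.expectation p (\<lambda>h. ?\<Phi> (override_on z h ?S))"
    by (subst (1) sect_def) simp
  also have "\<dots> = measure_pmf.expectation p
      (\<lambda>h. utility T u (sect ?S z (cond_pmf p (cyl A h))) A (restrict z ?M))"
  proof (rule expectation_cong)
    fix h assume h: "h \<in> set_pmf p"
    let ?g = "override_on z h ?S"
    let ?r = "sect ?S z (cond_pmf p (cyl A h))"
    have g: "?g \<in> set_pmf ?p" using h by (simp add: set_sect)
    have r: "?r = cond_pmf ?p (cyl A ?g)" by (rule sect_cond[OF cell_sub h])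
    have gr: "?g \<in> set_pmf ?r" unfolding r using g by simp
    \<comment> \<open>All outcomes of \<open>?r\<close> share their coordinates in \<open>A\<close>
      and in its ancestors, and a child assigns the same value under \<open>?r\<close> as under
      \<open>?p\<close>.\<close>
    have inner: "?\<Phi> ?g = u A (restrict z ?M) (restrict g2 A) (\<lambda>B\<in>children T (Some A). Nu u B g2 ?r)"
      if g2: "g2 \<in> set_pmf ?r" for g2
    proof -
      have g2': "g2 \<in> set_pmf ?p" "g2 \<in> cyl A ?g" using g2 g unfolding r by auto
      have eA: "restrict g2 A = restrict ?g A" by (rule restrict_ext) (use g2'(2) in \<open>simp add: cyl_def\<close>)
      have nB: "Nu u B g2 ?r = Nu u B ?g ?p" if B: "(Some A, Some B) \<in> E" for B
      proof (rule Nu_cong[OF g2 g])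
        show e: "g2 i = ?g i" if "i \<in> anc B" for i
          using that fun_cong[OF rz[OF g2'(1)], of i] fun_cong[OF rz[OF g], of i] g2'(2)
          unfolding anc_child'[OF B] by (auto simp: cyl_def)
        have "cond_pmf ?r (cyl (anc B) g2) = cond_pmf ?p (cyl (A \<union> anc B) g2)"
          unfolding r by (rule cond_cyl_Un[OF g g2'])
        moreover have "A \<union> anc B = anc B" unfolding anc_child'[OF B] by blast
        ultimately have c1: "cond_pmf ?r (cyl (anc B) g2) = cond_pmf ?p (cyl (anc B) g2)" by simp
        have c2: "cyl (anc B) g2 = cyl (anc B) ?g" using e by (auto simp: cyl_def)
        show "marginal (sub B) (cond_pmf ?r (cyl (anc B) g2)) = marginal (sub B) (cond_pmf ?p (cyl (anc B) ?g))"
          by (subst c1, subst c2) (rule refl)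
      qed
      have "(\<lambda>B\<in>children T (Some A). Nu u B g2 ?r) = (\<lambda>B\<in>children T (Some A). Nu u B ?g ?p)"
        by (rule restrict_ext) (simp only: child_iff' nB)
      then show ?thesis by (simp only: eA)
    qed
    have "utility T u ?r A (restrict z ?M) = measure_pmf.expectation ?r
        (\<lambda>g2. u A (restrict z ?M) (restrict g2 A) (\<lambda>B\<in>children T (Some A). Nu u B g2 ?r))"
      unfolding utility_sect[OF dis gr] utility_step[OF gr] cond_sect_self[OF dis gr] rz[OF gr] ..
    also have "\<dots> = measure_pmf.expectation ?r (\<lambda>g2. ?\<Phi> ?g)"
      by (rule expectation_cong) (rule inner[symmetric])
    finally show "?\<Phi> ?g = utility T u ?r A (restrict z ?M)" by simp
  qed
  finally show "utility T u ?p A (restrict z ?M) = \<dots>" .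
qed

text \<open>Once the cell of \<open>v\<close> is frozen, its expectation ranges over a single value,
  so the utility at \<open>v\<close> is a function of the utilities of the children.\<close>

lemma aggregate_cong:
  assumes v: "v \<in> vertices P"
    and e: "\<And>B. (v, Some B) \<in> E \<Longrightarrow> utility T u (sect (sub B) z p) B (restrict z (anc B)) =
      utility T u (sect (sub B) z q) B (restrict z (anc B))"
  shows "vertex_utility T uo u v (restrict z (anc_dims T v)) (sect (below v) z p) =
    vertex_utility T uo u v (restrict z (anc_dims T v)) (sect (below v) z q)"
proof -
  have ch: "anc B \<inter> sub B = {}" "anc B \<inter> below v = {}" "sub B \<subseteq> below v" if B: "(v, Some B) \<in> E" for B
  proof -
    show "anc B \<inter> sub B = {}" by (rule anc_sub[OF child_cell[OF B]])
    show "sub B \<subseteq> below v" unfolding below_children using B child_iff by blast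
    have "anc_dims T v \<inter> dims v = {}"
      using v anc_None anc_disjoint by (auto simp: vertices_def)
    then show "anc B \<inter> below v = {}" unfolding anc_child[OF B] below_def by blast
  qed
  have b: "utility T u (sect (below v) z r) B (restrict z (anc B)) = utility T u (sect (sub B) z r) B (restrict z (anc B))"
    if B: "(v, Some B) \<in> E" for B r
    by (rule utility_sect_cong[OF ch(2)[OF B] ch(1)[OF B] refl])
       (simp only: marginal_sect[OF ch(3)[OF B]] marginal_sect[OF subset_refl])
  have eb: "utility T u (sect (below v) z p) B (restrict z (anc B)) = utility T u (sect (below v) z q) B (restrict z (anc B))"
    if B: "(v, Some B) \<in> E" for B
    unfolding b[OF B] by (rule e[OF B])
  show ?thesis
  proof (cases v)
    case None
    have u: "restrict z (anc B) = (\<lambda>_. undefined)" if B: "(None, Some B) \<in> E" for B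
      using anc_child[OF B] anc_None by (simp add: restrict_def)
    have "(\<lambda>B\<in>children T None. utility T u (sect (below v) z p) B (\<lambda>_. undefined)) =
      (\<lambda>B\<in>children T None. utility T u (sect (below v) z q) B (\<lambda>_. undefined))"
    proof (rule restrict_ext)
      fix B assume "B \<in> children T None"
      then have B: "(None, Some B) \<in> E" using child_iff by simp
      show "utility T u (sect (below v) z p) B (\<lambda>_. undefined) = utility T u (sect (below v) z q) B (\<lambda>_. undefined)"
        using eb[unfolded None, OF B] unfolding u[OF B] None .
    qed
    then show ?thesis by (simp add: vertex_utility_def None)
  next
    case (Some A)
    have A: "A \<in> P" using v Some by (auto simp: vertices_def)
    have dA: "anc A \<inter> below v = {}" using anc_sub[OF A] unfolding Some below_sub[OF A] by blast
    have step: "utility T u (sect (below v) z r) A (restrict z (anc A)) =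
      u A (restrict z (anc A)) (restrict z A)
        (\<lambda>B\<in>children T v. utility T u (sect (below v) z r) B (restrict z (anc B)))" for r
    proof -
      obtain f where f: "f \<in> set_pmf (sect (below v) z r)" using pmf_ex[of "(sect (below v) z r)"] by blast
      have off: "restrict g M = restrict z M" if "g \<in> set_pmf (sect (below v) z r)" "M \<inter> below v = {}" for g M
      proof (rule restrict_ext)
        fix i assume "i \<in> M"
        then have "i \<notin> below v" using that(2) by blast
        then show "g i = z i" using sect_off[OF that(1)] by simp
      qed
      have AM: "A \<inter> below v = {}" unfolding Some below_sub[OF A] by blast
      have "u A (restrict f (anc A)) (restrict g A) (\<lambda>B\<in>children T (Some A). Nu u B g (sect (below v) z r)) =
        u A (restrict z (anc A)) (restrict z A)
        (\<lambda>B\<in>children T v. utility T u (sect (below v) z r) B (restrict z (anc B)))"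
        if g: "g \<in> set_pmf (sect (below v) z r)" for g
      proof -
        have nB: "Nu u B g (sect (below v) z r) = utility T u (sect (below v) z r) B (restrict z (anc B))"
          if "(v, Some B) \<in> E" for B
          unfolding Nu_def off[OF g ch(2)[OF that]] ..
        have "(\<lambda>B\<in>children T v. Nu u B g (sect (below v) z r)) =
          (\<lambda>B\<in>children T v. utility T u (sect (below v) z r) B (restrict z (anc B)))"
          by (rule restrict_ext) (simp only: child_iff nB)
        then have "(\<lambda>B\<in>children T (Some A). Nu u B g (sect (below v) z r)) =
          (\<lambda>B\<in>children T v. utility T u (sect (below v) z r) B (restrict z (anc B)))"
          by (simp only: Some)
        then show ?thesis by (simp only: off[OF f dA] off[OF g AM])
      qed
      then have "Nu u A f (sect (below v) z r) = measure_pmf.expectation (sect (below v) z r)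
        (\<lambda>_. u A (restrict z (anc A)) (restrict z A)
          (\<lambda>B\<in>children T v. utility T u (sect (below v) z r) B (restrict z (anc B))))"
        unfolding utility_step[OF f] cond_sect_self[OF dA f] by (rule expectation_cong)
      then show ?thesis unfolding utility_sect[OF dA f] by simp
    qed
    have "(\<lambda>B\<in>children T v. utility T u (sect (below v) z p) B (restrict z (anc B))) =
      (\<lambda>B\<in>children T v. utility T u (sect (below v) z q) B (restrict z (anc B)))"
      by (rule restrict_ext) (simp only: child_iff eb)
    then show ?thesis unfolding Some vertex_utility_def option.case step[unfolded Some] by (simp only: Some)
  qed
qed

text \<open>Independence holds because recursive utilities read the context only at the ancestors,
  and separability is \<open>aggregate_cong\<close>.\<close>

lemma rep_local_conditions:
  assumes pref: "\<And>p q. p \<in> L \<Longrightarrow> q \<in> L \<Longrightarrow> pref p q \<longleftrightarrow> W q \<le> W p"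
    and rep: "\<And>v z. v \<in> vertices P \<Longrightarrow> z \<in> Z \<Longrightarrow> rep_at Z pref T uo u v z"
  shows local_conditions
  unfolding local_conditions_def
proof (intro conjI ballI)
  have vP: "Some A \<in> vertices P" if "A \<in> P" for A using that by (simp add: vertices_def)
  have re: "repr (sub A) z (\<lambda>p. utility T u (sect (sub A) z p) A (restrict z (anc A)))" if "A \<in> P" "z \<in> Z" for A z
    by (rule rep_repr[OF pref rep[OF vP[OF that(1)] that(2)] that(2)])
  show "Util A (sub A)" if "A \<in> P" for A
    unfolding Util_def using re[OF that] utility_condaff[OF that] by blast
  have ind: "indep (sub B) (anc B)" if B: "B \<in> P" for B
    unfolding indep_def
  proof (intro ballI impI)
    fix z z' p q assume h: "z \<in> Z" "z' \<in> Z" "\<forall>i\<in>anc B. z i = z' i" and p: "p \<in> L" "q \<in> L"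
    have e: "utility T u (sect (sub B) z r) B (restrict z (anc B)) = utility T u (sect (sub B) z' r) B (restrict z' (anc B))" for r
      by (rule utility_sect_cong[OF anc_sub[OF B] anc_sub[OF B]]) (use h(3) in \<open>simp_all add: marginal_sect\<close>)
    show "W (sect (sub B) z p) \<le> W (sect (sub B) z q) \<longleftrightarrow> W (sect (sub B) z' p) \<le> W (sect (sub B) z' q)"
      using repr_le[OF re[OF B h(1)] p] repr_le[OF re[OF B h(2)] p] unfolding e by blast
  qed
  fix v assume v: "v \<in> vertices P"
  show "Sep (anc_dims T v \<union> cell v) (below v) (sub ` children T v)"
    unfolding Sep_def
  proof (intro conjI ballI impI)
    show "partition_on (below v) (sub ` children T v)" by (rule below_partition)
    have indv: "indep (sub B) (anc_dims T v \<union> cell v)" if B: "(v, Some B) \<in> E" for B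
      using ind[OF child_cell[OF B]] unfolding anc_child[OF B] .
    show "indep X (anc_dims T v \<union> cell v)" if "X \<in> sub ` children T v" for X
    proof -
      obtain B where "(v, Some B) \<in> E" "X = sub B" using \<open>X \<in> sub ` children T v\<close> child_iff by blast
      then show ?thesis using indv by simp
    qed
    fix z p q assume z: "z \<in> Z" and p: "p \<in> L" "q \<in> L"
      and h: "\<forall>X\<in>sub ` children T v. \<exists>w\<in>Z. (\<forall>i\<in>anc_dims T v \<union> cell v. w i = z i) \<and> eqv X w p q"
    have "utility T u (sect (sub B) z p) B (restrict z (anc B)) = utility T u (sect (sub B) z q) B (restrict z (anc B))"
      if B: "(v, Some B) \<in> E" for B
    proof -
      have "sub B \<in> sub ` children T v" using B child_iff by blast
      from bspec[OF h this] obtain w where w: "w \<in> Z" "\<forall>i\<in>anc_dims T v \<union> cell v. w i = z i" "eqv (sub B) w p q"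
        by (elim bexE conjE)
      have "eqv (sub B) w p q \<longleftrightarrow> eqv (sub B) z p q"
        by (rule indep_eqv[OF indv[OF B] w(1) z _ p]) (use w(2) in simp)
      then have "eqv (sub B) z p q" using w(3) by simp
      then show ?thesis using repr_eq[OF re[OF child_cell[OF B] z] p] by simp
    qed
    then have ve: "vertex_utility T uo u v (restrict z (anc_dims T v)) (sect (below v) z p) =
        vertex_utility T uo u v (restrict z (anc_dims T v)) (sect (below v) z q)"
      by (rule aggregate_cong[OF v])
    have bd: "below v \<subseteq> dims v" by (auto simp: below_def)
    have o': "W (sect (below v) z r) \<le> W (sect (below v) z s) \<longleftrightarrow>
       vertex_utility T uo u v (restrict z (anc_dims T v)) (sect (below v) z r) \<le>
       vertex_utility T uo u v (restrict z (anc_dims T v)) (sect (below v) z s)" if "r \<in> L" "s \<in> L" for r s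
      using rep_at_order[OF pref rep[OF v z] z sect_in_L[OF z that(1), of "below v"] sect_in_L[OF z that(2), of "below v"]]
      unfolding sect_sub[OF z bd] .
    show "eqv (below v) z p q"
      unfolding eqv_def by (rule order_antisym) (use o'[OF p] o'[OF p(2,1)] ve in simp_all)
  qed
qed

end

lemma sect_full:
  assumes "p \<in> lotteries (PiE I X)" "z \<in> PiE I X"
  shows "sect I z p = p"
proof -
  have "override_on z f I = f" if "f \<in> PiE I X" for f
    using that assms(2) by (auto simp: fun_eq_iff override_on_apply PiE_iff extensional_def)
  then have "sect I z p = map_pmf (\<lambda>f. f) p"
    unfolding sect_def by (intro map_pmf_cong refl) (use lotteriesD(2)[OF assms(1)] in auto)
  then show ?thesis by simp
qed

section \<open>From the conditions on a tree to a representation\<close>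

context rct_pref
begin

lemma sect_full_Z: "p \<in> L \<Longrightarrow> z \<in> Z \<Longrightarrow> sect I z p = p"
  unfolding Z_def by (rule sect_full)

text \<open>Utilities are chosen first, and the aggregators are then defined to be whatever makes
  the recursion return them. The root aggregator is chosen so that the root utility is
  \<open>W\<close> itself.\<close>

lemma local_conditions_rep:
  assumes loc: local_conditions
    and pref: "\<And>p q. p \<in> L \<Longrightarrow> q \<in> L \<Longrightarrow> pref p q \<longleftrightarrow> W q \<le> W p"
  shows "\<exists>uo u. \<forall>v\<in>vertices P. \<forall>z\<in>Z. rep_at Z pref T uo u v z"
proof -
  note botZ = lo_in_Z
  let ?base = "\<lambda>f M. override_on bot_pt f M"
  define Vf where "Vf A z = (SOME V. repr (sub A) z V \<and> condaff L A V)" for A z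
  have Vf: "repr (sub A) z (Vf A z) \<and> condaff L A (Vf A z)" if "A \<in> P" "z \<in> Z" for A z
  proof -
    have "\<exists>V. repr (sub A) z V \<and> condaff L A V"
      using loc that unfolding local_conditions_def Util_def by blast
    then show ?thesis unfolding Vf_def by (rule someI_ex)
  qed
  \<comment> \<open>Coordinates other than those of the ancestors are reset to the bottom point, so
    that the chosen utility depends on the ancestors alone.\<close>
  define V where "V A f = Vf A (?base f (anc A))" for A f
  have Vcong: "V A f = V A g" if "\<And>i. i \<in> anc A \<Longrightarrow> f i = g i" for A f g
  proof -
    have "?base f (anc A) = ?base g (anc A)" using that by (auto simp: fun_eq_iff override_on_apply)
    then show ?thesis by (simp add: V_def)
  qed
  have SepA: "Sep (anc_dims T v \<union> cell v) (below v) (sub ` children T v)" if "v \<in> vertices P" for v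
    using loc that unfolding local_conditions_def by blast
  define ok where "ok A x y t q r \<longleftrightarrow> q \<in> L \<and> (\<forall>g\<in>set_pmf q. \<forall>i\<in>A. g i = y i) \<and>
    (\<forall>B\<in>children T (Some A). V B (override_on x y A) q = t B) \<and> r = V A x q" for A x y t q r
  \<comment> \<open>The value of an aggregator is read off any lottery realising the utilities \<open>t\<close> of the children;
    separability makes it independent of that lottery.\<close>
  define u :: aggregators where "u A x y t = (SOME r. \<exists>q. ok A x y t q r)" for A x y t
  define uo where "uo t = (SOME r. \<exists>q\<in>L. (\<forall>B\<in>children T None. V B bot_pt q = t B) \<and> r = W q)" for t
  have agg: "u A (restrict f (anc A)) (restrict g A) (\<lambda>B\<in>children T (Some A). V B g p) = V A f p"
    if A: "A \<in> P" and fg: "f \<in> Z" "g \<in> Z" "\<And>i. i \<in> anc A \<Longrightarrow> f i = g i" and p: "p \<in> L"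
      and pg: "\<And>h i. h \<in> set_pmf p \<Longrightarrow> i \<in> A \<Longrightarrow> h i = g i" for A f g p
  proof -
    let ?x = "restrict f (anc A)" and ?y = "restrict g A" and ?t = "\<lambda>B\<in>children T (Some A). V B g p"
    have Vx: "V A ?x = V A f" by (rule Vcong) simp
    have Vxy: "V B (override_on ?x ?y A) = V B g" if "(Some A, Some B) \<in> E" for B
      by (rule Vcong) (use fg(3) anc_child'[OF that] in \<open>auto simp: override_on_apply\<close>)
    have okp: "ok A ?x ?y ?t p (V A f p)"
      unfolding ok_def
    proof (intro conjI ballI p)
      show "h i = ?y i" if "h \<in> set_pmf p" "i \<in> A" for h i using pg[OF that] that(2) by simp
      show "V B (override_on ?x ?y A) p = ?t B" if "B \<in> children T (Some A)" for B
        using that Vxy[of B] child_iff' by simp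
      show "V A f p = V A ?x p" by (simp only: Vx)
    qed
    have uniq: "r = V A f p" if r: "ok A ?x ?y ?t q r" for q r
    proof -
      have q: "q \<in> L" and qg: "\<And>h i. h \<in> set_pmf q \<Longrightarrow> i \<in> A \<Longrightarrow> h i = g i"
        and qV: "\<And>B. B \<in> children T (Some A) \<Longrightarrow> V B (override_on ?x ?y A) q = ?t B"
        and rq: "r = V A f q"
        using r unfolding ok_def Vx by auto
      let ?z2 = "?base g (anc A \<union> A)" and ?z = "?base f (anc A)"
      have z2: "?z2 \<in> Z" and z: "?z \<in> Z" using botZ fg by simp_all
      have AV: "Some A \<in> vertices P" using A by (simp add: vertices_def)
      have "eqv (below (Some A)) ?z2 q p"
      proof (rule Sep_eqv'[OF SepA[OF AV] z2 q p])
        fix X assume "X \<in> sub ` children T (Some A)"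
        then obtain B where B: "B \<in> children T (Some A)" "X = sub B" by blast
        then have BE: "(Some A, Some B) \<in> E" using child_iff' by simp
        have "V B g q = V B g p" using qV[OF B(1)] B(1) unfolding Vxy[OF BE] by simp
        moreover have "repr (sub B) ?z2 (V B g)"
          using Vf[OF child_cell[OF BE] z2] unfolding V_def anc_child'[OF BE] by simp
        ultimately show "eqv X ?z2 q p" using repr_eq[OF _ q p] B(2) by blast
      qed
      \<comment> \<open>For a lottery whose coordinates in \<open>A\<close> are sure, the subtree
        reduces to what lies below \<open>A\<close>, at the context enlarged by these
        coordinates.\<close>
      moreover have "sect (below (Some A)) ?z2 s = sect (sub A) ?z s"
        if s: "\<And>h i. h \<in> set_pmf s \<Longrightarrow> i \<in> A \<Longrightarrow> h i = g i" for s
      proof (rule sect_cong_set, rule ext)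
        fix h i assume h: "h \<in> set_pmf s"
        have d: "i \<notin> sub A" if "i \<in> anc A" using anc_sub[OF A] that by blast
        show "override_on ?z2 h (below (Some A)) i = override_on ?z h (sub A) i"
          using s[OF h, of i] d fg(3)[of i] cell_sub[of A] unfolding below_sub[OF A]
          by (auto simp: override_on_apply)
      qed
      ultimately have "eqv (sub A) ?z q p" using qg pg unfolding eqv_def by metis
      moreover have "repr (sub A) ?z (V A f)" using Vf[OF A z] unfolding V_def by simp
      ultimately have "V A f q = V A f p" using repr_eq[OF _ q p] by blast
      then show ?thesis using rq by simp
    qed
    show ?thesis unfolding u_def
      by (rule some_equality) (use okp uniq in blast)+
  qed
  have zV: "repr (sub A) z (V A z)" "condaff L A (V A z)" if A: "A \<in> P" and z: "z \<in> Z" for A z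
  proof -
    have b: "?base z (anc A) \<in> Z" using botZ z by simp
    have "repr (sub A) (?base z (anc A)) (V A z)" using Vf[OF A b] unfolding V_def by simp
    then show "repr (sub A) z (V A z)"
      by (rule repr_context[OF _ anc_indep[OF loc A] b z]) (simp add: override_on_apply)
    show "condaff L A (V A z)" using Vf[OF A b] unfolding V_def by simp
  qed
  \<comment> \<open>By induction from the leaves: \<open>agg\<close> evaluates the integrand at each
    value of the cell, and \<open>condaff\<close> averages the results back to the chosen
    utility.\<close>
  have main: "Nu u A f p = V A f (cond_pmf p (cyl (anc A) f))"
    if "A \<in> P" "p \<in> L" "f \<in> set_pmf p" for A f p
    using that
  proof (induction A arbitrary: f rule: wf_induct_rule[OF cell_wf])
    case (1 A)
    let ?p = "cond_pmf p (cyl (anc A) f)"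
    have fZ: "f \<in> Z" using lotteriesD(2)[OF 1(3,4)] .
    have pL: "?p \<in> L" by (rule cond_in_lotteries[OF 1(3,4)])
    have "Nu u A f p = measure_pmf.expectation ?p
      (\<lambda>g. u A (restrict f (anc A)) (restrict g A) (\<lambda>B\<in>children T (Some A). Nu u B g p))"
      by (rule utility_step[OF 1(4)])
    also have "\<dots> = measure_pmf.expectation ?p (\<lambda>g. V A f (cond_pmf ?p (cyl A g)))"
    proof (rule expectation_cong)
      fix g assume g: "g \<in> set_pmf ?p"
      then have gp: "g \<in> set_pmf p" "g \<in> cyl (anc A) f" using 1(4) by auto
      have nB: "Nu u B g p = V B g (cond_pmf ?p (cyl A g))" if B: "(Some A, Some B) \<in> E" for B
      proof -
        have "Nu u B g p = V B g (cond_pmf p (cyl (anc B) g))"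
          by (rule 1(1)) (use B child_cell[OF B] 1(3) gp in auto)
        then show ?thesis by (simp only: cond_cyl_Un[OF 1(4) gp] anc_child'[OF B])
      qed
      have e: "(\<lambda>B\<in>children T (Some A). Nu u B g p) = (\<lambda>B\<in>children T (Some A). V B g (cond_pmf ?p (cyl A g)))"
        by (rule restrict_ext) (simp only: child_iff' nB)
      show "u A (restrict f (anc A)) (restrict g A) (\<lambda>B\<in>children T (Some A). Nu u B g p) =
          V A f (cond_pmf ?p (cyl A g))"
        unfolding e
      proof (rule agg[OF 1(2) fZ lotteriesD(2)[OF 1(3) gp(1)] _ cond_in_lotteries[OF pL g]])
        show "f i = g i" if "i \<in> anc A" for i using gp(2) that by (simp add: cyl_def)
        show "h i = g i" if "h \<in> set_pmf (cond_pmf ?p (cyl A g))" "i \<in> A" for h i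
        proof -
          have "h \<in> cyl A g" using that(1) g by simp
          then show ?thesis using that(2) by (simp add: cyl_def)
        qed
      qed
    qed
    also have "\<dots> = V A f ?p" using zV(2)[OF 1(2) fZ] pL unfolding condaff_def by simp
    finally show ?case .
  qed
  have cellU: "utility T u (sect (sub A) z p) A (restrict z (anc A)) = V A z p"
    if A: "A \<in> P" and z: "z \<in> Z" and p: "p \<in> L" for A z p
  proof -
    let ?p = "sect (sub A) z p"
    have pL: "?p \<in> L" using z p by simp
    obtain f where f: "f \<in> set_pmf ?p" using pmf_ex[of ?p] by blast
    have "utility T u ?p A (restrict z (anc A)) = V A f (cond_pmf ?p (cyl (anc A) f))"
      unfolding utility_sect[OF anc_sub[OF A] f] by (rule main[OF A pL f])
    also have "\<dots> = V A f ?p" by (simp only: cond_sect_self[OF anc_sub[OF A] f])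
    also have "V A f = V A z"
    proof (rule Vcong)
      fix i assume "i \<in> anc A"
      then have "i \<notin> sub A" using anc_sub[OF A] by blast
      then show "f i = z i" by (rule sect_off[OF f])
    qed
    also have "V A z ?p = V A z p" by (rule repr_sect[OF zV(1)[OF A z] z p])
    finally show ?thesis .
  qed
  have rootU: "vertex_utility T uo u None x p = W p" if p: "p \<in> L" for x p
  proof -
    obtain f where f: "f \<in> set_pmf p" using pmf_ex[of p] by blast
    let ?t = "\<lambda>B\<in>children T None. utility T u p B (\<lambda>_. undefined)"
    have ut: "utility T u p B (\<lambda>_. undefined) = V B bot_pt p" if B: "(None, Some B) \<in> E" for B
    proof -
      have a: "anc B = {}" using anc_child[OF B] anc_None by simp
      have "utility T u p B (\<lambda>_. undefined) = Nu u B f p" by (simp add: Nu_def a restrict_def)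
      also have "\<dots> = V B f (cond_pmf p (cyl (anc B) f))" by (rule main[OF child_cell[OF B] p f])
      also have "cond_pmf p (cyl (anc B) f) = p" by (rule cond_pmf_eq_self) (simp add: a cyl_def)
      also have "V B f = V B bot_pt" by (rule Vcong) (simp add: a)
      finally show ?thesis .
    qed
    have tB: "?t B = V B bot_pt p" if "B \<in> children T None" for B
      using that ut[of B] child_iff by simp
    have nv: "None \<in> vertices P" by (simp add: vertices_def)
    have "uo ?t = W p"
      unfolding uo_def
    proof (rule some_equality)
      show "\<exists>q\<in>L. (\<forall>B\<in>children T None. V B bot_pt q = ?t B) \<and> W p = W q"
        using p tB by (intro bexI[of _ p]) simp_all
      fix r assume "\<exists>q\<in>L. (\<forall>B\<in>children T None. V B bot_pt q = ?t B) \<and> r = W q"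
      then obtain q where q: "q \<in> L" "\<And>B. B \<in> children T None \<Longrightarrow> V B bot_pt q = ?t B" "r = W q" by blast
      have "eqv (below None) bot_pt q p"
      proof (rule Sep_eqv'[OF SepA[OF nv] botZ q(1) p])
        fix X assume "X \<in> sub ` children T None"
        then obtain B where B: "B \<in> children T None" "X = sub B" by blast
        then have BE: "(None, Some B) \<in> E" using child_iff by simp
        have "V B bot_pt q = V B bot_pt p" using q(2)[OF B(1)] tB[OF B(1)] by simp
        then show "eqv X bot_pt q p" using repr_eq[OF zV(1)[OF child_cell[OF BE] botZ] q(1) p] B(2) by simp
      qed
      then have "W q = W p" unfolding below_None eqv_def sect_full_Z[OF q(1) botZ] sect_full_Z[OF p botZ] .
      then show "r = W p" using q(3) by simp
    qed
    then show ?thesis by (simp add: vertex_utility_def)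
  qed
  have uniform: "rep_at Z pref T uo u v z"
    if VV: "\<And>p. p \<in> L \<Longrightarrow> vertex_utility T uo u v (restrict z (anc_dims T v)) (sect (dims v) z p) = VV p"
      "repr (dims v) z VV" and z: "z \<in> Z" for v z VV
    unfolding rep_at_def Let_def
  proof (intro conjI ballI impI)
    fix p q assume p: "p \<in> L" and q: "q \<in> L"
    show "pref (sect (dims v) z p) (sect (dims v) z q) \<longleftrightarrow>
      vertex_utility T uo u v (restrict z (anc_dims T v)) (sect (dims v) z q) \<le>
      vertex_utility T uo u v (restrict z (anc_dims T v)) (sect (dims v) z p)"
      using pref[OF sect_in_L[OF z p] sect_in_L[OF z q], of "dims v" "dims v"] repr_le[OF VV(2) q p] VV(1)[OF p] VV(1)[OF q]
      by simp
  next
    have e: "vertex_utility T uo u v (restrict z (anc_dims T v)) (return_pmf (override_on z y (dims v))) = VV (return_pmf y)"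
      if "y \<in> Z" for y
      using VV(1)[of "return_pmf y"] that by simp
    show "continuous_on Z (\<lambda>y. vertex_utility T uo u v (restrict z (anc_dims T v)) (return_pmf (override_on z y (dims v))))"
      using VV(2) e unfolding repr_def by (simp cong: continuous_on_cong)
    fix y y' assume y: "y \<in> Z" "y' \<in> Z" and le: "\<forall>i\<in>dims v. y i \<le> y' i" and lt: "\<exists>i\<in>dims v. y i < y' i"
    obtain i where "i \<in> dims v" "y i < y' i" using lt by blast
    then have "VV (return_pmf y) < VV (return_pmf y')"
      by (intro repr_strict_mono[OF VV(2) z y, of i]) (use le in auto)
    then show "vertex_utility T uo u v (restrict z (anc_dims T v)) (return_pmf (override_on z y (dims v))) <
      vertex_utility T uo u v (restrict z (anc_dims T v)) (return_pmf (override_on z y' (dims v)))"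
      using e y by simp
  qed
  have "rep_at Z pref T uo u v z" if v: "v \<in> vertices P" and z: "z \<in> Z" for v z
  proof (cases v)
    case None
    show ?thesis unfolding None
    proof (rule uniform[OF _ _ z])
      show "repr (dims None) z (\<lambda>p. W (sect (dims None) z p))" by (rule repr_W[OF z])
      show "vertex_utility T uo u None (restrict z (anc_dims T None)) (sect (dims None) z p) = W (sect (dims None) z p)"
        if "p \<in> L" for p
        by (rule rootU) (use z that in simp)
    qed
  next
    case (Some A)
    then have A: "A \<in> P" using v by (auto simp: vertices_def)
    show ?thesis unfolding Some
    proof (rule uniform[OF _ zV(1)[OF A z] z])
      show "vertex_utility T uo u (Some A) (restrict z (anc A)) (sect (sub A) z p) = V A z p" if "p \<in> L" for p
        unfolding vertex_utility_def option.case by (rule cellU[OF A z that])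
    qed
  qed
  then show ?thesis by blast
qed

end

section \<open>Translation to preorders and conclusion\<close>

lemma (in lottery_pref) smeu_trees_iff:
  assumes pref: "\<And>p q. p \<in> L \<Longrightarrow> q \<in> L \<Longrightarrow> pref p q \<longleftrightarrow> W q \<le> W p"
  shows "T \<in> smeu_trees I (\<lambda>i. {lo i..hi i}) pref \<longleftrightarrow> is_rct I T \<and> good {} I (tree_rel T)"
proof (cases "is_rct I T")
  case True
  interpret rct_pref I lo hi W T
    by unfold_locales (fact True finite_I)+
  note iff = smeu_rep_iff[OF lo_in_Z[unfolded Z_def] finite_I, of pref T, folded Z_def]
  have "T \<in> smeu_trees I (\<lambda>i. {lo i..hi i}) pref \<longleftrightarrow> (\<exists>uo u. \<forall>v\<in>vertices P. \<forall>z\<in>Z. rep_at Z pref T uo u v z)"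
    unfolding smeu_trees_def mem_Collect_eq iff using True by blast
  also have "\<dots> \<longleftrightarrow> local_conditions"
  proof
    assume "\<exists>uo u. \<forall>v\<in>vertices P. \<forall>z\<in>Z. rep_at Z pref T uo u v z"
    then obtain uo u where "\<forall>v\<in>vertices P. \<forall>z\<in>Z. rep_at Z pref T uo u v z" by blast
    then show local_conditions by (intro rep_local_conditions[OF pref]) blast+
  next
    assume local_conditions
    then show "\<exists>uo u. \<forall>v\<in>vertices P. \<forall>z\<in>Z. rep_at Z pref T uo u v z"
      by (rule local_conditions_rep) (rule pref)
  qed
  also have "\<dots> \<longleftrightarrow> good {} I (tree_rel T)" by (rule local_conditions_iff)
  finally show ?thesis using True by blast
next
  case False
  then show ?thesis by (simp add: smeu_trees_def smeu_rep_def)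
qed

text \<open>Refinement of cells means that dimensions equivalent in \<open>T'\<close> are equivalent
  in \<open>T\<close>; as the left-hand side is symmetric, relatedness in one direction
  suffices.\<close>

lemma simpler_iff:
  assumes "is_rct I T" "is_rct I T'" "finite I"
  shows "simpler I T T' \<longleftrightarrow> (\<forall>i\<in>I. dep (tree_rel T) i \<le> dep (tree_rel T') i) \<and>
    ((\<forall>i\<in>I. dep (tree_rel T) i = dep (tree_rel T') i) \<longrightarrow> tree_rel T' \<inter> (tree_rel T')\<inverse> \<subseteq> tree_rel T)"
proof -
  interpret T: rct I T by unfold_locales fact+
  interpret T': rct I T' by unfold_locales fact+
  have "refines I (fst T') (fst T) \<longleftrightarrow> tree_rel T' \<inter> (tree_rel T')\<inverse> \<subseteq> tree_rel T"
  proof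
    assume r: "refines I (fst T') (fst T)"
    show "tree_rel T' \<inter> (tree_rel T')\<inverse> \<subseteq> tree_rel T"
    proof
      fix x assume "x \<in> tree_rel T' \<inter> (tree_rel T')\<inverse>"
      then obtain i j where x: "x = (i, j)" "(i, j) \<in> tree_rel T'" "(j, i) \<in> tree_rel T'" by (cases x) auto
      obtain A where A: "A \<in> fst T'" "i \<in> A" using x(2) by (auto elim: T'.tree_relE)
      have "j \<in> A" using T'.cell_eq[OF A] x by blast
      moreover obtain B where B: "B \<in> fst T" "A \<subseteq> B" using r A(1) unfolding refines_def by blast
      ultimately have "i \<in> B" "j \<in> B" using A by blast+
      then show "x \<in> tree_rel T" using T.cell_eq[OF B(1)] x(1) by blast
    qed
  next
    assume s: "tree_rel T' \<inter> (tree_rel T')\<inverse> \<subseteq> tree_rel T"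
    show "refines I (fst T') (fst T)"
      unfolding refines_def
    proof (intro conjI ballI T.partP T'.partP)
      fix A assume A: "A \<in> fst T'"
      then obtain i where i: "i \<in> A" using T'.cell_ne by blast
      then obtain B where B: "B \<in> fst T" "i \<in> B"
        using partition_ex[OF T.partP] T'.cell_in_I[OF A] by blast
      have "A \<subseteq> B"
      proof
        fix j assume "j \<in> A"
        then have j: "(i, j) \<in> tree_rel T'" "(j, i) \<in> tree_rel T'" using T'.cell_eq[OF A i] by blast+
        then have "(i, j) \<in> tree_rel T" "(j, i) \<in> tree_rel T" using s by blast+
        then show "j \<in> B" using T.cell_eq[OF B] by blast
      qed
      then show "\<exists>B\<in>fst T. A \<subseteq> B" using B(1) by blast
    qed
  qed
  then show ?thesis
    unfolding simpler_def using T.depth_eq_dep T'.depth_eq_dep by simp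
qed

theorem theorem1:
  fixes N :: nat and lo hi :: "nat \<Rightarrow> real"
    and pref :: "point pmf \<Rightarrow> point pmf \<Rightarrow> bool"
  defines "I \<equiv> {1..N}" and "X \<equiv> (\<lambda>i. {lo i..hi i})"
  assumes "N > 1"
    and "\<And>i. i \<in> I \<Longrightarrow> lo i < hi i"
    and "\<exists>T uo u. smeu_rep I X pref T uo u"
  shows "\<exists>!T. T \<in> smeu_trees I X pref \<and> (\<forall>T'\<in>smeu_trees I X pref. simpler I T T')"
proof -
  have fin: "finite I" by (simp add: I_def)
  let ?Z = "PiE I X"
  have b: "restrict lo I \<in> ?Z" using assms(4) by (auto simp: X_def intro!: less_imp_le)
  obtain T0 uo0 u0 where rep: "smeu_rep I X pref T0 uo0 u0" using assms(5) by blast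
  note rep0 = rep[unfolded smeu_rep_iff[OF b fin]]
  interpret T0: rct I T0 by unfold_locales (use rep0 fin in auto)
  \<comment> \<open>The root utility of the given representation. It represents the preference on
    lotteries, so every other tree can be judged by it too.\<close>
  define W where "W = vertex_utility T0 uo0 u0 None (\<lambda>_. undefined)"
  have root: "rep_at ?Z pref T0 uo0 u0 None (restrict lo I)"
    using rep0 b by (simp add: vertices_def)
  have e: "restrict (restrict lo I) {} = (\<lambda>_. undefined)" by (simp add: restrict_def)
  have sf: "sect I (restrict lo I) p = p" if "p \<in> lotteries ?Z" for p by (rule sect_full[OF that b])
  note r = root[unfolded rep_at_def Let_def T0.sub_root T0.anc_None e, folded W_def]
  have ov: "override_on (restrict lo I) y I = y" if "y \<in> ?Z" for y
    using sf[of "return_pmf y"] that by simp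
  have pref: "pref p q \<longleftrightarrow> W q \<le> W p" if "p \<in> lotteries ?Z" "q \<in> lotteries ?Z" for p q
    using bspec[OF bspec[OF conjunct1[OF r] that(1)] that(2)] unfolding sf[OF that(1)] sf[OF that(2)] .
  have cont: "continuous_on ?Z (\<lambda>y. W (return_pmf y))"
    using conjunct1[OF conjunct2[OF r]] ov by (simp cong: continuous_on_cong)
  have mono: "strict_mono_on ?Z (\<lambda>y. W (return_pmf y))"
  proof (rule strict_mono_onI)
    fix y y' assume y: "y \<in> ?Z" "y' \<in> ?Z" "y < y'"
    have le: "\<forall>i\<in>I. y i \<le> y' i" using y(3) by (auto simp: less_fun_def le_fun_def)
    obtain i where i: "y i < y' i" using y(3) by (auto simp: less_fun_def le_fun_def not_le)
    then have "i \<in> I" using y(1,2) by (cases "i \<in> I") (auto simp: PiE_iff extensional_def)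
    then have lt: "\<exists>i\<in>I. y i < y' i" using i by blast
    show "W (return_pmf y) < W (return_pmf y')"
      using mp[OF mp[OF bspec[OF bspec[OF conjunct2[OF conjunct2[OF r]] y(1)] y(2)] le] lt]
      unfolding ov[OF y(1)] ov[OF y(2)] .
  qed
  interpret lottery_pref I lo hi W
    by unfold_locales (use fin assms(4) cont mono in \<open>simp_all add: X_def\<close>)
  have ZX: "?Z = Z" by (simp add: Z_def X_def)
  have trees: "T \<in> smeu_trees I X pref \<longleftrightarrow> is_rct I T \<and> good {} I (tree_rel T)" for T
    unfolding X_def by (rule smeu_trees_iff) (rule pref[unfolded ZX])
  have "T0 \<in> smeu_trees I X pref" using rep by (auto simp: smeu_trees_def)
  then have g0: "good {} I (tree_rel T0)" using trees by blast
  \<comment> \<open>Restricting the given tree to an arbitrary \<open>S\<close> yields the certainty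
    equivalents on \<open>S\<close>.\<close>
  interpret lottery_pref_ce I lo hi W
  proof unfold_locales
    fix S z p assume S: "S \<subseteq> I" and z: "z \<in> Z" "p \<in> L"
    show "\<exists>y\<in>Z. eqv S z p (return_pmf y)"
      by (rule good_certainty_equivalent[OF good_restrict[OF g0 S] z])
  qed
  have "indep I {}"
    unfolding indep_def
  proof (intro ballI impI)
    fix z z' p q assume "z \<in> Z" "z' \<in> Z"
    then have "sect I z r = sect I z' r" for r by (intro sect_cong) auto
    then show "W (sect I z p) \<le> W (sect I z q) \<longleftrightarrow> W (sect I z' p) \<le> W (sect I z' q)" by simp
  qed
  then obtain Q where Q: "good {} I Q" "\<And>R. good {} I R \<Longrightarrow> best I Q R"
    using simplest_exists[OF subset_refl _ _ g0] by blast
  interpret Q: forest_preorder I Q by (rule good_forest_preorder[OF Q(1)])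
  let ?T = "(Q.cl ` I, Q.tree_edges)"
  have T: "is_rct I ?T" "tree_rel ?T = Q" by (rule Q.tree_is_rct, rule Q.tree_rel_tree)
  have simplest: "simpler I ?T T'" if "T' \<in> smeu_trees I X pref" for T'
  proof -
    have T': "is_rct I T'" "good {} I (tree_rel T')" using that trees by blast+
    show ?thesis
      unfolding simpler_iff[OF T(1) T'(1) fin] T(2) using Q(2)[OF T'(2)] unfolding best_def by blast
  qed
  show ?thesis
  proof (rule ex1I[of _ ?T])
    have mem: "?T \<in> smeu_trees I X pref" using trees T Q(1) by simp
    then show "?T \<in> smeu_trees I X pref \<and> (\<forall>T'\<in>smeu_trees I X pref. simpler I ?T T')" using simplest by blast
    fix T' assume T': "T' \<in> smeu_trees I X pref \<and> (\<forall>T''\<in>smeu_trees I X pref. simpler I T' T'')"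
    then have h: "is_rct I T'" "good {} I (tree_rel T')" using trees by blast+
    \<comment> \<open>Simplicity in both directions gives equal depths and equal cells; the last
      conjunct of \<open>best\<close> then identifies the preorders, and these determine the
      trees.\<close>
    have "simpler I T' ?T" using T' mem by blast
    then have s: "(\<forall>i\<in>I. dep (tree_rel T') i \<le> dep Q i) \<and>
      ((\<forall>i\<in>I. dep (tree_rel T') i = dep Q i) \<longrightarrow> Q \<inter> Q\<inverse> \<subseteq> tree_rel T')"
      unfolding simpler_iff[OF h(1) T(1) fin] T(2) .
    have bQ: "best I Q (tree_rel T')" by (rule Q(2)[OF h(2)])
    then have "\<forall>i\<in>I. dep Q i \<le> dep (tree_rel T') i" unfolding best_def by blast
    then have eq: "\<forall>i\<in>I. dep Q i = dep (tree_rel T') i" using s by (meson order_antisym)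
    then have "Q \<inter> Q\<inverse> \<subseteq> tree_rel T'" using s by simp
    then have "tree_rel T' = Q" using bQ eq unfolding best_def by blast
    then show "T' = ?T" by (intro rct_eqI[OF h(1) T(1) fin]) (simp only: T(2))
  qed
qed

end
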